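(* Let $\epsilon>0$. For every $u_0^\epsilon\in W^{2,1}(\mathcal A)$ satisfying $$\beta_i\big(-\lambda_i u^\epsilon_{0i}(N)+\epsilon (u^\epsilon_{0i})_x(N)\big)=\sum_{j\in\mathcal M}K_{ij}\big(u^\epsilon_{0j}(N)-u^\epsilon_{0i}(N)\big)\qquad\forall i\in\mathcal M,$$ there exists a unique solution $u^\epsilon\in C([0,+\infty);W^{2,1}(\mathcal A))\cap C^1([0,+\infty);L^1(\mathcal A))$ of the problem $$\begin{cases}(u_i^\epsilon)_t=-\lambda_i(u_i^\epsilon)_x+\epsilon(u_i^\epsilon)_{xx}, & x\in I_i,\ t>0,\ i\in\mathcal M,\\ u_i^\epsilon(x,0)=u^\epsilon_{0i}(x), & x\in I_i,\ i\in\mathcal M,\\ \beta_i\big(-\lambda_iu_i^\epsilon(N,t)+\epsilon(u_i^\epsilon)_x(N,t)\big)=\sum_{j\in\mathcal M}K_{ij}\big(u_j^\epsilon(N,t)-u_i^\epsilon(N,t)\big), & t>0,\ i\in\mathcal M,\\ u_i^\epsilon(e_i,t)=u^\epsilon_{0i}(e_i), & t>0,\ i\in\mathcal M,\end{cases}$$ and this solution is given by $$u^\epsilon(t)=\tau_\epsilon(t)(u_0^\epsilon-q)+\int_0^t\tau_\epsilon(t-s)F\,ds+q .$$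
   Context: Network. $\mathcal M=\{1,\dots,m\}$ is the disjoint union of two nonempty sets $\mathcal I$ (arcs incoming in the inner node $N$) and $\mathcal O$ (arcs outgoing from $N$). For $i\in\mathcal M$, $L_i>0$, $I_i=(0,L_i)$, $\lambda_i>0$. For a function $f_i$ on $I_i$, $f_i(N)$ means $f_i(L_i)$ if $i\in\mathcal I$ and $f_i(0)$ if $i\in\mathcal O$, while $f_i(e_i)$ means $f_i(0)$ if $i\in\mathcal I$ and $f_i(L_i)$ if $i\in\mathcal O$ (similarly for derivatives and for functions of $(x,t)$). Set $\beta_i=1$ if $i\in\mathcal I$, $\beta_i=-1$ if $i\in\mathcal O$. The coefficients $K_{ij}$ ($i,j\in\mathcal M$) satisfy $K_{ij}\ge0$ and $K_{ij}=K_{ji}$. Set $\alpha_{ij}=-K_{ij}$ for $i\ne j$ and $\alpha_{ii}=\sum_{j\in\mathcal M,j\neq i}K_{ij}$. Spaces. $L^p(\mathcal A)$ and $W^{k,p}(\mathcal A)$ are the spaces of $m$-tuples $f=(f_1,\dots,f_m)$ with $f_i\in L^p(I_i)$, resp. $f_i\in W^{k,p}(I_i)$, with norm $\|f\|=\sum_{i\in\mathcal M}\|f_i\|$. A solution is a function in $C([0,+\infty);W^{2,1}(\mathcal A))\cap C^1([0,+\infty);L^1(\mathcal A))$ which solves the equation in the strong sense and verifies the initial, boundary and transmission conditions. $q=\{q_i\}_{i\in\mathcal M}$ is any fixed family with $q_i\in C^\infty([0,L_i])$, $q_i(e_i)=u^\epsilon_{0i}(e_i)$, $q_i(N)=q_i'(N)=0$;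 $F=\{F_i\}_{i\in\mathcal M}$ with $F_i=\epsilon q_i''-\lambda_iq_i'$. $A_0^\epsilon$ is the operator in $L^1(\mathcal A)$ with domain $D(A_0^\epsilon)=\{w\in W^{2,1}(\mathcal A): w_i(e_i)=0,\ \beta_i(\lambda_iw_i(N)-\epsilon (w_i)_x(N))=\sum_{j\in\mathcal M}\alpha_{ij}w_j(N)\ \forall i\in\mathcal M\}$ and $A_0^\epsilon w=\{\epsilon (w_i)_{xx}-\lambda_i(w_i)_x\}_{i\in\mathcal M}$; it is densely defined and m-dissipative, and $\tau_\epsilon$ denotes the linear contraction semigroup it generates in $L^1(\mathcal A)$. *)

theory Defs
  imports "HOL-Analysis.Analysis"
begin

text \<open>
  Arcs are indexed by a finite type \<open>'m\<close>. The type \<open>'m l1\<close> consists of the tuples of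
  Lebesgue integrable functions on the real line, indexed by \<open>'m\<close> and taken up to equality almost
  everywhere, with the norm that is the sum of the \<open>L\<^sup>1\<close> norms of the components.
  Since the lengths of the arcs are terms, not types, the space \<open>L\<^sup>1\<close> of the network is the closed
  subspace \<open>L1A\<close> below of the tuples whose \<open>i\<close>-th component vanishes outside the \<open>i\<close>-th arc
  (extension by zero).
\<close>

definition l1rel :: "('m \<Rightarrow> real \<Rightarrow> real) \<Rightarrow> ('m \<Rightarrow> real \<Rightarrow> real) \<Rightarrow> bool" where
  "l1rel f g \<longleftrightarrow> (\<forall>i. integrable lborel (f i)) \<and> (\<forall>i. integrable lborel (g i)) \<and>
     (\<forall>i. AE x in lborel. f i x = g i x)"

quotient_type 'm l1 = "'m \<Rightarrow> real \<Rightarrow> real" / partial: l1rel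
proof (rule part_equivpI)
  show "\<exists>x. l1rel x (x :: 'm \<Rightarrow> real \<Rightarrow> real)"
    by (rule exI[of _ "\<lambda>i x. 0"]) (simp add: l1rel_def)
  show "symp (l1rel :: ('m \<Rightarrow> real \<Rightarrow> real) \<Rightarrow> _)"
    by (auto simp: symp_def l1rel_def eq_commute)
  show "transp (l1rel :: ('m \<Rightarrow> real \<Rightarrow> real) \<Rightarrow> _)"
  proof (rule transpI)
    fix f g h :: "'m \<Rightarrow> real \<Rightarrow> real"
    assume *: "l1rel f g" "l1rel g h"
    have "AE x in lborel. f i x = h i x" for i
    proof -
      have "AE x in lborel. f i x = g i x" "AE x in lborel. g i x = h i x"
        using * by (auto simp: l1rel_def)
      then show ?thesis by eventually_elim simp
    qed
    then show "l1rel f h" using * by (auto simp: l1rel_def)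
  qed
qed

instantiation l1 :: (finite) real_normed_vector
begin

lift_definition zero_l1 :: "'a l1" is "\<lambda>i x. 0"
  by (simp add: l1rel_def)

lift_definition plus_l1 :: "'a l1 \<Rightarrow> 'a l1 \<Rightarrow> 'a l1" is "\<lambda>f g i x. f i x + g i x"
  unfolding l1rel_def
proof (intro conjI allI; (elim conjE)?)
  fix f1 f2 g1 g2 :: "'a \<Rightarrow> real \<Rightarrow> real" and i
  assume "\<forall>i. AE x in lborel. f1 i x = f2 i x" "\<forall>i. AE x in lborel. g1 i x = g2 i x"
  then have "AE x in lborel. f1 i x = f2 i x" "AE x in lborel. g1 i x = g2 i x" by auto
  then show "AE x in lborel. f1 i x + g1 i x = f2 i x + g2 i x" by eventually_elim simp
qed auto

lift_definition uminus_l1 :: "'a l1 \<Rightarrow> 'a l1" is "\<lambda>f i x. - f i x"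
  unfolding l1rel_def by auto

lift_definition minus_l1 :: "'a l1 \<Rightarrow> 'a l1 \<Rightarrow> 'a l1" is "\<lambda>f g i x. f i x - g i x"
  unfolding l1rel_def
proof (intro conjI allI; (elim conjE)?)
  fix f1 f2 g1 g2 :: "'a \<Rightarrow> real \<Rightarrow> real" and i
  assume "\<forall>i. AE x in lborel. f1 i x = f2 i x" "\<forall>i. AE x in lborel. g1 i x = g2 i x"
  then have "AE x in lborel. f1 i x = f2 i x" "AE x in lborel. g1 i x = g2 i x" by auto
  then show "AE x in lborel. f1 i x - g1 i x = f2 i x - g2 i x" by eventually_elim simp
qed auto

lift_definition scaleR_l1 :: "real \<Rightarrow> 'a l1 \<Rightarrow> 'a l1" is "\<lambda>r f i x. r * f i x"
  unfolding l1rel_def by auto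

lift_definition norm_l1 :: "'a l1 \<Rightarrow> real" is "\<lambda>f. \<Sum>i\<in>UNIV. (LINT x|lborel. \<bar>f i x\<bar>)"
  unfolding l1rel_def
proof (intro sum.cong refl integral_cong_AE; (elim conjE)?)
  fix f g :: "'a \<Rightarrow> real \<Rightarrow> real" and i
  assume *: "\<forall>i. integrable lborel (f i)" "\<forall>i. integrable lborel (g i)"
    "\<forall>i. AE x in lborel. f i x = g i x"
  show "(\<lambda>x. \<bar>f i x\<bar>) \<in> borel_measurable lborel" "(\<lambda>x. \<bar>g i x\<bar>) \<in> borel_measurable lborel"
    using * borel_measurable_integrable[of lborel "f i"] borel_measurable_integrable[of lborel "g i"]
    by (simp_all add: borel_measurable_abs)
  have "AE x in lborel. f i x = g i x" using * by auto
  then show "AE x in lborel. \<bar>f i x\<bar> = \<bar>g i x\<bar>" by eventually_elim simp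
qed

definition dist_l1 :: "'a l1 \<Rightarrow> 'a l1 \<Rightarrow> real" where
  "dist_l1 f g = norm (f - g)"

definition sgn_l1 :: "'a l1 \<Rightarrow> 'a l1" where
  "sgn_l1 f = inverse (norm f) *\<^sub>R f"

definition uniformity_l1 :: "('a l1 \<times> 'a l1) filter" where
  "uniformity_l1 = (INF e\<in>{0<..}. principal {(f, g). dist f g < e})"

definition open_l1 :: "'a l1 set \<Rightarrow> bool" where
  "open_l1 U \<longleftrightarrow> (\<forall>f\<in>U. eventually (\<lambda>(f', g). f' = f \<longrightarrow> g \<in> U) uniformity)"

instance
proof
  fix a b c :: "'a l1" and r s :: real and U :: "'a l1 set"
  show "dist a b = norm (a - b)" "sgn a = inverse (norm a) *\<^sub>R a"
    by (simp_all add: dist_l1_def sgn_l1_def)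
  show "uniformity = (INF e\<in>{0<..}. principal {(f, g). dist f (g::'a l1) < e})"
    by (rule uniformity_l1_def)
  show "open U \<longleftrightarrow> (\<forall>f\<in>U. eventually (\<lambda>(f', g). f' = f \<longrightarrow> g \<in> U) uniformity)"
    by (rule open_l1_def)
  show "a + b + c = a + (b + c)" by transfer (auto simp: l1rel_def algebra_simps)
  show "a + b = b + a" by transfer (auto simp: l1rel_def algebra_simps)
  show "0 + a = a" by transfer (auto simp: l1rel_def)
  show "- a + a = 0" by transfer (auto simp: l1rel_def)
  show "a - b = a + - b" by transfer (auto simp: l1rel_def)
  show "r *\<^sub>R (a + b) = r *\<^sub>R a + r *\<^sub>R b" by transfer (auto simp: l1rel_def algebra_simps)
  show "(r + s) *\<^sub>R a = r *\<^sub>R a + s *\<^sub>R a" by transfer (auto simp: l1rel_def algebra_simps)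
  show "r *\<^sub>R s *\<^sub>R a = (r * s) *\<^sub>R a" by transfer (auto simp: l1rel_def algebra_simps)
  show "1 *\<^sub>R a = a" by transfer (auto simp: l1rel_def)
  show "norm (r *\<^sub>R a) = \<bar>r\<bar> * norm a"
    by transfer (simp add: abs_mult sum_distrib_left)
  show "norm (a + b) \<le> norm a + norm b"
  proof transfer
    fix f g :: "'a \<Rightarrow> real \<Rightarrow> real"
    assume "l1rel f f" "l1rel g g"
    then have fg: "integrable lborel (f i)" "integrable lborel (g i)" for i
      by (auto simp: l1rel_def)
    have "(LINT x|lborel. \<bar>f i x + g i x\<bar>) \<le> (LINT x|lborel. \<bar>f i x\<bar>) + (LINT x|lborel. \<bar>g i x\<bar>)" for i
    proof -
      have "(LINT x|lborel. \<bar>f i x + g i x\<bar>) \<le> (LINT x|lborel. \<bar>f i x\<bar> + \<bar>g i x\<bar>)"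
        using fg by (intro integral_mono) auto
      also have "\<dots> = (LINT x|lborel. \<bar>f i x\<bar>) + (LINT x|lborel. \<bar>g i x\<bar>)"
        using fg by (intro Bochner_Integration.integral_add) auto
      finally show ?thesis .
    qed
    then have "(\<Sum>i\<in>UNIV. (LINT x|lborel. \<bar>f i x + g i x\<bar>))
        \<le> (\<Sum>i\<in>UNIV. (LINT x|lborel. \<bar>f i x\<bar>) + (LINT x|lborel. \<bar>g i x\<bar>))"
      by (rule sum_mono)
    then show "(\<Sum>i\<in>UNIV. (LINT x|lborel. \<bar>f i x + g i x\<bar>))
        \<le> (\<Sum>i\<in>UNIV. (LINT x|lborel. \<bar>f i x\<bar>)) + (\<Sum>i\<in>UNIV. (LINT x|lborel. \<bar>g i x\<bar>))"
      by (simp add: sum.distrib)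
  qed
  show "norm a = 0 \<longleftrightarrow> a = 0"
  proof transfer
    fix f :: "'a \<Rightarrow> real \<Rightarrow> real"
    assume "l1rel f f"
    then have f: "integrable lborel (f i)" for i
      by (auto simp: l1rel_def)
    have "(\<Sum>i\<in>UNIV. (LINT x|lborel. \<bar>f i x\<bar>)) = 0 \<longleftrightarrow> (\<forall>i. (LINT x|lborel. \<bar>f i x\<bar>) = 0)"
      by (subst sum_nonneg_eq_0_iff) auto
    also have "\<dots> \<longleftrightarrow> (\<forall>i. AE x in lborel. f i x = 0)"
      using f by (subst integral_nonneg_eq_0_iff_AE) auto
    finally show "(\<Sum>i\<in>UNIV. (LINT x|lborel. \<bar>f i x\<bar>)) = 0 \<longleftrightarrow> l1rel f (\<lambda>i x. 0)"
      using f by (auto simp: l1rel_def)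
  qed
qed

end

lemma L1_series_converges:
  fixes h :: "nat \<Rightarrow> real \<Rightarrow> real"
  assumes h: "\<And>n. integrable lborel (h n)"
    and s: "summable (\<lambda>n. LINT x|lborel. \<bar>h n x\<bar>)"
  shows "integrable lborel (\<lambda>x. \<Sum>n. h n x)"
    and "(\<lambda>N. LINT x|lborel. \<bar>(\<Sum>n<N. h n x) - (\<Sum>n. h n x)\<bar>) \<longlonglongrightarrow> 0"
proof -
  have hm [measurable]: "h n \<in> borel_measurable borel" for n
    using borel_measurable_integrable[OF h[of n]] by simp
  have "(\<integral>\<^sup>+x. (\<Sum>n. ennreal \<bar>h n x\<bar>) \<partial>lborel) = (\<Sum>n. \<integral>\<^sup>+x. ennreal \<bar>h n x\<bar> \<partial>lborel)"
    by (rule nn_integral_suminf) auto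
  also have "\<dots> = (\<Sum>n. ennreal (LINT x|lborel. \<bar>h n x\<bar>))"
    using h by (intro suminf_cong nn_integral_eq_integral) auto
  also have "\<dots> = ennreal (\<Sum>n. LINT x|lborel. \<bar>h n x\<bar>)"
    using s by (intro suminf_ennreal2) auto
  finally have "(\<integral>\<^sup>+x. (\<Sum>n. ennreal \<bar>h n x\<bar>) \<partial>lborel) \<noteq> \<infinity>" by simp
  then have "AE x in lborel. (\<Sum>n. ennreal \<bar>h n x\<bar>) \<noteq> \<infinity>"
    by (intro nn_integral_PInf_AE) auto
  then have ae: "AE x in lborel. summable (\<lambda>n. norm (h n x))"
    by eventually_elim (auto intro!: summable_suminf_not_top)
  show int: "integrable lborel (\<lambda>x. \<Sum>n. h n x)"
    by (rule integrable_suminf[OF h ae]) (use s in simp)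
  have int_abs: "integrable lborel (\<lambda>x. \<Sum>n. \<bar>h n x\<bar>)"
    using h s ae by (intro integrable_suminf) auto
  have m: "(\<lambda>x. \<bar>(\<Sum>n<N. h n x) - (\<Sum>n. h n x)\<bar>) \<in> borel_measurable lborel" for N
    by (rule borel_measurable_integrable)
      (intro integrable_abs Bochner_Integration.integrable_diff Bochner_Integration.integrable_sum h int)
  have lim: "AE x in lborel. (\<lambda>N. \<bar>(\<Sum>n<N. h n x) - (\<Sum>n. h n x)\<bar>) \<longlonglongrightarrow> 0"
    using ae
  proof eventually_elim
    case (elim x)
    then have "(\<lambda>N. \<Sum>n<N. h n x) \<longlonglongrightarrow> (\<Sum>n. h n x)"
      by (intro summable_LIMSEQ) (rule summable_norm_cancel)
    then show ?case
      by (rule tendsto_rabs_zero[OF LIM_zero])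
  qed
  have bound: "AE x in lborel. norm \<bar>(\<Sum>n<N. h n x) - (\<Sum>n. h n x)\<bar> \<le> 2 * (\<Sum>n. \<bar>h n x\<bar>)" for N
    using ae
  proof eventually_elim
    case (elim x)
    then have sx: "summable (\<lambda>n. \<bar>h n x\<bar>)" by simp
    have "\<bar>\<Sum>n<N. h n x\<bar> \<le> (\<Sum>n<N. \<bar>h n x\<bar>)" by (rule sum_abs)
    also have "\<dots> \<le> (\<Sum>n. \<bar>h n x\<bar>)" by (rule sum_le_suminf[OF sx]) auto
    finally have "\<bar>\<Sum>n<N. h n x\<bar> \<le> (\<Sum>n. \<bar>h n x\<bar>)" .
    moreover have "\<bar>\<Sum>n. h n x\<bar> \<le> (\<Sum>n. \<bar>h n x\<bar>)" by (rule summable_rabs[OF sx])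
    ultimately show ?case unfolding real_norm_def by linarith
  qed
  have "(\<lambda>N. LINT x|lborel. \<bar>(\<Sum>n<N. h n x) - (\<Sum>n. h n x)\<bar>) \<longlonglongrightarrow> (LINT x|(lborel::real measure). 0)"
    by (rule integral_dominated_convergence[OF _ m _ lim bound])
      (auto intro!: integrable_mult_right int_abs simp del: mult_2)
  then show "(\<lambda>N. LINT x|lborel. \<bar>(\<Sum>n<N. h n x) - (\<Sum>n. h n x)\<bar>) \<longlonglongrightarrow> 0" by simp
qed

lemma l1rel_rep: "l1rel (rep_l1 f) (rep_l1 f)"
  using Quotient_l1 by (auto simp: Quotient_def)

lemma abs_rep_l1: "abs_l1 (rep_l1 f) = f"
  using Quotient_l1 by (auto simp: Quotient_def)

lemma norm_abs_l1: "l1rel f f \<Longrightarrow> norm (abs_l1 f) = (\<Sum>i\<in>UNIV. (LINT x|lborel. \<bar>f i x\<bar>))"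
  by (rule norm_l1.abs_eq)

lemma minus_abs_l1:
  "l1rel f f \<Longrightarrow> l1rel g g \<Longrightarrow> abs_l1 f - abs_l1 g = abs_l1 (\<lambda>i x. f i x - g i x)"
  by (rule minus_l1.abs_eq)

instance l1 :: (finite) banach
proof
  fix X :: "nat \<Rightarrow> 'a l1"
  assume X: "Cauchy X"
  have "\<exists>r. strict_mono r \<and> (\<forall>n. \<forall>k\<ge>r n. norm (X k - X (r n)) < (1/2)^n)"
  proof -
    have "\<exists>M. \<forall>m\<ge>M. \<forall>k\<ge>M. norm (X k - X m) < (1/2)^n" for n :: nat
    proof -
      have "(0::real) < (1/2)^n" by simp
      then show ?thesis using X unfolding Cauchy_iff by blast
    qed
    then have "\<forall>n. \<exists>M. \<forall>m\<ge>M. \<forall>k\<ge>M. norm (X k - X m) < (1/2)^n" by blast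
    then obtain M where "\<forall>n. \<forall>m\<ge>M n. \<forall>k\<ge>M n. norm (X k - X m) < (1/2)^n"
      unfolding choice_iff by (elim exE)
    then have M: "\<And>n m k. m \<ge> M n \<Longrightarrow> k \<ge> M n \<Longrightarrow> norm (X k - X m) < (1/2)^n"
      by blast
    define r where "r = rec_nat (M 0) (\<lambda>n y. Suc y + M (Suc n))"
    have r_Suc: "r (Suc n) = Suc (r n) + M (Suc n)" for n by (simp add: r_def)
    have rM: "r n \<ge> M n" for n by (cases n) (auto simp: r_def)
    have "\<forall>n. \<forall>k\<ge>r n. norm (X k - X (r n)) < (1/2)^n"
      using M[OF rM order_trans[OF rM]] by blast
    moreover have "strict_mono r" by (simp add: strict_mono_Suc_iff r_Suc)
    ultimately show ?thesis by blast
  qed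
  then obtain r where r: "strict_mono r" "\<And>n k. k \<ge> r n \<Longrightarrow> norm (X k - X (r n)) < (1/2)^n"
    by blast
  define Y where "Y n = rep_l1 (X (r n))" for n
  define h where "h i n x = Y (Suc n) i x - Y n i x" for i n x
  have Yint: "integrable lborel (Y n i)" for n i
    using l1rel_rep[of "X (r n)"] by (auto simp: Y_def l1rel_def)
  have Yrel: "l1rel (Y n) (Y n)" for n by (simp add: Y_def l1rel_rep)
  have absY: "abs_l1 (Y n) = X (r n)" for n by (simp add: Y_def abs_rep_l1)
  have hint: "integrable lborel (h i n)" for i n
    unfolding h_def[abs_def] using Yint by auto
  have hle: "(LINT x|lborel. \<bar>h i n x\<bar>) \<le> (1/2)^n" for i n
  proof -
    have "(LINT x|lborel. \<bar>h i n x\<bar>) \<le> (\<Sum>i\<in>UNIV. (LINT x|lborel. \<bar>h i n x\<bar>))"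
      by (rule member_le_sum[of i UNIV "\<lambda>i. LINT x|lborel. \<bar>h i n x\<bar>"]) auto
    also have "\<dots> = norm (abs_l1 (\<lambda>i x. Y (Suc n) i x - Y n i x))"
      using Yint by (subst norm_abs_l1) (auto simp: l1rel_def h_def)
    also have "\<dots> = norm (X (r (Suc n)) - X (r n))"
      by (simp add: minus_abs_l1[OF Yrel Yrel, symmetric] absY)
    also have "\<dots> \<le> (1/2)^n"
      using r(2)[of n "r (Suc n)"] strict_monoD[OF r(1), of n "Suc n"] by simp
    finally show ?thesis .
  qed
  have hsum: "summable (\<lambda>n. LINT x|lborel. \<bar>h i n x\<bar>)" for i
    by (rule summable_comparison_test'[OF summable_geometric[of "1/2::real"], of 0])
      (use hle in auto)
  define G where "G i x = Y 0 i x + (\<Sum>n. h i n x)" for i x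
  have Grel: "l1rel G G"
    unfolding l1rel_def G_def[abs_def] using Yint L1_series_converges(1)[OF hint hsum] by auto
  have tel: "(\<Sum>n<N. h i n x) = Y N i x - Y 0 i x" for i N x
    unfolding h_def by (rule sum_lessThan_telescope)
  have "norm (X (r N) - abs_l1 G)
      = (\<Sum>i\<in>UNIV. (LINT x|lborel. \<bar>(\<Sum>n<N. h i n x) - (\<Sum>n. h i n x)\<bar>))" for N
  proof -
    have "norm (X (r N) - abs_l1 G) = norm (abs_l1 (\<lambda>i x. Y N i x - G i x))"
      by (simp add: minus_abs_l1[OF Yrel Grel, symmetric] absY)
    also have "\<dots> = (\<Sum>i\<in>UNIV. (LINT x|lborel. \<bar>Y N i x - G i x\<bar>))"
      using Yrel[of N] Grel by (subst norm_abs_l1) (auto simp: l1rel_def)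
    finally show ?thesis by (simp add: tel G_def algebra_simps)
  qed
  moreover have "(\<lambda>N. \<Sum>i\<in>UNIV. (LINT x|lborel. \<bar>(\<Sum>n<N. h i n x) - (\<Sum>n. h i n x)\<bar>))
      \<longlonglongrightarrow> (\<Sum>i\<in>(UNIV::'a set). 0)"
    by (intro tendsto_sum L1_series_converges(2)[OF hint hsum])
  ultimately have "(\<lambda>N. norm (X (r N) - abs_l1 G)) \<longlonglongrightarrow> 0" by (simp only: sum.neutral_const)
  then have "(X \<circ> r) \<longlonglongrightarrow> abs_l1 G"
    unfolding o_def by (rule LIM_zero_cancel[OF tendsto_norm_zero_cancel])
  then have "X \<longlonglongrightarrow> abs_l1 G" by (rule Cauchy_converges_subseq[OF X r(1)])
  then show "convergent X" by (auto simp: convergent_def)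
qed

lift_definition arcscale :: "('m \<Rightarrow> real) \<Rightarrow> 'm l1 \<Rightarrow> 'm l1" is "\<lambda>c f i x. c i * f i x"
  unfolding l1rel_def by auto

subsection \<open>Function spaces on the network\<close>

definition L1A :: "('m \<Rightarrow> real) \<Rightarrow> 'm l1 set" where
  "L1A L = {f. \<forall>i. AE x in lborel. x \<notin> {0<..<L i} \<longrightarrow> rep_l1 f i x = 0}"

definition of_funs :: "('m \<Rightarrow> real) \<Rightarrow> ('m \<Rightarrow> real \<Rightarrow> real) \<Rightarrow> 'm l1" where
  "of_funs L f = abs_l1 (\<lambda>i x. indicator {0<..<L i} x * f i x)"

text \<open>Weak derivative on \<open>(a, b)\<close>; the test functions are the \<open>C\<^sup>1\<close> functions with compact
  support in \<open>(a, b)\<close>, as is customary in dimension one.\<close>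

definition test_function :: "real \<Rightarrow> real \<Rightarrow> (real \<Rightarrow> real) \<Rightarrow> bool" where
  "test_function a b \<phi> \<longleftrightarrow>
     (\<forall>x. \<phi> differentiable (at x)) \<and> continuous_on UNIV (deriv \<phi>) \<and>
     (\<exists>c d. a < c \<and> d < b \<and> (\<forall>x. x \<notin> {c..d} \<longrightarrow> \<phi> x = 0))"

definition weak_deriv :: "real \<Rightarrow> real \<Rightarrow> (real \<Rightarrow> real) \<Rightarrow> (real \<Rightarrow> real) \<Rightarrow> bool" where
  "weak_deriv a b f g \<longleftrightarrow>
     (\<forall>\<phi>. test_function a b \<phi> \<longrightarrow>
        (LINT x:{a<..<b}|lborel. f x * deriv \<phi> x) = - (LINT x:{a<..<b}|lborel. g x * \<phi> x))"

definition has_wder :: "('m \<Rightarrow> real) \<Rightarrow> 'm l1 \<Rightarrow> 'm l1 \<Rightarrow> bool" where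
  "has_wder L f g \<longleftrightarrow> (\<forall>i. weak_deriv 0 (L i) (rep_l1 f i) (rep_l1 g i))"

definition wder :: "('m \<Rightarrow> real) \<Rightarrow> 'm l1 \<Rightarrow> 'm l1" where
  "wder L f = (THE g. g \<in> L1A L \<and> has_wder L f g)"

text \<open>\<open>WA L k\<close> is \<open>W\<^bsup>k,1\<^esup>\<close> of the network.\<close>

primrec WA :: "('m \<Rightarrow> real) \<Rightarrow> nat \<Rightarrow> 'm l1 set" where
  "WA L 0 = L1A L"
| "WA L (Suc k) = {f \<in> L1A L. \<exists>g \<in> WA L k. has_wder L f g}"

definition normW :: "('m::finite \<Rightarrow> real) \<Rightarrow> nat \<Rightarrow> 'm l1 \<Rightarrow> real" where
  "normW L k f = (\<Sum>j\<le>k. norm ((wder L ^^ j) f))"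

text \<open>Point values on the closed arc are those of the continuous representative.\<close>

definition pval :: "('m \<Rightarrow> real) \<Rightarrow> 'm l1 \<Rightarrow> 'm \<Rightarrow> real \<Rightarrow> real" where
  "pval L f i p = (THE v. \<exists>c. continuous_on {0..L i} c \<and>
     (AE x in lborel. x \<in> {0<..<L i} \<longrightarrow> rep_l1 f i x = c x) \<and> v = c p)"

subsection \<open>The network: \<open>I\<close> is the set of incoming arcs, its complement the outgoing ones\<close>

definition ptN :: "'m set \<Rightarrow> ('m \<Rightarrow> real) \<Rightarrow> 'm \<Rightarrow> real" where
  "ptN I L i = (if i \<in> I then L i else 0)"

definition pte :: "'m set \<Rightarrow> ('m \<Rightarrow> real) \<Rightarrow> 'm \<Rightarrow> real" where
  "pte I L i = (if i \<in> I then 0 else L i)"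

abbreviation valN :: "'m set \<Rightarrow> ('m \<Rightarrow> real) \<Rightarrow> 'm l1 \<Rightarrow> 'm \<Rightarrow> real" where
  "valN I L f i \<equiv> pval L f i (ptN I L i)"

abbreviation vale :: "'m set \<Rightarrow> ('m \<Rightarrow> real) \<Rightarrow> 'm l1 \<Rightarrow> 'm \<Rightarrow> real" where
  "vale I L f i \<equiv> pval L f i (pte I L i)"

definition beta :: "'m set \<Rightarrow> 'm \<Rightarrow> real" where
  "beta I i = (if i \<in> I then 1 else - 1)"

definition alpha :: "('m::finite \<Rightarrow> 'm \<Rightarrow> real) \<Rightarrow> 'm \<Rightarrow> 'm \<Rightarrow> real" where
  "alpha K i j = (if i = j then (\<Sum>k\<in>UNIV - {i}. K i k) else - K i j)"

definition transmission ::
  "'m::finite set \<Rightarrow> ('m \<Rightarrow> real) \<Rightarrow> ('m \<Rightarrow> real) \<Rightarrow> ('m \<Rightarrow> 'm \<Rightarrow> real) \<Rightarrow> real \<Rightarrow> 'm l1 \<Rightarrow> bool" where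
  "transmission I L lam K \<epsilon> w \<longleftrightarrow>
     (\<forall>i. beta I i * (- lam i * valN I L w i + \<epsilon> * valN I L (wder L w) i)
        = (\<Sum>j\<in>UNIV. K i j * (valN I L w j - valN I L w i)))"

definition advdiff :: "('m::finite \<Rightarrow> real) \<Rightarrow> ('m \<Rightarrow> real) \<Rightarrow> real \<Rightarrow> 'm l1 \<Rightarrow> 'm l1" where
  "advdiff L lam \<epsilon> w = \<epsilon> *\<^sub>R wder L (wder L w) - arcscale lam (wder L w)"

text \<open>Solutions in \<open>C([0,\<infinity>); W\<^bsup>2,1\<^esup>)\<close> and \<open>C\<^sup>1([0,\<infinity>); L\<^sup>1)\<close>; only the values \<open>u t\<close> for
  \<open>t \<ge> 0\<close> are meaningful.\<close>

definition is_solution ::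
  "'m::finite set \<Rightarrow> ('m \<Rightarrow> real) \<Rightarrow> ('m \<Rightarrow> real) \<Rightarrow> ('m \<Rightarrow> 'm \<Rightarrow> real) \<Rightarrow> real \<Rightarrow> 'm l1
     \<Rightarrow> (real \<Rightarrow> 'm l1) \<Rightarrow> bool" where
  "is_solution I L lam K \<epsilon> u0 u \<longleftrightarrow>
     (\<forall>t\<ge>0. u t \<in> WA L 2) \<and>
     (\<forall>t\<ge>0. ((\<lambda>s. normW L 2 (u s - u t)) \<longlongrightarrow> 0) (at t within {0..})) \<and>
     (\<exists>u'. continuous_on {0..} u' \<and>
        (\<forall>t\<ge>0. (u has_vector_derivative u' t) (at t within {0..})) \<and>
        (\<forall>t>0. u' t = - arcscale lam (wder L (u t)) + \<epsilon> *\<^sub>R wder L (wder L (u t)))) \<and>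
     u 0 = u0 \<and>
     (\<forall>t>0. transmission I L lam K \<epsilon> (u t)) \<and>
     (\<forall>t>0. \<forall>i. vale I L (u t) i = vale I L u0 i)"

subsection \<open>The semigroup\<close>

definition contraction_semigroup :: "'a::real_normed_vector set \<Rightarrow> (real \<Rightarrow> 'a \<Rightarrow> 'a) \<Rightarrow> bool" where
  "contraction_semigroup X T \<longleftrightarrow>
     (\<forall>t\<ge>0. \<forall>f\<in>X. T t f \<in> X \<and> norm (T t f) \<le> norm f) \<and>
     (\<forall>t\<ge>0. \<forall>f\<in>X. \<forall>g\<in>X. \<forall>a b. T t (a *\<^sub>R f + b *\<^sub>R g) = a *\<^sub>R T t f + b *\<^sub>R T t g) \<and>
     (\<forall>f\<in>X. T 0 f = f) \<and>
     (\<forall>s\<ge>0. \<forall>t\<ge>0. \<forall>f\<in>X. T (s + t) f = T s (T t f)) \<and>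
     (\<forall>f\<in>X. continuous_on {0..} (\<lambda>t. T t f))"

definition generates ::
  "'a::real_normed_vector set \<Rightarrow> 'a set \<Rightarrow> ('a \<Rightarrow> 'a) \<Rightarrow> (real \<Rightarrow> 'a \<Rightarrow> 'a) \<Rightarrow> bool" where
  "generates X D A T \<longleftrightarrow> contraction_semigroup X T \<and>
     (\<forall>f\<in>X. \<forall>g. ((\<lambda>h. (T h f - f) /\<^sub>R h) \<longlongrightarrow> g) (at_right 0) \<longleftrightarrow> f \<in> D \<and> g = A f)"

definition dom_A0 ::
  "'m::finite set \<Rightarrow> ('m \<Rightarrow> real) \<Rightarrow> ('m \<Rightarrow> real) \<Rightarrow> ('m \<Rightarrow> 'm \<Rightarrow> real) \<Rightarrow> real \<Rightarrow> 'm l1 set" where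
  "dom_A0 I L lam K \<epsilon> = {w \<in> WA L 2. \<forall>i. vale I L w i = 0 \<and>
     beta I i * (lam i * valN I L w i - \<epsilon> * valN I L (wder L w) i)
       = (\<Sum>j\<in>UNIV. alpha K i j * valN I L w j)}"

text \<open>The choice is immaterial: two semigroups with the same generator agree at all \<open>t \<ge> 0\<close> on
  \<open>L1A L\<close>, and no other values are used.\<close>

definition tau ::
  "'m::finite set \<Rightarrow> ('m \<Rightarrow> real) \<Rightarrow> ('m \<Rightarrow> real) \<Rightarrow> ('m \<Rightarrow> 'm \<Rightarrow> real) \<Rightarrow> real
     \<Rightarrow> real \<Rightarrow> 'm l1 \<Rightarrow> 'm l1" where
  "tau I L lam K \<epsilon> = (SOME T. generates (L1A L) (dom_A0 I L lam K \<epsilon>) (advdiff L lam \<epsilon>) T)"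

subsection \<open>The lifting \<open>q\<close> of the boundary data\<close>

text \<open>Derivative on the closed interval \<open>[0, l]\<close>, one-sided at the end points.\<close>

definition derivc :: "real \<Rightarrow> (real \<Rightarrow> real) \<Rightarrow> real \<Rightarrow> real" where
  "derivc l f x = vector_derivative f (at x within {0..l})"

definition smooth_closed :: "real \<Rightarrow> (real \<Rightarrow> real) \<Rightarrow> bool" where
  "smooth_closed l f \<longleftrightarrow> (\<forall>n. (derivc l ^^ n) f differentiable_on {0..l})"

definition is_lifting ::
  "'m set \<Rightarrow> ('m \<Rightarrow> real) \<Rightarrow> 'm l1 \<Rightarrow> ('m \<Rightarrow> real \<Rightarrow> real) \<Rightarrow> bool" where
  "is_lifting I L u0 q \<longleftrightarrow> (\<forall>i. smooth_closed (L i) (q i) \<and>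
     q i (pte I L i) = vale I L u0 i \<and>
     q i (ptN I L i) = 0 \<and> derivc (L i) (q i) (ptN I L i) = 0)"

definition forcing ::
  "('m \<Rightarrow> real) \<Rightarrow> ('m \<Rightarrow> real) \<Rightarrow> real \<Rightarrow> ('m \<Rightarrow> real \<Rightarrow> real) \<Rightarrow> 'm \<Rightarrow> real \<Rightarrow> real" where
  "forcing L lam \<epsilon> q i x =
     \<epsilon> * derivc (L i) (derivc (L i) (q i)) x - lam i * derivc (L i) (q i) x"

end

theory Submission
  imports Defs
begin

text \<open>
  With \<open>v = u - q\<close> the problem becomes \<open>v' = A v + F\<close> where \<open>A = A\<^sub>0\<^sup>\<epsilon>\<close> and \<open>F\<close> does not depend on
  time.  A solution given by the stated formula exists as soon as \<open>A\<close> generates a contraction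
  semigroup, and it is unique because \<open>A\<close> is dissipative.

  The semigroup is the limit of the implicit Euler scheme \<open>J\<^sub>h\<^sup>n f\<close>, \<open>n = \<lfloor>t / h\<rfloor>\<close>, \<open>h = 2\<^sup>-\<^sup>k\<close>, with
  \<open>J\<^sub>h = (1 - h A)\<^sup>-\<^sup>1\<close>: halving the step changes one step of size \<open>2 h\<close> by at most \<open>h\<^sup>2 \<parallel>A\<^sup>2 f\<parallel>\<close>.
  Dissipativity in \<open>L\<^sup>1\<close> comes from testing with \<open>w / sqrt (w\<^sup>2 + d\<^sup>2)\<close>, a smooth increasing
  substitute for the sign: the node terms have a sign because \<open>K\<close> is symmetric and nonnegative.
  The resolvent equation has constant coefficients on each arc, and matching the node conditions
  is a linear system whose injectivity is again dissipativity.  Finally, continuity in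
  \<open>W\<^bsup>2,1\<^esup>\<close> is continuity in the graph norm, since the two norms are equivalent.
\<close>

section \<open>Generation of contraction semigroups\<close>

text \<open>\<open>tau\<close> is a choice among all semigroups with the given generator, so nothing
  may be used of it beyond \<open>generates\<close>: invariance of the domain, differentiability of
  orbits and Duhamel's integral are derived from that predicate alone. The Euler error bound
  involves \<open>A (A f)\<close>; convergence is therefore obtained on the domain of A^2, which is
  dense because the resolvent maps \<open>D\<close> into it, and is extended by contractivity.
  Functions in W^{2,1} have a merely integrable second derivative, so classical calculus does not
  apply to them: weak derivatives are replaced by continuous representatives that are integrals of
  their densities (\<open>ac\<close>), and these also give meaning to the values at the nodes. The
  linear system has one unknown per arc, because the condition at the outer end leaves just the
  slope there free. Uniqueness uses no semigroup: a solution sampled on a fine grid satisfies the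
  implicit Euler scheme up to a small residual.\<close>

lemma norm_add_diff_le: "norm (a + b - c) \<le> norm a + norm b + norm c"
  for a b c :: "'a::real_normed_vector"
  by (meson add_mono norm_triangle_ineq norm_triangle_ineq4 order_refl order_trans)

text \<open>The hypotheses of the Lumer-Phillips theorem, with the range condition at every step
  \<open>h\<close>. They are stated for a subspace \<open>X\<close> of a Banach type, since the
  lengths of the arcs are terms and the space on the network is not a type.\<close>

locale dissipative_op =
  fixes X D :: "'a::banach set" and A :: "'a \<Rightarrow> 'a"
  assumes subX: "subspace X" and closedX: "closed X"
    and subD: "subspace D" and DX: "D \<subseteq> X"
    and A_add: "\<And>x y. x \<in> D \<Longrightarrow> y \<in> D \<Longrightarrow> A (x + y) = A x + A y"
    and A_scale: "\<And>c x. x \<in> D \<Longrightarrow> A (c *\<^sub>R x) = c *\<^sub>R A x"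
    and A_in: "\<And>x. x \<in> D \<Longrightarrow> A x \<in> X"
    and dense: "\<And>f e. f \<in> X \<Longrightarrow> 0 < e \<Longrightarrow> \<exists>w\<in>D. norm (f - w) < e"
    and dissip: "\<And>h w. 0 < h \<Longrightarrow> w \<in> D \<Longrightarrow> norm w \<le> norm (w - h *\<^sub>R A w)"
    and surj: "\<And>h f. 0 < h \<Longrightarrow> f \<in> X \<Longrightarrow> \<exists>w\<in>D. w - h *\<^sub>R A w = f"
begin

lemma A_diff: "x \<in> D \<Longrightarrow> y \<in> D \<Longrightarrow> A (x - y) = A x - A y"
  using A_add[of x "(-1) *\<^sub>R y"] A_scale[of y "-1"] subD by (simp add: subspace_neg)

lemma D_intros: "x \<in> D \<Longrightarrow> y \<in> D \<Longrightarrow> x + y \<in> D" "x \<in> D \<Longrightarrow> y \<in> D \<Longrightarrow> x - y \<in> D"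
  "x \<in> D \<Longrightarrow> c *\<^sub>R x \<in> D"
  using subD by (auto intro: subspace_add subspace_diff subspace_scale)

lemma X_intros: "x \<in> X \<Longrightarrow> y \<in> X \<Longrightarrow> x + y \<in> X" "x \<in> X \<Longrightarrow> y \<in> X \<Longrightarrow> x - y \<in> X"
  "x \<in> X \<Longrightarrow> c *\<^sub>R x \<in> X"
  using subX by (auto intro: subspace_add subspace_diff subspace_scale)

lemma resolvent_inj:
  assumes "0 < h" "x \<in> D" "y \<in> D" "x - h *\<^sub>R A x = y - h *\<^sub>R A y"
  shows "x = y"
proof -
  have "norm (x - y) \<le> norm ((x - y) - h *\<^sub>R A (x - y))"
    using assms D_intros by (intro dissip) auto
  also have "(x - y) - h *\<^sub>R A (x - y) = (x - h *\<^sub>R A x) - (y - h *\<^sub>R A y)"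
    using assms by (simp add: A_diff algebra_simps)
  also have "\<dots> = 0" using assms by simp
  finally show ?thesis by simp
qed

definition J :: "real \<Rightarrow> 'a \<Rightarrow> 'a" where
  "J h f = (THE w. w \<in> D \<and> w - h *\<^sub>R A w = f)"

lemma J_eqI: "0 < h \<Longrightarrow> w \<in> D \<Longrightarrow> w - h *\<^sub>R A w = f \<Longrightarrow> J h f = w"
  unfolding J_def by (rule the_equality) (auto intro: resolvent_inj)

lemma
  assumes "0 < h" "f \<in> X"
  shows J_D: "J h f \<in> D" and J_eq: "J h f - h *\<^sub>R A (J h f) = f"
  using surj[OF assms] J_eqI[OF assms(1)] by auto

lemma J_X: "0 < h \<Longrightarrow> f \<in> X \<Longrightarrow> J h f \<in> X"
  using J_D DX by auto

lemma J_norm: "0 < h \<Longrightarrow> f \<in> X \<Longrightarrow> norm (J h f) \<le> norm f"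
  using dissip[OF _ J_D] J_eq by metis

lemma J_add: "0 < h \<Longrightarrow> f \<in> X \<Longrightarrow> g \<in> X \<Longrightarrow> J h (f + g) = J h f + J h g"
proof (intro J_eqI D_intros J_D)
  assume *: "0 < h" "f \<in> X" "g \<in> X"
  have "J h f + J h g - h *\<^sub>R A (J h f + J h g) = (J h f - h *\<^sub>R A (J h f)) + (J h g - h *\<^sub>R A (J h g))"
    using * J_D by (simp add: A_add scaleR_right_distrib)
  then show "J h f + J h g - h *\<^sub>R A (J h f + J h g) = f + g" using * by (simp add: J_eq)
qed

lemma J_scale: "0 < h \<Longrightarrow> f \<in> X \<Longrightarrow> J h (c *\<^sub>R f) = c *\<^sub>R J h f"
proof (intro J_eqI D_intros J_D)
  assume *: "0 < h" "f \<in> X"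
  have "c *\<^sub>R J h f - h *\<^sub>R A (c *\<^sub>R J h f) = c *\<^sub>R (J h f - h *\<^sub>R A (J h f))"
    using * J_D by (simp add: A_scale scaleR_right_diff_distrib mult.commute)
  then show "c *\<^sub>R J h f - h *\<^sub>R A (c *\<^sub>R J h f) = c *\<^sub>R f" using * by (simp add: J_eq)
qed

text \<open>\<open>A (J h f)\<close> is the difference quotient \<open>(J h f - f) / h\<close>,
  hence again in \<open>D\<close>: the resolvent takes \<open>D\<close> into the domain of A^2.
  Applying \<open>A\<close> to the resolvent equation then gives the second claim, by uniqueness of
  its solution.\<close>

lemma
  assumes "0 < h" "f \<in> D"
  shows A_J_D: "A (J h f) \<in> D" and A_J: "A (J h f) = J h (A f)"
proof -
  have f: "f \<in> X" using assms DX by auto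
  note w = J_D[OF assms(1) f] J_eq[OF assms(1) f]
  have "h *\<^sub>R A (J h f) = J h f - f"
    using w(2) by (simp add: algebra_simps)
  then have "A (J h f) = (1 / h) *\<^sub>R (J h f - f)"
    using assms(1) by (simp flip: \<open>h *\<^sub>R A (J h f) = J h f - f\<close>)
  then show *: "A (J h f) \<in> D" using w assms by (auto intro: D_intros)
  have "A (J h f) - h *\<^sub>R A (A (J h f)) = A (J h f - h *\<^sub>R A (J h f))"
    using w(1) * by (metis A_diff A_scale D_intros(3))
  also have "\<dots> = A f" by (simp only: w(2))
  finally show "A (J h f) = J h (A f)"
    by (rule J_eqI[OF assms(1) *, symmetric])
qed

lemma J_step: "0 < h \<Longrightarrow> f \<in> D \<Longrightarrow> J h f - f = h *\<^sub>R J h (A f)"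
  using J_eq[of h f] A_J[of h f] DX by (auto simp: algebra_simps)

text \<open>Since \<open>(1 - h A)\<^sup>2 = 1 - 2 h A + h\<^sup>2 A\<^sup>2\<close>, applying \<open>1 - 2 h A\<close> to \<open>J\<^sub>h\<^sup>2 f\<close> gives
  \<open>f - h\<^sup>2 A\<^sup>2 J\<^sub>h\<^sup>2 f\<close>.\<close>

lemma J_double:
  assumes h: "0 < h" and f: "f \<in> D" "A f \<in> D"
  shows "norm (J h (J h f) - J (2 * h) f) \<le> h\<^sup>2 * norm (A (A f))"
proof -
  have X: "f \<in> X" "A (A f) \<in> X" using f DX A_in by auto
  define v w z where "v = J h f" and "w = J h v" and "z = J (2 * h) f"
  have v: "v \<in> D" "v - h *\<^sub>R A v = f" "A v = J h (A f)" "A v \<in> D"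
    unfolding v_def by (rule J_D J_eq A_J A_J_D h X f)+
  have Av': "A (A v) = J h (A (A f))" unfolding v(3) by (rule A_J[OF h f(2)])
  have vX: "v \<in> X" using v(1) DX by auto
  have w: "w \<in> D" "w - h *\<^sub>R A w = v" "A w = J h (A v)" "A w \<in> D"
    unfolding w_def by (rule J_D J_eq A_J A_J_D h vX v)+
  have Aw': "A (A w) = J h (A (A v))" unfolding w(3) by (rule A_J[OF h v(4)])
  have z: "z \<in> D" "z - (2 * h) *\<^sub>R A z = f"
    using J_D[of "2 * h" f] J_eq[of "2 * h" f] h X by (auto simp: z_def)
  have Av: "A v = A w - h *\<^sub>R A (A w)"
    using w(1,2,4) by (metis A_diff A_scale D_intros(3))
  have "norm (z - w) \<le> norm ((z - w) - (2 * h) *\<^sub>R A (z - w))"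
    using h z w by (intro dissip D_intros) auto
  also have "(z - w) - (2 * h) *\<^sub>R A (z - w) = f - (w - (2 * h) *\<^sub>R A w)"
    unfolding A_diff[OF z(1) w(1)] z(2)[symmetric] by (simp add: algebra_simps)
  also have "w - (2 * h) *\<^sub>R A w = f - h\<^sup>2 *\<^sub>R A (A w)"
  proof -
    have "f = (w - h *\<^sub>R A w) - h *\<^sub>R (A w - h *\<^sub>R A (A w))"
      by (simp only: w(2) v(2) flip: Av)
    also have "\<dots> = w - (2 * h) *\<^sub>R A w + h\<^sup>2 *\<^sub>R A (A w)"
      unfolding mult_2 scaleR_add_left by (simp add: algebra_simps power2_eq_square)
    finally show ?thesis by simp
  qed
  also have "norm (f - (f - h\<^sup>2 *\<^sub>R A (A w))) = h\<^sup>2 * norm (A (A w))" by simp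
  also have "\<dots> \<le> h\<^sup>2 * norm (A (A f))"
    unfolding Aw' Av' using J_norm[OF h X(2)] J_norm[OF h J_X[OF h X(2)]]
    by (intro mult_left_mono) auto
  finally show ?thesis by (simp add: v_def w_def z_def norm_minus_commute)
qed

section \<open>Error estimates for the implicit Euler scheme\<close>

abbreviation S :: "real \<Rightarrow> nat \<Rightarrow> 'a \<Rightarrow> 'a" where "S h n \<equiv> J h ^^ n"

lemma S_X: "0 < h \<Longrightarrow> f \<in> X \<Longrightarrow> S h n f \<in> X"
  by (induction n) (auto intro: J_X)

lemma S_norm: "0 < h \<Longrightarrow> f \<in> X \<Longrightarrow> norm (S h n f) \<le> norm f"
proof (induction n)
  case (Suc n)
  then show ?case using J_norm[OF \<open>0 < h\<close> S_X[OF \<open>0 < h\<close> \<open>f \<in> X\<close>, of n]] by simp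
qed auto

lemma S_linear:
  assumes "0 < h" "f \<in> X" "g \<in> X"
  shows "S h n (a *\<^sub>R f + b *\<^sub>R g) = a *\<^sub>R S h n f + b *\<^sub>R S h n g"
  using assms by (induction n) (auto simp: J_add J_scale S_X X_intros)

lemma S_diff:
  assumes "0 < h" "f \<in> X" "g \<in> X"
  shows "S h n (f - g) = S h n f - S h n g"
  using S_linear[OF assms, of n 1 "-1"] by simp

lemma S_diff_norm:
  assumes "0 < h" "f \<in> X" "g \<in> X"
  shows "norm (S h n f - S h n g) \<le> norm (f - g)"
  using S_norm[of h "f - g" n] S_diff[OF assms] assms X_intros by simp

lemma S_D:
  assumes "0 < h" "f \<in> D"
  shows "S h n f \<in> D \<and> A (S h n f) = S h n (A f)"
proof (induction n)
  case (Suc n)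
  then have "S h n f \<in> X" using DX by auto
  then show ?case using Suc A_J[of h "S h n f"] J_D[of h "S h n f"] assms by auto
qed (use assms in auto)

lemma S_step: "0 < h \<Longrightarrow> f \<in> D \<Longrightarrow> S h (Suc n) f - S h n f = h *\<^sub>R S h (Suc n) (A f)"
  using J_step[of h "S h n f"] S_D[of h f n] by simp

text \<open>Each step moves by \<open>h\<close> times a contracted copy of \<open>A f\<close>, and
  the distances add up.\<close>

lemma S_lipschitz:
  assumes h: "0 < h" and f: "f \<in> D"
  shows "norm (S h (n + m) f - S h n f) \<le> m * h * norm (A f)"
proof (induction m)
  case (Suc m)
  have "norm (S h (Suc (n + m)) f - S h (n + m) f) \<le> h * norm (A f)"
    unfolding S_step[OF assms] using S_norm[OF h A_in[OF f], of "Suc (n + m)"] h by simp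
  then have "norm ((S h (Suc (n + m)) f - S h (n + m) f) + (S h (n + m) f - S h n f))
     \<le> h * norm (A f) + m * h * norm (A f)"
    using Suc by (intro norm_triangle_mono)
  then show ?case by (simp add: algebra_simps)
qed simp

lemma S_lipschitz':
  assumes h: "0 < h" and f: "f \<in> D"
  shows "norm (S h n f - S h m f) \<le> \<bar>real n - real m\<bar> * h * norm (A f)"
proof (cases "m \<le> n")
  case True
  then obtain k where "n = m + k" by (auto simp: le_iff_add)
  then show ?thesis using S_lipschitz[OF assms, of m k] by simp
next
  case False
  then obtain k where "m = n + k" using le_iff_add by (meson nat_le_linear)
  then show ?thesis using S_lipschitz[OF assms, of n k] by (simp add: norm_minus_commute)
qed

text \<open>The local error of \<open>J_double\<close> arises at \<open>S h (2 * n) f\<close>, where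
  A^2 is still bounded by \<open>norm (A (A f))\<close> because \<open>A\<close> commutes with the
  scheme. Errors made earlier are passed on by the contraction \<open>J (2 * h)\<close>, so the
  local errors merely add up.\<close>

lemma S_double:
  assumes h: "0 < h" and f: "f \<in> D" "A f \<in> D"
  shows "norm (S h (2 * n) f - S (2 * h) n f) \<le> n * h\<^sup>2 * norm (A (A f))"
proof (induction n)
  case (Suc n)
  have fX: "f \<in> X" using f DX by auto
  define a b where "a = S h (2 * n) f" and "b = S (2 * h) n f"
  have a: "a \<in> D" "A a \<in> D" "A (A a) = S h (2 * n) (A (A f))"
    using S_D[OF h f(1), of "2*n"] S_D[OF h f(2), of "2*n"] by (auto simp: a_def)
  have X: "a \<in> X" "b \<in> X" using h fX by (auto simp: a_def b_def intro: S_X)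
  have "norm (J h (J h a) - J (2 * h) a) \<le> h\<^sup>2 * norm (A (A a))"
    by (rule J_double[OF h a(1,2)])
  also have "\<dots> \<le> h\<^sup>2 * norm (A (A f))"
    using a(3) S_norm[OF h A_in[OF f(2)], of "2*n"] by (simp add: mult_left_mono)
  finally have 1: "norm (J h (J h a) - J (2 * h) a) \<le> h\<^sup>2 * norm (A (A f))" .
  have 2: "norm (J (2 * h) a - J (2 * h) b) \<le> n * h\<^sup>2 * norm (A (A f))"
    using S_diff_norm[of "2 * h" a b 1] h X Suc by (simp add: a_def b_def)
  have "norm ((J h (J h a) - J (2 * h) a) + (J (2 * h) a - J (2 * h) b))
     \<le> h\<^sup>2 * norm (A (A f)) + n * h\<^sup>2 * norm (A (A f))"
    using 1 2 by (rule norm_triangle_mono)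
  moreover have "S h (2 * Suc n) f = J h (J h a)" "S (2 * h) (Suc n) f = J (2 * h) b"
    by (simp_all add: a_def b_def)
  moreover have "h\<^sup>2 * norm (A (A f)) + n * h\<^sup>2 * norm (A (A f)) = Suc n * h\<^sup>2 * norm (A (A f))"
    by (simp add: distrib_right)
  ultimately show ?case by simp
qed simp

text \<open>Resolvents of elements of \<open>D\<close> lie in the domain of A^2, and
  \<open>norm (J h w - w)\<close> is at most \<open>h * norm (A w)\<close>, which is small for small
  \<open>h\<close>.\<close>

lemma dense2:
  assumes "f \<in> X" "0 < e"
  shows "\<exists>w\<in>D. A w \<in> D \<and> norm (f - w) < e"
proof -
  obtain w where w: "w \<in> D" "norm (f - w) < e / 2" using dense[of f "e/2"] assms by auto
  \<comment> \<open>The bound \<open>N\<close> is taken positive because \<open>h\<close> divides by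
    it, while \<open>A w\<close> may vanish.\<close>
  obtain N where n: "N > 0" "norm (A w) \<le> N" by (rule that[of "norm (A w) + 1"]) (use norm_ge_zero[of "A w"] in linarith)+
  define h where "h = e / 2 / N"
  have h: "h > 0" using assms n by (simp add: h_def)
  have wX: "w \<in> X" using w DX by auto
  have "norm (J h w - w) \<le> h * norm (A w)"
    using J_step[OF h w(1)] J_norm[OF h A_in[OF w(1)]] h by simp
  also have "\<dots> \<le> h * N" using h n by (simp add: mult_left_mono)
  also have "\<dots> = e / 2" using n by (simp add: h_def)
  finally have "norm (J h w - w) \<le> e / 2" .
  moreover have "norm (f - J h w) \<le> norm (f - w) + norm (J h w - w)"
    using norm_triangle_ineq4[of "f - w" "J h w - w"] by simp
  ultimately have "norm (f - J h w) < e" using w(2) by linarith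
  then show ?thesis using J_D[OF h wX] A_J_D[OF h w(1)] by blast
qed

section \<open>Dyadic approximations and their limit, the semigroup\<close>

definition U :: "nat \<Rightarrow> real \<Rightarrow> 'a \<Rightarrow> 'a" where
  "U k t = S ((1/2)^k) (nat \<lfloor>t * 2^k\<rfloor>)"

lemma U_X: "f \<in> X \<Longrightarrow> U k t f \<in> X"
  by (simp add: U_def S_X)

lemma U_diff_norm: "f \<in> X \<Longrightarrow> g \<in> X \<Longrightarrow> norm (U k t f - U k t g) \<le> norm (f - g)"
  by (simp add: U_def S_diff_norm)

text \<open>With dyadic steps, passing from \<open>k\<close> to \<open>Suc k\<close> is one halving
  of the step plus rounding. Halving costs \<open>n * h\<^sup>2\<close>, which is of order
  \<open>t / 2^k\<close>, and rounding costs at most one step; the resulting bound is summable in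
  \<open>k\<close>.\<close>

lemma U_step:
  assumes f: "f \<in> D" "A f \<in> D" and t: "0 \<le> t"
  shows "norm (U (Suc k) t f - U k t f) \<le> (1/2)^k * (t * norm (A (A f)) + norm (A f))"
proof -
  define h :: real where "h = (1/2)^Suc k"
  have h: "0 < h" "2 * h = (1/2)^k" by (auto simp: h_def)
  define n m where "n = nat \<lfloor>t * 2^k\<rfloor>" and "m = nat \<lfloor>t * 2^Suc k\<rfloor>"
  have n: "real n \<le> t * 2^k" "t * 2^k < real n + 1" 
    and m: "real m \<le> t * 2^Suc k" "t * 2^Suc k < real m + 1" 
    using t by (simp_all add: n_def m_def)
  \<comment> \<open>Comparing the two floors as natural numbers shows that \<open>m\<close> is
    \<open>2 * n\<close> or \<open>2 * n + 1\<close>.\<close>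
  have "real m < real (2 * n + 2)" "real (2 * n) < real (m + 1)" using n m by auto
  then have nm: "\<bar>real m - real (2 * n)\<bar> \<le> 1" unfolding of_nat_less_iff by linarith
  have "norm (S h m f - S h (2 * n) f) \<le> \<bar>real m - real (2 * n)\<bar> * h * norm (A f)"
    by (rule S_lipschitz'[OF h(1) f(1)])
  also have "\<dots> \<le> (1/2)^k * norm (A f)"
  proof (rule mult_right_mono)
    have "\<bar>real m - real (2 * n)\<bar> * h \<le> 1 * h" using nm h by (intro mult_right_mono) auto
    then show "\<bar>real m - real (2 * n)\<bar> * h \<le> (1/2)^k" using h by linarith
  qed simp
  finally have 1: "norm (S h m f - S h (2 * n) f) \<le> (1/2)^k * norm (A f)" .
  have "norm (S h (2 * n) f - S (2 * h) n f) \<le> n * h\<^sup>2 * norm (A (A f))"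
    by (rule S_double[OF h(1) f])
  also have "\<dots> \<le> (1/2)^k * t * norm (A (A f))"
  proof (rule mult_right_mono)
    have "n * h\<^sup>2 \<le> t * 2^k * h\<^sup>2" using n by (intro mult_right_mono) auto
    also have "\<dots> = t * ((1/2)^k / 4)"
      by (simp add: h_def power2_eq_square field_simps)
    also have "\<dots> \<le> (1/2)^k * t" using t by simp
    finally show "n * h\<^sup>2 \<le> (1/2)^k * t" .
  qed simp
  finally have 2: "norm (S h (2 * n) f - S (2 * h) n f) \<le> (1/2)^k * t * norm (A (A f))" .
  have "U (Suc k) t f = S h m f" "U k t f = S (2 * h) n f" 
    by (simp_all add: U_def h_def n_def m_def)
  then have "norm (U (Suc k) t f - U k t f) = norm ((S h m f - S h (2 * n) f) + (S h (2 * n) f - S (2 * h) n f))"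
    by simp
  also have "\<dots> \<le> (1/2)^k * norm (A f) + (1/2)^k * t * norm (A (A f))"
    using 1 2 by (rule norm_triangle_mono)
  finally show ?thesis by (simp add: algebra_simps)
qed

text \<open>On the domain of A^2 the differences of \<open>U_step\<close> are dominated by a
  geometric series. All \<open>U k t\<close> being contractions, the Cauchy property extends to
  \<open>X\<close> by density.\<close>

lemma U_convergent:
  assumes "f \<in> X" "0 \<le> t"
  shows "convergent (\<lambda>k. U k t f)"
proof -
  have *: "convergent (\<lambda>k. U k t f)" if f: "f \<in> D" "A f \<in> D" for f
  proof -
    have "summable (\<lambda>k. U (Suc k) t f - U k t f)"
    proof (rule summable_comparison_test'[of _ 0])
      show "summable (\<lambda>k. (1/2)^k * (t * norm (A (A f)) + norm (A f)))"
        by (intro summable_mult2 summable_geometric) auto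
    qed (use U_step[OF f assms(2)] in auto)
    then have "convergent (\<lambda>n. (U n t f - U 0 t f) + U 0 t f)"
      unfolding summable_iff_convergent sum_lessThan_telescope[of "\<lambda>k. U k t f"]
      by (rule convergent_add[OF _ convergent_const])
    then show ?thesis by simp
  qed
  have "Cauchy (\<lambda>k. U k t f)"
    unfolding Cauchy_iff
  proof (intro allI impI)
    fix e :: real assume e: "e > 0"
    then obtain w where w: "w \<in> D" "A w \<in> D" "norm (f - w) < e / 3" 
      using dense2[of f "e/3"] assms by auto
    have wX: "w \<in> X" using w DX by auto
    obtain M where M: "\<And>m n. m \<ge> M \<Longrightarrow> n \<ge> M \<Longrightarrow> norm (U m t w - U n t w) < e / 3"
      using *[OF w(1,2)] e unfolding Cauchy_convergent_iff[symmetric] Cauchy_iff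
      by (metis zero_less_divide_iff zero_less_numeral)
    have "norm (U m t f - U n t f) < e" if "m \<ge> M" "n \<ge> M" for m n
    proof -
      have "norm (U m t f - U n t f) = norm ((U m t f - U m t w) + (U m t w - U n t w) - (U n t f - U n t w))"
        by simp
      also have "\<dots> \<le> norm (U m t f - U m t w) + norm (U m t w - U n t w) + norm (U n t f - U n t w)"
        by (rule norm_add_diff_le)
      also have "\<dots> < e / 3 + e / 3 + e / 3"
        using M[OF that] U_diff_norm[OF assms(1) wX, of m t] U_diff_norm[OF assms(1) wX, of n t] w(3)
        by linarith
      finally show ?thesis by simp
    qed
    then show "\<exists>M. \<forall>m\<ge>M. \<forall>n\<ge>M. norm (U m t f - U n t f) < e" by blast
  qed
  then show ?thesis by (simp add: Cauchy_convergent_iff)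
qed

definition T :: "real \<Rightarrow> 'a \<Rightarrow> 'a" where "T t f = lim (\<lambda>k. U k t f)"

lemma U_lim: "f \<in> X \<Longrightarrow> 0 \<le> t \<Longrightarrow> (\<lambda>k. U k t f) \<longlonglongrightarrow> T t f"
  unfolding T_def using U_convergent by (simp add: convergent_LIMSEQ_iff)

lemma T_X: "f \<in> X \<Longrightarrow> 0 \<le> t \<Longrightarrow> T t f \<in> X"
  by (rule closed_sequentially[OF closedX _ U_lim]) (auto intro: U_X)

lemma T_norm: "f \<in> X \<Longrightarrow> 0 \<le> t \<Longrightarrow> norm (T t f) \<le> norm f"
  by (rule Lim_bounded[OF tendsto_norm[OF U_lim], of _ _ 0]) (auto simp: U_def S_norm)

lemma T_linear:
  assumes "f \<in> X" "g \<in> X" "0 \<le> t"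
  shows "T t (a *\<^sub>R f + b *\<^sub>R g) = a *\<^sub>R T t f + b *\<^sub>R T t g"
proof (rule LIMSEQ_unique)
  show "(\<lambda>k. U k t (a *\<^sub>R f + b *\<^sub>R g)) \<longlonglongrightarrow> T t (a *\<^sub>R f + b *\<^sub>R g)"
    using assms by (intro U_lim X_intros)
  have "(\<lambda>k. a *\<^sub>R U k t f + b *\<^sub>R U k t g) \<longlonglongrightarrow> a *\<^sub>R T t f + b *\<^sub>R T t g"
    using assms by (intro tendsto_intros U_lim)
  moreover have "a *\<^sub>R U k t f + b *\<^sub>R U k t g = U k t (a *\<^sub>R f + b *\<^sub>R g)" for k
    using assms by (simp add: U_def S_linear)
  ultimately show "(\<lambda>k. U k t (a *\<^sub>R f + b *\<^sub>R g)) \<longlonglongrightarrow> a *\<^sub>R T t f + b *\<^sub>R T t g" by simp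
qed

lemma T_diff_norm:
  assumes "f \<in> X" "g \<in> X" "0 \<le> t"
  shows "norm (T t f - T t g) \<le> norm (f - g)"
  using T_linear[OF assms, of 1 "-1"] T_norm[of "f - g" t] assms by (auto intro: X_intros)

lemma T_zero: "f \<in> X \<Longrightarrow> T 0 f = f"
  using U_lim[of f 0] by (simp add: U_def LIMSEQ_const_iff)

lemma tendsto_half_powers: "(\<lambda>k. (1/2::real)^k) \<longlonglongrightarrow> 0"
  by (rule LIMSEQ_power_zero) simp

lemma grid_floor:
  assumes "0 \<le> t"
  shows "real (nat \<lfloor>t * 2^k\<rfloor>) * (1/2)^k \<le> t" "t \<le> real (nat \<lfloor>t * 2^k\<rfloor>) * (1/2)^k + (1/2)^k"
proof -
  define n where "n = nat \<lfloor>t * 2^k\<rfloor>"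
  have n: "real n \<le> t * 2^k" "t * 2^k \<le> real n + 1" using assms by (simp_all add: n_def)
  have "real n * (1/2)^k \<le> t * 2^k * (1/2)^k" using n(1) by (rule mult_right_mono) simp
  then show "real (nat \<lfloor>t * 2^k\<rfloor>) * (1/2)^k \<le> t" by (simp add: n_def power_one_over)
  have "t * 2^k * (1/2)^k \<le> (real n + 1) * (1/2)^k" using n(2) by (rule mult_right_mono) simp
  then show "t \<le> real (nat \<lfloor>t * 2^k\<rfloor>) * (1/2)^k + (1/2)^k"
    by (simp add: n_def power_one_over algebra_simps)
qed

text \<open>The Lipschitz bound of the scheme survives in the limit, since the grid times differ
  from \<open>s\<close> and \<open>t\<close> by at most one mesh width.\<close>

lemma T_lipschitz:
  assumes f: "f \<in> D" and st: "0 \<le> s" "0 \<le> t"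
  shows "norm (T t f - T s f) \<le> \<bar>t - s\<bar> * norm (A f)"
proof (rule LIMSEQ_le)
  have X: "f \<in> X" using f DX by auto
  show "(\<lambda>k. norm (U k t f - U k s f)) \<longlonglongrightarrow> norm (T t f - T s f)"
    by (intro tendsto_intros U_lim X st)
  show "(\<lambda>k. (\<bar>t - s\<bar> + (1/2)^k) * norm (A f)) \<longlonglongrightarrow> \<bar>t - s\<bar> * norm (A f)"
    by (rule tendsto_eq_intros tendsto_half_powers refl | simp)+
  have "norm (U k t f - U k s f) \<le> (\<bar>t - s\<bar> + (1/2)^k) * norm (A f)" for k
  proof -
    define n m where "n = nat \<lfloor>t * 2^k\<rfloor>" and "m = nat \<lfloor>s * 2^k\<rfloor>"
    have "norm (U k t f - U k s f) \<le> \<bar>real n - real m\<bar> * (1/2)^k * norm (A f)"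
      unfolding U_def n_def m_def by (intro S_lipschitz' f) simp
    also have "\<dots> \<le> (\<bar>t - s\<bar> + (1/2)^k) * norm (A f)"
    proof (rule mult_right_mono)
      have "\<bar>real n - real m\<bar> * (1/2)^k = \<bar>real n * (1/2)^k - real m * (1/2)^k\<bar>"
        by (simp add: abs_mult flip: left_diff_distrib)
      also have "\<dots> \<le> \<bar>t - s\<bar> + (1/2)^k"
        using grid_floor[OF st(1), of k] grid_floor[OF st(2), of k] unfolding n_def m_def by linarith
      finally show "\<bar>real n - real m\<bar> * (1/2)^k \<le> \<bar>t - s\<bar> + (1/2)^k" .
    qed simp
    finally show ?thesis .
  qed
  then show "\<exists>N. \<forall>n\<ge>N. norm (U n t f - U n s f) \<le> (\<bar>t - s\<bar> + (1/2)^n) * norm (A f)" by blast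
qed

lemma T_continuous:
  assumes f: "f \<in> X"
  shows "continuous_on {0..} (\<lambda>t. T t f)"
  unfolding continuous_on_iff
proof (intro ballI allI impI)
  fix t e :: real assume t: "t \<in> {0..}" and e: "0 < e"
  obtain w where w: "w \<in> D" "norm (f - w) < e / 3" using dense[of f "e/3"] f e by auto
  have wX: "w \<in> X" using w DX by auto
  obtain N where n: "N > 0" "norm (A w) \<le> N" by (rule that[of "norm (A w) + 1"]) (use norm_ge_zero[of "A w"] in linarith)+
  define d where "d = e / 3 / N"
  have d: "d > 0" using e n by (simp add: d_def)
  have "dist (T s f) (T t f) < e" if s: "s \<in> {0..}" "dist s t < d" for s
  proof -
    have "norm (T s w - T t w) \<le> \<bar>s - t\<bar> * norm (A w)" using T_lipschitz[OF w(1), of t s] s t by auto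
    also have "\<dots> \<le> d * N"
      using s d n by (intro mult_mono) (auto simp: dist_real_def)
    also have "\<dots> = e / 3" using n by (simp add: d_def)
    finally have 1: "norm (T s w - T t w) \<le> e / 3" .
    have "norm (T s f - T t f) = norm ((T s f - T s w) + (T s w - T t w) - (T t f - T t w))" by simp
    also have "\<dots> \<le> norm (T s f - T s w) + norm (T s w - T t w) + norm (T t f - T t w)"
      by (rule norm_add_diff_le)
    also have "\<dots> < e / 3 + e / 3 + e / 3"
      using 1 T_diff_norm[OF f wX, of s] T_diff_norm[OF f wX, of t] w(2) s t by auto
    finally show ?thesis by (simp add: dist_norm)
  qed
  then show "\<exists>d>0. \<forall>s\<in>{0..}. dist s t < d \<longrightarrow> dist (T s f) (T t f) < e" using d by blast
qed

text \<open>The discrete law holds up to one step, because the floors of \<open>s * 2^k\<close> and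
  \<open>t * 2^k\<close> add up to that of \<open>(s + t) * 2^k\<close> or to one less. For
  \<open>w\<close> in \<open>D\<close> one step is negligible in the limit. Contractivity lets the
  inner limit be taken inside \<open>U k s\<close> and finally carries the law from \<open>D\<close>
  to \<open>X\<close>.\<close>

lemma T_add:
  assumes f: "f \<in> X" and st: "0 \<le> s" "0 \<le> t"
  shows "T (s + t) f = T s (T t f)"
proof -
  have *: "T (s + t) w = T s (T t w)" if w: "w \<in> D" for w
  proof -
    have X: "w \<in> X" using w DX by auto
    have "(\<lambda>k. norm (U k t w - T t w)) \<longlonglongrightarrow> 0"
      by (intro tendsto_norm_zero LIM_zero U_lim X st)
    moreover have "norm (U k s (U k t w) - U k s (T t w)) \<le> norm (U k t w - T t w)" for k
      using X st by (intro U_diff_norm U_X T_X)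
    ultimately have "(\<lambda>k. norm (U k s (U k t w) - U k s (T t w))) \<longlonglongrightarrow> 0"
      by (intro Lim_null_comparison[of "\<lambda>k. norm (U k s (U k t w) - U k s (T t w))"]) auto
    then have "(\<lambda>k. (U k s (U k t w) - U k s (T t w)) + U k s (T t w)) \<longlonglongrightarrow> 0 + T s (T t w)"
      using X st by (intro tendsto_add U_lim T_X) (auto simp: tendsto_norm_zero_iff)
    then have 1: "(\<lambda>k. U k s (U k t w)) \<longlonglongrightarrow> T s (T t w)" by simp
    have "norm (U k (s + t) w - U k s (U k t w)) \<le> (1/2)^k * norm (A w)" for k
    proof -
      define n m p where "n = nat \<lfloor>(s + t) * 2^k\<rfloor>" and "m = nat \<lfloor>s * 2^k\<rfloor>" and "p = nat \<lfloor>t * 2^k\<rfloor>"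
      have "real n \<le> (s + t) * 2^k" "(s + t) * 2^k < real n + 1" 
        "real m \<le> s * 2^k" "s * 2^k < real m + 1" "real p \<le> t * 2^k" "t * 2^k < real p + 1" 
        using st by (simp_all add: n_def m_def p_def)
      then have "real n < real (m + p + 2)" "real (m + p) < real (n + 1)"
        by (simp_all add: distrib_right)
      then have nmp: "\<bar>real n - real (m + p)\<bar> \<le> 1" unfolding of_nat_less_iff by linarith
      have "norm (U k (s + t) w - U k s (U k t w)) \<le> \<bar>real n - real (m + p)\<bar> * (1/2)^k * norm (A w)"
        using S_lipschitz'[OF _ w, of "(1/2)^k" n "m + p"]
        by (simp add: U_def n_def m_def p_def funpow_add)
      also have "\<dots> \<le> 1 * (1/2)^k * norm (A w)"
        using nmp by (intro mult_right_mono) auto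
      finally show ?thesis by simp
    qed
    moreover have "(\<lambda>k. (1/2)^k * norm (A w)) \<longlonglongrightarrow> 0"
      by (rule tendsto_mult_left_zero[OF tendsto_half_powers])
    ultimately have "(\<lambda>k. U k (s + t) w - U k s (U k t w)) \<longlonglongrightarrow> 0"
      by (intro Lim_null_comparison[of "\<lambda>k. U k (s + t) w - U k s (U k t w)"]) auto
    from tendsto_add[OF this 1] have "(\<lambda>k. U k (s + t) w) \<longlonglongrightarrow> T s (T t w)" by simp
    then show ?thesis using U_lim[OF X, of "s + t"] st by (auto intro: LIMSEQ_unique)
  qed
  have "norm (T (s + t) f - T s (T t f)) \<le> e" if e: "0 < e" for e
  proof -
    obtain w where w: "w \<in> D" "norm (f - w) < e / 2" using dense[of f "e/2"] f e by auto
    have X: "w \<in> X" using w DX by auto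
    have "norm (T s (T t w) - T s (T t f)) \<le> norm (T t w - T t f)"
      using f X st by (intro T_diff_norm T_X)
    also have "\<dots> \<le> norm (w - f)" using f X st by (intro T_diff_norm)
    finally have "norm (T s (T t w) - T s (T t f)) \<le> norm (f - w)" by (simp add: norm_minus_commute)
    moreover have "norm (T (s + t) f - T (s + t) w) \<le> norm (f - w)"
      using f X st by (intro T_diff_norm) auto
    moreover have "norm (T (s + t) f - T s (T t f)) 
       = norm ((T (s + t) f - T (s + t) w) + (T s (T t w) - T s (T t f)))"
      by (simp add: *[OF w(1)])
    ultimately show ?thesis using w(2)
      by (smt (verit, best) field_sum_of_halves norm_triangle_ineq)
  qed
  then have "norm (T (s + t) f - T s (T t f)) \<le> 0" by (rule field_le_epsilon) simp
  then show ?thesis by simp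
qed

lemma T_semigroup: "contraction_semigroup X T"
  unfolding contraction_semigroup_def
  by (intro conjI allI impI ballI T_X T_norm T_linear T_zero T_add T_continuous)

section \<open>The generator of the limit semigroup\<close>

lemma S_near:
  fixes j n :: nat and h :: real
  assumes h: "0 < h" and g: "g \<in> X" and w: "w \<in> D" and j: "j \<le> n"
  shows "norm (S h j g - g) \<le> 2 * norm (g - w) + n * h * norm (A w)"
proof -
  have X: "w \<in> X" using w DX by auto
  have "norm (S h j w - w) \<le> j * h * norm (A w)" using S_lipschitz[OF h w, of 0 j] by simp
  also have "\<dots> \<le> n * h * norm (A w)" using h j by (intro mult_right_mono) auto
  finally have "norm (S h j w - w) \<le> n * h * norm (A w)" .
  moreover have "norm (S h j g - S h j w) \<le> norm (g - w)" by (rule S_diff_norm[OF h g X])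
  moreover have "norm (S h j g - g) \<le> norm (S h j g - S h j w) + norm (S h j w - w) + norm (g - w)"
  proof -
    have "S h j g - g = (S h j g - S h j w) + (S h j w - w) - (g - w)" by simp
    then show ?thesis by (simp only: norm_add_diff_le)
  qed
  ultimately show ?thesis by linarith
qed

text \<open>\<open>S h m f - f\<close> is a sum of \<open>m\<close> increments
  \<open>h *\<^sub>R S h j (A f)\<close>. Since \<open>A f\<close> need not lie in \<open>D\<close>,
  \<open>S_near\<close> compares each of them with \<open>h *\<^sub>R A f\<close> through an
  auxiliary \<open>w\<close> in \<open>D\<close>, uniformly in \<open>j\<close>.\<close>

lemma S_taylor:
  fixes m n :: nat and h :: real
  assumes h: "0 < h" and f: "f \<in> D" and w: "w \<in> D" and m: "m \<le> n"
  shows "norm (S h m f - f - (m * h) *\<^sub>R A f) \<le> m * h * (2 * norm (A f - w) + n * h * norm (A w))"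
  using m
proof (induction m)
  case (Suc m)
  let ?B = "2 * norm (A f - w) + n * h * norm (A w)"
  have "norm (S h (Suc m) (A f) - A f) \<le> ?B"
    by (rule S_near[OF h A_in[OF f] w Suc.prems])
  then have "norm (h *\<^sub>R (S h (Suc m) (A f) - A f)) \<le> h * ?B"
    using h by (simp add: mult_left_mono del: funpow.simps)
  moreover have "S h (Suc m) f - f - (Suc m * h) *\<^sub>R A f
     = (S h m f - f - (m * h) *\<^sub>R A f) + h *\<^sub>R (S h (Suc m) (A f) - A f)"
  proof -
    have "S h (Suc m) f - f - (Suc m * h) *\<^sub>R A f 
       = (S h (Suc m) f - S h m f) + (S h m f - f - (m * h) *\<^sub>R A f) - h *\<^sub>R A f"
      by (simp add: algebra_simps)
    then show ?thesis unfolding S_step[OF h f] by (simp add: algebra_simps)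
  qed
  ultimately have "norm (S h (Suc m) f - f - (Suc m * h) *\<^sub>R A f) \<le> m * h * ?B + h * ?B"
    using Suc by (metis Suc_leD norm_triangle_mono)
  then show ?case by (simp add: algebra_simps)
qed simp

lemma T_taylor:
  assumes f: "f \<in> D" and w: "w \<in> D" and t: "0 \<le> t"
  shows "norm (T t f - f - t *\<^sub>R A f) \<le> t * (2 * norm (A f - w) + t * norm (A w))"
proof (rule LIMSEQ_le)
  have X: "f \<in> X" using f DX by auto
  let ?n = "\<lambda>k. nat \<lfloor>t * 2^k\<rfloor>" and ?h = "\<lambda>k. (1/2::real)^k"
  have nh: "(\<lambda>k. real (?n k) * ?h k) \<longlonglongrightarrow> t"
  proof (rule tendsto_sandwich)
    show "(\<lambda>k. t - ?h k) \<longlonglongrightarrow> t" "(\<lambda>k. t) \<longlonglongrightarrow> t"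
      by (rule tendsto_eq_intros tendsto_half_powers refl | simp)+
  qed (use grid_floor[OF t] in \<open>auto simp: algebra_simps intro!: always_eventually\<close>)
  show "(\<lambda>k. norm (U k t f - f - (real (?n k) * ?h k) *\<^sub>R A f)) \<longlonglongrightarrow> norm (T t f - f - t *\<^sub>R A f)"
    by (intro tendsto_intros nh U_lim X t)
  show "(\<lambda>k. real (?n k) * ?h k * (2 * norm (A f - w) + real (?n k) * ?h k * norm (A w)))
     \<longlonglongrightarrow> t * (2 * norm (A f - w) + t * norm (A w))"
    by (intro tendsto_intros nh)
  show "\<exists>N. \<forall>k\<ge>N. norm (U k t f - f - (real (?n k) * ?h k) *\<^sub>R A f)
     \<le> real (?n k) * ?h k * (2 * norm (A f - w) + real (?n k) * ?h k * norm (A w))"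
    unfolding U_def using S_taylor[OF _ f w order_refl] by auto
qed

lemma T_generator:
  assumes f: "f \<in> D"
  shows "((\<lambda>h. (T h f - f) /\<^sub>R h) \<longlongrightarrow> A f) (at_right 0)"
proof (rule tendstoI)
  fix e :: real assume e: "0 < e"
  \<comment> \<open>By \<open>T_taylor\<close> the error is at most
    \<open>2 * norm (A f - w) + h * norm (A w)\<close>; the choices of \<open>w\<close> and
    \<open>d\<close> make each of the two terms at most \<open>e / 2\<close>.\<close>
  obtain w where w: "w \<in> D" "norm (A f - w) < e / 4" using dense[OF A_in[OF f], of "e/4"] e by auto
  obtain N where n: "N > 0" "norm (A w) \<le> N" by (rule that[of "norm (A w) + 1"]) (use norm_ge_zero[of "A w"] in linarith)+
  define d where "d = e / 2 / N"
  have d: "d > 0" using e n by (simp add: d_def)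
  have "dist ((T h f - f) /\<^sub>R h) (A f) < e" if h: "0 < h" "h < d" for h
  proof -
    have "(T h f - f) /\<^sub>R h - A f = (1 / h) *\<^sub>R (T h f - f - h *\<^sub>R A f)"
      using h by (simp add: algebra_simps divide_inverse)
    then have "norm ((T h f - f) /\<^sub>R h - A f) = (1 / h) * norm (T h f - f - h *\<^sub>R A f)"
      using h by simp
    also have "\<dots> \<le> (1 / h) * (h * (2 * norm (A f - w) + h * norm (A w)))"
      using h by (intro mult_left_mono T_taylor f w) auto
    also have "\<dots> = 2 * norm (A f - w) + h * norm (A w)" using h by simp
    also have "h * norm (A w) \<le> d * N" using h n by (intro mult_mono) auto
    also have "d * N = e / 2" using n by (simp add: d_def)
    finally show ?thesis using w(2) by (simp add: dist_norm)
  qed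
  then show "\<forall>\<^sub>F h in at_right 0. dist ((T h f - f) /\<^sub>R h) (A f) < e"
    using d by (auto simp: eventually_at_right_field)
qed

text \<open>An orbit leaving \<open>z\<close> with velocity \<open>z\<close> would have norm about
  \<open>(1 + h) * norm z\<close> after time \<open>h\<close>, which a contraction forbids: 1 is not
  an eigenvalue of the generator.\<close>

lemma T_no_growth:
  assumes z: "z \<in> X" and lim: "((\<lambda>h. (T h z - z) /\<^sub>R h) \<longlongrightarrow> z) (at_right 0)"
  shows "z = 0"
proof (rule ccontr)
  assume "z \<noteq> 0"
  then have "\<forall>\<^sub>F h in at_right 0. dist ((T h z - z) /\<^sub>R h) z < norm z"
    using lim by (intro tendstoD) auto
  then obtain d where d: "d > 0" "\<And>h. 0 < h \<Longrightarrow> h < d \<Longrightarrow> dist ((T h z - z) /\<^sub>R h) z < norm z"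
    by (auto simp: eventually_at_right_field)
  define h where "h = d / 2"
  have h: "h > 0" "h < d" using d by (auto simp: h_def)
  have "(T h z - z) /\<^sub>R h - z = (1 / h) *\<^sub>R (T h z - (1 + h) *\<^sub>R z)"
    using h by (simp add: algebra_simps divide_inverse)
  then have "(1 / h) * norm (T h z - (1 + h) *\<^sub>R z) < norm z"
    using d(2)[OF h] h by (simp add: dist_norm)
  then have "norm (T h z - (1 + h) *\<^sub>R z) < h * norm z"
    using h by (simp add: field_simps)
  moreover have "norm ((1 + h) *\<^sub>R z) \<le> norm (T h z) + norm (T h z - (1 + h) *\<^sub>R z)"
    using norm_triangle_sub[of "(1 + h) *\<^sub>R z" "T h z"] by (simp add: norm_minus_commute)
  moreover have "norm (T h z) \<le> norm z" using z h by (intro T_norm) auto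
  moreover have "norm ((1 + h) *\<^sub>R z) = norm z + h * norm z" using h by (simp add: distrib_right)
  ultimately show False by linarith
qed

text \<open>By \<open>T_generator\<close> the generator extends \<open>A\<close>, and the range
  condition excludes a proper extension. If the generator maps \<open>f\<close> to \<open>g\<close>,
  solve \<open>w - A w = f - g\<close> in \<open>D\<close>; the generator then maps
  \<open>f - w\<close> to itself, so \<open>f = w\<close>.\<close>

theorem generates_T: "generates X D A T"
proof -
  have "f \<in> D \<and> g = A f"
    if f: "f \<in> X" and lim: "((\<lambda>h. (T h f - f) /\<^sub>R h) \<longlongrightarrow> g) (at_right 0)" for f g
  proof -
  have "(T h f - f) /\<^sub>R h \<in> X" if "h > 0" for h
    using f that by (intro X_intros T_X) auto
  then have g: "g \<in> X"
    by (intro Lim_in_closed_set[OF closedX _ _ lim])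
       (auto simp: eventually_at_right_field intro!: exI[of _ 1])
  obtain w where w: "w \<in> D" "w - 1 *\<^sub>R A w = f - g"
    using surj[of 1 "f - g"] f g X_intros by auto
  have wX: "w \<in> X" using w DX by auto
  have "((\<lambda>h. (T h f - f) /\<^sub>R h - (T h w - w) /\<^sub>R h) \<longlongrightarrow> g - A w) (at_right 0)"
    by (intro tendsto_diff lim T_generator w)
  moreover have "\<forall>\<^sub>F h in at_right 0. 
      (T h f - f) /\<^sub>R h - (T h w - w) /\<^sub>R h = (T h (f - w) - (f - w)) /\<^sub>R h"
  proof -
    have "T h (f - w) = T h f - T h w" if "0 < h" for h
      using T_linear[OF f wX, of h 1 "-1"] that by simp
    then show ?thesis
      by (auto simp: eventually_at_right_field simp flip: scaleR_diff_right intro!: exI[of _ 1])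
  qed
  ultimately have "((\<lambda>h. (T h (f - w) - (f - w)) /\<^sub>R h) \<longlongrightarrow> g - A w) (at_right 0)"
    by (simp add: tendsto_cong)
  moreover have "g - A w = f - w" using w by (simp add: algebra_simps)
  ultimately have "f - w = 0" using T_no_growth[of "f - w"] f wX X_intros by auto
    then show ?thesis using w by auto
  qed
  then show ?thesis
    unfolding generates_def using T_semigroup T_generator by blast
qed

end

text \<open>The values \<open>v (k * h)\<close> satisfy the implicit Euler scheme with a residual of
  at most \<open>h * e\<close> per step, by uniform continuity of \<open>v'\<close>. Dissipativity
  makes each step a contraction, so \<open>norm (v t)\<close> is at most \<open>t * e\<close> for
  every positive \<open>e\<close>.\<close>

lemma (in dissipative_op) cauchy_problem_unique:
  assumes v': "\<And>t. 0 \<le> t \<Longrightarrow> (v has_vector_derivative v' t) (at t within {0..})"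
    and cont: "continuous_on {0..} v'"
    and ode: "\<And>t. 0 < t \<Longrightarrow> v t \<in> D \<and> v' t = A (v t)"
    and v0: "v 0 = 0" and t: "0 \<le> t"
  shows "v t = 0"
proof (cases "t = 0")
  case False
  with t have t: "0 < t" by simp
  have "norm (v t) \<le> t * e" if e: "0 < e" for e
  proof -
    have "uniformly_continuous_on {0..t} v'"
      by (intro compact_uniformly_continuous continuous_on_subset[OF cont]) auto
    then obtain d where d: "d > 0"
      "\<And>s r. s \<in> {0..t} \<Longrightarrow> r \<in> {0..t} \<Longrightarrow> dist s r < d \<Longrightarrow> dist (v' s) (v' r) < e"
      using e unfolding uniformly_continuous_on_def by metis
    obtain n where n: "t / d < real n" using reals_Archimedean2 by blast
    then have n0: "0 < real n" using t d by (meson divide_pos_pos order_less_trans)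
    define h where "h = t / n"
    have h: "0 < h" "h < d" "n * h = t" using n n0 t d by (auto simp: h_def field_simps)
    have "norm (v (k * h)) \<le> k * h * e" if "k \<le> n" for k :: nat
      using that
    proof (induction k)
      case (Suc k)
      define a b where "a = k * h" and "b = Suc k * h"
      have "b \<le> n * h" using Suc.prems h unfolding b_def by (intro mult_right_mono) auto
      then have ab: "0 \<le> a" "b = a + h" "b \<le> t" "0 < b"
        using h by (auto simp: a_def b_def algebra_simps intro: add_pos_nonneg)
      \<comment> \<open>The expansion is made at the right end \<open>b\<close> because the scheme
        is implicit; moreover \<open>b\<close> is positive, so the equation is available there even
        when \<open>a\<close> is 0.\<close>
      have "norm (v b - v a - (b - a) *\<^sub>R v' b) \<le> norm (b - a) * e"
      proof (rule vector_differentiable_bound_linearization)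
        show "(v has_vector_derivative v' x) (at x within {a..b})" if "x \<in> {a..b}" for x
          using that ab by (intro has_vector_derivative_within_subset[OF v']) auto
        show "norm (v' x - v' b) \<le> e" if "x \<in> {a..b}" for x
          using that ab h d(2)[of x b] by (auto simp: dist_norm)
      qed (use ab h in \<open>auto simp: closed_segment_eq_real_ivl\<close>)
      then have 1: "norm (v b - v a - h *\<^sub>R v' b) \<le> h * e" using ab h by simp
      have b: "v b \<in> D" "v' b = A (v b)" using ode ab by auto
      have "norm (v b) \<le> norm (v b - h *\<^sub>R A (v b))" by (rule dissip[OF h(1) b(1)])
      also have "v b - h *\<^sub>R A (v b) = v a + (v b - v a - h *\<^sub>R v' b)" by (simp add: b)
      also have "norm \<dots> \<le> k * h * e + h * e"
        using Suc 1 by (intro norm_triangle_mono) (auto simp: a_def)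
      finally show ?case by (simp add: b_def algebra_simps)
    qed (simp add: v0)
    from this[of n] show ?thesis using h by simp
  qed
  \<comment> \<open>The bound \<open>t * e\<close> is applied with \<open>e / t\<close> in place of
    \<open>e\<close>.\<close>
  then have "norm (v t) \<le> 0 + e" if "0 < e" for e
    using t that by (metis add_0 divide_pos_pos nonzero_mult_div_cancel_left times_divide_eq_right less_irrefl)
  then have "norm (v t) \<le> 0" by (rule field_le_epsilon)
  then show ?thesis by simp
qed (simp add: v0)

section \<open>Orbits and Duhamel's integral, from the generator alone\<close>

locale generated_semigroup =
  fixes X D :: "'a::banach set" and A :: "'a \<Rightarrow> 'a" and T :: "real \<Rightarrow> 'a \<Rightarrow> 'a" and P :: "'a \<Rightarrow> 'a"
  assumes gen: "generates X D A T" and DX: "D \<subseteq> X"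
    and P_linear: "bounded_linear P" and P_in: "\<And>x. P x \<in> X" and P_id: "\<And>x. x \<in> X \<Longrightarrow> P x = x"
begin

lemma X_intros: "x \<in> X \<Longrightarrow> y \<in> X \<Longrightarrow> x + y \<in> X" "x \<in> X \<Longrightarrow> y \<in> X \<Longrightarrow> x - y \<in> X"
  "x \<in> X \<Longrightarrow> c *\<^sub>R x \<in> X"
  using P_in[of "x + y"] P_in[of "x - y"] P_in[of "c *\<^sub>R x"] P_id P_linear
  by (auto simp: linear_simps)

text \<open>\<open>X\<close> is the kernel of the continuous map \<open>P x - x\<close>.\<close>

lemma closedX: "closed X"
proof -
  have "X = {x. P x - x = 0}" using P_in P_id by (auto, metis)
  moreover have "closed {x. P x - x = 0}"
    by (intro closed_Collect_eq continuous_intros bounded_linear.continuous_on[OF P_linear])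
  ultimately show ?thesis by simp
qed

lemma T_X: "0 \<le> t \<Longrightarrow> f \<in> X \<Longrightarrow> T t f \<in> X"
  and T_norm: "0 \<le> t \<Longrightarrow> f \<in> X \<Longrightarrow> norm (T t f) \<le> norm f"
  and T_linear: "0 \<le> t \<Longrightarrow> f \<in> X \<Longrightarrow> g \<in> X \<Longrightarrow> T t (a *\<^sub>R f + b *\<^sub>R g) = a *\<^sub>R T t f + b *\<^sub>R T t g"
  and T_0: "f \<in> X \<Longrightarrow> T 0 f = f"
  and T_plus: "0 \<le> s \<Longrightarrow> 0 \<le> t \<Longrightarrow> f \<in> X \<Longrightarrow> T (s + t) f = T s (T t f)"
  and T_cont: "f \<in> X \<Longrightarrow> continuous_on {0..} (\<lambda>t. T t f)"
  using gen unfolding generates_def contraction_semigroup_def by blast+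

lemma generator_iff:
  "f \<in> X \<Longrightarrow> ((\<lambda>h. (T h f - f) /\<^sub>R h) \<longlongrightarrow> g) (at_right 0) \<longleftrightarrow> f \<in> D \<and> g = A f"
  using gen unfolding generates_def by blast

lemma T_diff: "0 \<le> t \<Longrightarrow> f \<in> X \<Longrightarrow> g \<in> X \<Longrightarrow> T t (f - g) = T t f - T t g"
  using T_linear[of t f g 1 "-1"] by simp

lemma T_add: "0 \<le> t \<Longrightarrow> f \<in> X \<Longrightarrow> g \<in> X \<Longrightarrow> T t (f + g) = T t f + T t g"
  using T_linear[of t f g 1 "1"] by simp

lemma T_scale: "0 \<le> t \<Longrightarrow> f \<in> X \<Longrightarrow> T t (c *\<^sub>R f) = c *\<^sub>R T t f"
  using T_linear[of t f f c 0] by simp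

text \<open>\<open>T t\<close> is linear only on the subspace \<open>X\<close>. Precomposing it with
  the projection \<open>P\<close> gives a bounded linear map on the whole type, to which the general
  rules on limits and integrals apply.\<close>

lemma T_P_linear:
  assumes t: "0 \<le> t"
  shows "bounded_linear (\<lambda>x. T t (P x))"
proof -
  obtain K where K: "\<And>x. norm (P x) \<le> norm x * K" using bounded_linear.bounded[OF P_linear] by blast
  show ?thesis
    using K order_trans[OF T_norm[OF t P_in] K]
    by (intro bounded_linear_intro[where K = K])
      (auto simp: linear_simps[OF P_linear] T_add[OF t] T_scale[OF t] P_in)
qed

lemma A_X: "f \<in> D \<Longrightarrow> A f \<in> X"
proof -
  assume f: "f \<in> D"
  then have X: "f \<in> X" using DX by auto
  have "((\<lambda>h. (T h f - f) /\<^sub>R h) \<longlongrightarrow> A f) (at_right 0)" using generator_iff[OF X] f by simp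
  moreover have "(T h f - f) /\<^sub>R h \<in> X" if "h > 0" for h
    using X that by (intro X_intros T_X) auto
  ultimately show "A f \<in> X"
    by (intro Lim_in_closed_set[OF closedX])
       (auto simp: eventually_at_right_field intro!: exI[of _ 1])
qed

text \<open>\<open>T t\<close> is continuous on \<open>X\<close> and commutes with every
  \<open>T h\<close>, so it carries the difference quotients of the orbit of \<open>f\<close> at 0
  to those of the orbit of \<open>T t f\<close>.\<close>

lemma
  assumes f: "f \<in> D" and t: "0 \<le> t"
  shows T_D: "T t f \<in> D" and A_T: "A (T t f) = T t (A f)"
proof -
  have X: "f \<in> X" using f DX by auto
  have "((\<lambda>h. (T h f - f) /\<^sub>R h) \<longlongrightarrow> A f) (at_right 0)" using generator_iff[OF X] f by simp
  then have "((\<lambda>h. T t (P ((T h f - f) /\<^sub>R h))) \<longlongrightarrow> T t (P (A f))) (at_right 0)"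
    by (rule bounded_linear.tendsto[OF T_P_linear[OF t]])
  also have "?this \<longleftrightarrow> ((\<lambda>h. (T h (T t f) - T t f) /\<^sub>R h) \<longlongrightarrow> T t (A f)) (at_right 0)"
  proof (rule filterlim_cong[OF _ refl])
    show "nhds (T t (P (A f))) = nhds (T t (A f))" using A_X[OF f] by (simp add: P_id)
    have "T t (P ((T h f - f) /\<^sub>R h)) = (T h (T t f) - T t f) /\<^sub>R h" if "h > 0" for h
    proof -
      have "(T h f - f) /\<^sub>R h \<in> X" using X that by (intro X_intros T_X) auto
      then have "T t (P ((T h f - f) /\<^sub>R h)) = (T t (T h f) - T t f) /\<^sub>R h"
        using X t that by (simp add: P_id T_scale T_diff T_X X_intros)
      also have "T t (T h f) = T h (T t f)" using T_plus[of t h f] T_plus[of h t f] X t that by (simp add: add.commute)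
      finally show ?thesis .
    qed
    then show "\<forall>\<^sub>F h in at_right 0. T t (P ((T h f - f) /\<^sub>R h)) = (T h (T t f) - T t f) /\<^sub>R h"
      by (auto simp: eventually_at_right_field intro!: exI[of _ 1])
  qed
  finally show "T t f \<in> D" "A (T t f) = T t (A f)"
    using generator_iff[OF T_X[OF t X]] by auto
qed

text \<open>The generator only gives a right derivative at time 0. Contractivity makes the expansion
  uniform in the starting time \<open>r\<close>, so a point \<open>y\<close> to the left of
  \<open>t\<close> can serve as the start; the velocity at \<open>y\<close> is close to that at
  \<open>t\<close> by continuity of the orbit of \<open>A f\<close>.\<close>

lemma T_derivative:
  assumes f: "f \<in> D" and t: "0 \<le> t"
  shows "((\<lambda>t. T t f) has_vector_derivative T t (A f)) (at t within {0..})"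
  unfolding has_vector_derivative_def has_derivative_within_alt
proof (intro conjI allI impI)
  show "bounded_linear (\<lambda>x. x *\<^sub>R T t (A f))" by (rule bounded_linear_scaleR_left)
  fix e :: real assume e: "e > 0"
  have X: "f \<in> X" "A f \<in> X" using f DX A_X by auto
  have "((\<lambda>h. (T h f - f) /\<^sub>R h) \<longlongrightarrow> A f) (at_right 0)" using generator_iff[OF X(1)] f by simp
  then have "\<forall>\<^sub>F h in at_right 0. dist ((T h f - f) /\<^sub>R h) (A f) < e / 2"
    using e by (intro tendstoD) auto
  then obtain d1 where d1: "d1 > 0" "\<And>h. 0 < h \<Longrightarrow> h < d1 \<Longrightarrow> dist ((T h f - f) /\<^sub>R h) (A f) < e / 2"
    by (auto simp: eventually_at_right_field)
  have step: "norm (T (r + h) f - T r f - h *\<^sub>R T r (A f)) \<le> h * (e / 2)" if h: "0 < h" "h < d1" and r: "0 \<le> r" for r h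
  proof -
    have z: "T h f - f - h *\<^sub>R A f \<in> X" using X h by (intro X_intros T_X) auto
    have "T (r + h) f - T r f - h *\<^sub>R T r (A f) = T r (T h f - f - h *\<^sub>R A f)"
      using X h r by (simp add: T_plus T_diff T_scale T_X X_intros)
    then have "norm (T (r + h) f - T r f - h *\<^sub>R T r (A f)) \<le> norm (T h f - f - h *\<^sub>R A f)"
      using T_norm[OF r z] by simp
    also have "T h f - f - h *\<^sub>R A f = h *\<^sub>R ((T h f - f) /\<^sub>R h - A f)"
      using h by (simp add: scaleR_diff_right)
    also have "norm \<dots> \<le> h * (e / 2)"
      using d1(2)[OF h] h by (simp add: dist_norm)
    finally show ?thesis .
  qed
  obtain d2 where d2: "d2 > 0" "\<And>s. 0 \<le> s \<Longrightarrow> dist s t < d2 \<Longrightarrow> dist (T s (A f)) (T t (A f)) < e / 2"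
    using T_cont[OF X(2)] t e unfolding continuous_on_iff by (metis atLeast_iff half_gt_zero)
  have "norm (T y f - T t f - (y - t) *\<^sub>R T t (A f)) \<le> e * norm (y - t)"
    if y: "0 \<le> y" "norm (y - t) < min d1 d2" for y
  proof (cases y t rule: linorder_cases)
    case less
    have "T y f - T t f - (y - t) *\<^sub>R T t (A f) = - (T (y + (t - y)) f - T y f - (t - y) *\<^sub>R T y (A f))
       + (t - y) *\<^sub>R (T t (A f) - T y (A f))"
      by (simp add: algebra_simps)
    also have "norm \<dots> \<le> (t - y) * (e / 2) + (t - y) * (e / 2)"
    proof (rule norm_triangle_mono)
      show "norm (- (T (y + (t - y)) f - T y f - (t - y) *\<^sub>R T y (A f))) \<le> (t - y) * (e / 2)"
        unfolding norm_minus_cancel using less y by (intro step) auto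
      have "norm (T t (A f) - T y (A f)) \<le> e / 2"
        using d2(2)[of y] y by (simp add: dist_norm norm_minus_commute)
      then show "norm ((t - y) *\<^sub>R (T t (A f) - T y (A f))) \<le> (t - y) * (e / 2)"
        using less by (simp add: mult_left_mono)
    qed
    also have "\<dots> = e * norm (y - t)" using less by (simp add: field_simps)
    finally show ?thesis .
  next
    case greater
    then have "norm (T y f - T t f - (y - t) *\<^sub>R T t (A f)) \<le> (y - t) * (e / 2)"
      using step[of "y - t" t] y t by simp
    also have "\<dots> \<le> e * norm (y - t)" using greater e by simp
    finally show ?thesis .
  qed simp
  then show "\<exists>d>0. \<forall>y\<in>{0..}. norm (y - t) < d \<longrightarrow> norm (T y f - T t f - (y - t) *\<^sub>R T t (A f)) \<le> e * norm (y - t)"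
    using d1(1) d2(1) by (intro exI[of _ "min d1 d2"]) auto
qed

text \<open>Duhamel's integral after the substitution of \<open>t - s\<close> for \<open>s\<close>.
  As the forcing does not depend on time, \<open>t\<close> then occurs only as the upper limit, and
  differentiation is immediate.\<close>

definition Y :: "'a \<Rightarrow> real \<Rightarrow> 'a" where "Y F t = integral {0..t} (\<lambda>s. T s F)"

lemma T_integrable:
  assumes F: "F \<in> X" and a: "0 \<le> a"
  shows "(\<lambda>s. T s F) integrable_on {a..b}"
  by (intro integrable_continuous_real continuous_on_subset[OF T_cont[OF F]]) (use a in auto)

lemma Y_reflect:
  assumes F: "F \<in> X" and t: "0 \<le> t"
  shows "((\<lambda>s. T (t - s) F) has_integral Y F t) {0..t}"
proof -
  have "((\<lambda>s. T s F) has_integral Y F t) {0..t}"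
    unfolding Y_def by (rule integrable_integral[OF T_integrable[OF F]]) simp
  then have "((\<lambda>s. T (- s) F) has_integral Y F t) {-t..-0}"
    by (subst has_integral_reflect_real)
  then have "(((\<lambda>s. T (- s) F) \<circ> ((+) (-t))) has_integral Y F t) {0..t}"
    by (subst has_integral_shift_Icc_real) simp
  then show ?thesis by (simp add: o_def)
qed

lemma Y_derivative:
  assumes F: "F \<in> X" and t: "0 \<le> t"
  shows "((Y F) has_vector_derivative T t F) (at t within {0..})"
proof -
  have "((\<lambda>u. integral {0..u} (\<lambda>s. T s F)) has_vector_derivative T t F) (at t within {0..t + 1})"
    using t by (intro integral_has_vector_derivative continuous_on_subset[OF T_cont[OF F]]) auto
  moreover have "at t within {0..t + 1} = at t within {0..}"
    by (rule at_within_nhd[of t "{..<t + 1}"]) auto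
  ultimately show ?thesis by (simp add: Y_def[abs_def])
qed

text \<open>The projection \<open>P\<close> passes under the integral and fixes the
  integrand.\<close>

lemma Y_X:
  assumes F: "F \<in> X" and t: "0 \<le> t"
  shows "Y F t \<in> X"
proof -
  have "P (Y F t) = integral {0..t} (P \<circ> (\<lambda>s. T s F))"
    unfolding Y_def by (rule integral_linear[OF T_integrable[OF F] P_linear, symmetric]) simp
  also have "\<dots> = Y F t"
    unfolding Y_def using F by (intro integral_cong) (auto intro!: P_id T_X)
  finally show ?thesis using P_in by metis
qed

text \<open>\<open>T h (Y F t) - Y F t\<close> is the integral over \<open>{t..t + h}\<close> minus
  that over \<open>{0..h}\<close>, so its quotient by \<open>h\<close> tends to
  \<open>T t F - F\<close>. The integral thus lies in \<open>D\<close> although \<open>F\<close> is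
  only in \<open>X\<close>.\<close>

lemma
  assumes F: "F \<in> X" and t: "0 \<le> t"
  shows Y_D: "Y F t \<in> D" and A_Y: "A (Y F t) = T t F - F"
proof -
  have shift: "T h (Y F t) = Y F (t + h) - Y F h" if h: "0 < h" for h
  proof -
    have "T h (Y F t) = T h (P (Y F t))" by (simp add: P_id Y_X F t)
    also have "\<dots> = integral {0..t} ((\<lambda>x. T h (P x)) \<circ> (\<lambda>s. T s F))"
      unfolding Y_def using h
      by (intro integral_linear[OF T_integrable[OF F] T_P_linear, symmetric]) simp_all
    also have "\<dots> = integral {0..t} ((\<lambda>s. T s F) \<circ> ((+) h))"
      using F h by (intro integral_cong) (auto simp: P_id T_X T_plus)
    also have "\<dots> = integral {h..t + h} (\<lambda>s. T s F)"
      using integral_shift_Icc_real[of 0 t "\<lambda>s. T s F" h] by simp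
    also have "\<dots> = Y F (t + h) - Y F h"
      unfolding Y_def using h t Henstock_Kurzweil_Integration.integral_combine[OF _ _ T_integrable[OF F order_refl], of h "t + h"] by (simp add: algebra_simps)
    finally show ?thesis .
  qed
  have right: "((\<lambda>h. (Y F (r + h) - Y F r) /\<^sub>R h) \<longlongrightarrow> T r F) (at_right 0)" if r: "0 \<le> r" for r
  proof -
    have "(Y F has_vector_derivative T r F) (at r within {r<..})"
      using r by (intro has_vector_derivative_within_subset[OF Y_derivative[OF F r]]) auto
    then have "((\<lambda>y. ((Y F y - Y F r) - (y - r) *\<^sub>R T r F) /\<^sub>R norm (y - r)) \<longlongrightarrow> 0) (at_right r)"
      unfolding has_vector_derivative_def has_derivative_at_within by blast
    then have "((\<lambda>h. ((Y F (r + h) - Y F r) - h *\<^sub>R T r F) /\<^sub>R norm h) \<longlongrightarrow> 0) (at_right 0)"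
      unfolding at_right_to_0[of r] filterlim_filtermap by (simp add: add.commute)
    also have "?this \<longleftrightarrow> ((\<lambda>h. (Y F (r + h) - Y F r) /\<^sub>R h - T r F) \<longlongrightarrow> 0) (at_right 0)"
      by (rule filterlim_cong[OF refl refl])
        (auto simp: eventually_at_right_field scaleR_diff_right intro!: exI[of _ 1])
    finally show ?thesis by (rule LIM_zero_cancel)
  qed
  have "((\<lambda>h. (Y F (t + h) - Y F t) /\<^sub>R h - (Y F (0 + h) - Y F 0) /\<^sub>R h) \<longlongrightarrow> T t F - T 0 F) (at_right 0)"
    by (intro tendsto_diff right t order_refl)
  also have "?this \<longleftrightarrow> ((\<lambda>h. (T h (Y F t) - Y F t) /\<^sub>R h) \<longlongrightarrow> T t F - F) (at_right 0)"
  proof (rule filterlim_cong[OF _ refl])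
    show "nhds (T t F - T 0 F) = nhds (T t F - F)" by (simp add: T_0 F)
    show "\<forall>\<^sub>F h in at_right 0. (Y F (t + h) - Y F t) /\<^sub>R h - (Y F (0 + h) - Y F 0) /\<^sub>R h 
        = (T h (Y F t) - Y F t) /\<^sub>R h"
      by (auto simp: eventually_at_right_field shift Y_def[of F 0] simp flip: scaleR_diff_right intro!: exI[of _ 1])
  qed
  finally show "Y F t \<in> D" "A (Y F t) = T t F - F"
    using generator_iff[OF Y_X[OF F t]] by auto
qed

end

section \<open>Absolutely continuous functions on an interval\<close>

lemma set_integrable_Icc_iff_Ioo:
  fixes f :: "real \<Rightarrow> real"
  shows "set_integrable lborel {a..b} f \<longleftrightarrow> set_integrable lborel {a<..<b} f"
proof
  assume "set_integrable lborel {a<..<b} f"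
  \<comment> \<open>The set \<open>{b} - {a}\<close> keeps the end point from being counted twice
    when \<open>a = b\<close>.\<close>
  then have "integrable lborel (\<lambda>x. indicator {a<..<b} x * f x + indicator {a} x * f a
      + indicator ({b} - {a}) x * f b)"
    unfolding set_integrable_def
    by (intro Bochner_Integration.integrable_add integrable_mult_left integrable_real_indicator)
      (auto simp: emeasure_lborel_countable)
  also have "?this \<longleftrightarrow> integrable lborel (\<lambda>x. if a \<le> b then indicator {a..b} x * f x else indicator {a} x * f a
      + indicator ({b} - {a}) x * f b)"
    by (intro Bochner_Integration.integrable_cong) (auto simp: indicator_def)
  finally show "set_integrable lborel {a..b} f"
    by (cases "a \<le> b") (auto simp: set_integrable_def)
qed (auto intro: set_integrable_subset)

lemma set_integral_Icc_Ioo: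
  fixes f :: "real \<Rightarrow> real"
  shows "(LINT x:{a..b}|lborel. f x) = (LINT x:{a<..<b}|lborel. f x)"
proof (cases "set_integrable lborel {a..b} f")
  case True
  then show ?thesis
    by (metis integral_open_interval_real set_borel_integral_eq_integral(2) set_integrable_Icc_iff_Ioo)
next
  \<comment> \<open>Both integrals then have the default value 0.\<close>
  case False
  then show ?thesis
    using set_integrable_Icc_iff_Ioo[of a b f]
    unfolding set_integrable_def set_lebesgue_integral_def by (simp add: not_integrable_integral_eq)
qed

text \<open>Membership of W^{1,1} in terms of a chosen representative: \<open>F\<close> is the
  continuous one, meaningful at every point of \<open>{0..l}\<close> including the ends, while the
  density \<open>g\<close> matters only up to null sets.\<close>

definition ac :: "real \<Rightarrow> (real \<Rightarrow> real) \<Rightarrow> (real \<Rightarrow> real) \<Rightarrow> bool" where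
  "ac l F g \<longleftrightarrow> set_integrable lborel {0..l} g \<and>
     (\<forall>x\<in>{0..l}. F x = F 0 + (LINT y:{0..x}|lborel. g y))"

lemma set_integral_upto_eq_integral:
  fixes g :: "real \<Rightarrow> real"
  assumes "set_integrable lborel {0..l} g" "x \<in> {0..l}"
  shows "(LINT y:{0..x}|lborel. g y) = integral {0..x} g" "g integrable_on {0..x}"
proof -
  have "set_integrable lborel {0..x} g" using assms by (auto intro: set_integrable_subset)
  then show "(LINT y:{0..x}|lborel. g y) = integral {0..x} g" "g integrable_on {0..x}"
    by (rule set_borel_integral_eq_integral)+
qed

lemma ac_integrable: "ac l F g \<Longrightarrow> set_integrable lborel {0..l} g"
  by (simp add: ac_def)

lemma ac_eq: "ac l F g \<Longrightarrow> x \<in> {0..l} \<Longrightarrow> F x = F 0 + integral {0..x} g"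
  using set_integral_upto_eq_integral unfolding ac_def by metis

lemma ac_integral: "ac l F g \<Longrightarrow> x \<in> {0..l} \<Longrightarrow> (LINT y:{0..x}|lborel. g y) = F x - F 0"
  unfolding ac_def by (metis add_diff_cancel_left')

lemma acI:
  "set_integrable lborel {0..l} g \<Longrightarrow> (\<And>x. x \<in> {0..l} \<Longrightarrow> F x = F 0 + integral {0..x} g) \<Longrightarrow> ac l F g"
  using set_integral_upto_eq_integral unfolding ac_def by metis

lemma ac_continuous:
  assumes "ac l F g"
  shows "continuous_on {0..l} F"
proof -
  have "g integrable_on {0..l}" using ac_integrable[OF assms] set_borel_integral_eq_integral by blast
  then have "continuous_on {0..l} (\<lambda>x. F 0 + integral {0..x} g)"
    by (intro continuous_intros indefinite_integral_continuous_1)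
  then show ?thesis by (rule continuous_on_eq) (rule ac_eq[OF assms, symmetric])
qed

lemma ac_set_integrable: "ac l F g \<Longrightarrow> set_integrable lborel {0..l} F"
  by (rule borel_integrable_atLeastAtMost'[OF ac_continuous])

lemma acI_derivative:
  assumes "\<And>x. x \<in> {0..l} \<Longrightarrow> (F has_real_derivative f x) (at x within {0..l})"
    and "continuous_on {0..l} f"
  shows "ac l F f"
proof (rule acI)
  fix x assume x: "x \<in> {0..l}"
  have "(f has_integral F x - F 0) {0..x}"
    using x by (intro fundamental_theorem_of_calculus has_vector_derivative_within_subset[OF
      assms(1)[unfolded has_real_derivative_iff_has_vector_derivative]]) auto
  then show "F x = F 0 + integral {0..x} f" by (simp add: integral_unique)
qed (rule borel_integrable_atLeastAtMost'[OF assms(2)])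

lemma ac_derivative:
  assumes "ac l F f" "continuous_on {0..l} f" "x \<in> {0..l}"
  shows "(F has_real_derivative f x) (at x within {0..l})"
proof -
  have "((\<lambda>x. F 0 + integral {0..x} f) has_real_derivative f x) (at x within {0..l})"
    using integral_has_real_derivative[OF assms(2,3)] by (auto intro!: derivative_eq_intros)
  then show ?thesis
    by (rule has_field_derivative_transform_within[of _ _ _ _ 1]) (use assms(3) ac_eq[OF assms(1), symmetric] in auto)
qed

lemma ac_lincomb:
  assumes "ac l F f" "ac l G g"
  shows "ac l (\<lambda>x. a * F x + b * G x) (\<lambda>x. a * f x + b * g x)"
proof -
  note [simp] = set_integrable_subset[OF ac_integrable[OF assms(1)]] set_integrable_subset[OF ac_integrable[OF assms(2)]]
  have "(LINT y:{0..x}|lborel. a * f y + b * g y) = a * (LINT y:{0..x}|lborel. f y) + b * (LINT y:{0..x}|lborel. g y)"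
    if "x \<in> {0..l}" for x
    using that by (subst set_integral_add) auto
  note int = this
  have eqs: "F x = F 0 + (LINT y:{0..x}|lborel. f y)" "G x = G 0 + (LINT y:{0..x}|lborel. g y)"
    if "x \<in> {0..l}" for x
    using assms that unfolding ac_def by blast+
  have "a * F x + b * G x = a * F 0 + b * G 0 + (LINT y:{0..x}|lborel. a * f y + b * g y)"
    if "x \<in> {0..l}" for x
    unfolding int[OF that] eqs[OF that] by (simp add: algebra_simps)
  moreover have "set_integrable lborel {0..l} (\<lambda>x. a * f x + b * g x)"
    using ac_integrable assms by (intro set_integral_add) auto
  ultimately show ?thesis unfolding ac_def by blast
qed

lemma ac_cong:
  assumes "ac l F g" "\<And>x. x \<in> {0..l} \<Longrightarrow> F x = F' x" 
  shows "ac l F' g"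
proof (rule acI)
  fix x assume x: "x \<in> {0..l}"
  then have "F 0 = F' 0" by (intro assms) auto
  then show "F' x = F' 0 + integral {0..x} g"
    using ac_eq[OF assms(1) x] assms(2)[OF x] by simp
qed (rule ac_integrable[OF assms(1)])

lemma set_integral_singleton [simp]:
  fixes f :: "real \<Rightarrow> real"
  shows "(LINT x:{a}|lborel. f x) = 0"
  using set_integral_Icc_Ioo[of a a f] by (simp add: set_lebesgue_integral_def)

lemma set_integrable_mult_continuous:
  fixes f k :: "real \<Rightarrow> real"
  assumes f: "set_integrable lborel {a..b} f" and k: "continuous_on {a..b} k"
  shows "set_integrable lborel {a..b} (\<lambda>x. f x * k x)"
proof -
  obtain M where M: "\<And>x. x \<in> {a..b} \<Longrightarrow> \<bar>k x\<bar> \<le> M"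
    using compact_imp_bounded[OF compact_continuous_image[OF k compact_Icc]]
    unfolding bounded_iff by (metis image_eqI real_norm_def)
  \<comment> \<open>The absolute value of \<open>M\<close> covers the empty interval, where nothing
    makes \<open>M\<close> nonnegative.\<close>
  have M': "\<bar>indicator {a..b} x * k x\<bar> \<le> \<bar>M\<bar>" for x
    using M[of x] by (cases "x \<in> {a..b}") auto
  define f0 k0 where "f0 x = indicator {a..b} x * f x" and "k0 x = indicator {a..b} x * k x" for x
  have f0: "integrable lborel f0" using f by (simp add: f0_def[abs_def] set_integrable_def)
  have k0: "integrable lborel k0"
    using borel_integrable_atLeastAtMost'[OF k] by (simp add: k0_def[abs_def] set_integrable_def)
  have [measurable]: "f0 \<in> borel_measurable borel" "k0 \<in> borel_measurable borel"
    using borel_measurable_integrable[OF f0] borel_measurable_integrable[OF k0] by auto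
  have "integrable lborel (\<lambda>x. f0 x * k0 x)"
  proof (rule Bochner_Integration.integrable_bound)
    show "integrable lborel (\<lambda>x. \<bar>M\<bar> * f0 x)" using f0 by simp
    show "AE x in lborel. norm (f0 x * k0 x) \<le> norm (\<bar>M\<bar> * f0 x)"
    proof (rule AE_I2)
      fix x
      have "\<bar>k0 x\<bar> \<le> \<bar>M\<bar>" using M'[of x] by (simp only: k0_def)
      then have "\<bar>f0 x\<bar> * \<bar>k0 x\<bar> \<le> \<bar>f0 x\<bar> * \<bar>M\<bar>" by (rule mult_left_mono) simp
      then show "norm (f0 x * k0 x) \<le> norm (\<bar>M\<bar> * f0 x)" by (simp add: abs_mult mult.commute)
    qed
  qed measurable
  moreover have "f0 x * k0 x = indicator {a..b} x *\<^sub>R (f x * k x)" for x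
    by (auto simp: f0_def k0_def indicator_def)
  ultimately show ?thesis by (simp add: set_integrable_def)
qed

lemma integrable_lborel_pair_mult:
  fixes f g :: "real \<Rightarrow> real"
  assumes f[measurable]: "integrable lborel f" and g[measurable]: "integrable lborel g"
  shows "integrable (lborel \<Otimes>\<^sub>M lborel) (\<lambda>(x, y). f x * g y)"
proof (rule lborel_pair.Fubini_integrable)
  show "integrable lborel (\<lambda>x. LINT y|lborel. norm (case (x, y) of (x, y) \<Rightarrow> f x * g y))"
    using f g by (simp add: abs_mult)
qed (use assms in auto)

text \<open>Fubini's theorem for \<open>\<phi>' x * g y\<close> on the triangle
  \<open>0 \<le> y \<le> x \<le> l\<close>: integrating over \<open>y\<close> first produces
  \<open>F x - F 0\<close>, over \<open>x\<close> first \<open>\<phi> l - \<phi> y\<close>. No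
  pointwise derivative of \<open>F\<close> is involved.\<close>

lemma ac_by_parts:
  assumes F: "ac l F g" and l: "0 \<le> l"
    and \<phi>: "\<And>x. x \<in> {0..l} \<Longrightarrow> (\<phi> has_real_derivative \<phi>' x) (at x within {0..l})"
    and \<phi>': "continuous_on {0..l} \<phi>'"
  shows "(LINT x:{0..l}|lborel. g x * \<phi> x)
     = F l * \<phi> l - F 0 * \<phi> 0 - (LINT x:{0..l}|lborel. F x * \<phi>' x)"
proof -
  define g0 where "g0 x = indicator {0..l} x * g x" for x
  define p where "p x = indicator {0..l} x * \<phi>' x" for x
  have g0: "integrable lborel g0" using ac_integrable[OF F] by (simp add: g0_def[abs_def] set_integrable_def)
  have p: "integrable lborel p"
    using borel_integrable_atLeastAtMost'[OF \<phi>'] by (simp add: p_def[abs_def] set_integrable_def)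
  have [measurable]: "g0 \<in> borel_measurable borel" "p \<in> borel_measurable borel"
    using borel_measurable_integrable[OF g0] borel_measurable_integrable[OF p] by auto
  define k where "k x y = (if y \<le> x then p x * g0 y else 0)" for x y
  have "integrable (lborel \<Otimes>\<^sub>M lborel) (\<lambda>(x, y). k x y)"
  proof (rule Bochner_Integration.integrable_bound[OF integrable_lborel_pair_mult[OF p g0]])
    show "(\<lambda>(x, y). k x y) \<in> borel_measurable (lborel \<Otimes>\<^sub>M lborel)"
      unfolding k_def by measurable
  qed (auto simp: k_def)
  then have fub: "(LINT y|lborel. LINT x|lborel. k x y) = (LINT x|lborel. LINT y|lborel. k x y)"
    by (rule lborel_pair.Fubini_integral)
  have "ac l \<phi> \<phi>'" by (rule acI_derivative[OF \<phi> \<phi>'])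
  note phi_cont = ac_continuous[OF this]
  have inner1: "(LINT y|lborel. k x y) = indicator {0..l} x *\<^sub>R (\<phi>' x * (F x - F 0))" for x
  proof (cases "x \<in> {0..l}")
    case True
    have "(LINT y|lborel. k x y) = (LINT y|lborel. p x * (indicator {0..x} y * g y))"
      using True by (intro Bochner_Integration.integral_cong) (auto simp: k_def g0_def indicator_def)
    also have "\<dots> = p x * (LINT y:{0..x}|lborel. g y)"
      by (simp add: set_lebesgue_integral_def)
    also have "(LINT y:{0..x}|lborel. g y) = F x - F 0" by (rule ac_integral[OF F True])
    finally show ?thesis using True by (simp add: p_def)
  next
    case False
    then have "k x y = 0" for y by (auto simp: k_def p_def)
    then show ?thesis using False by simp
  qed
  have inner2: "(LINT x|lborel. k x y) = indicator {0..l} y *\<^sub>R (g y * (\<phi> l - \<phi> y))" for y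
  proof (cases "y \<in> {0..l}")
    case True
    have "(LINT x|lborel. k x y) = (LINT x|lborel. g0 y * (indicator {y..l} x * \<phi>' x))"
      using True by (intro Bochner_Integration.integral_cong) (auto simp: k_def p_def indicator_def)
    also have "\<dots> = g0 y * (LINT x:{y..l}|lborel. \<phi>' x)"
      by (simp add: set_lebesgue_integral_def)
    also have "(LINT x:{y..l}|lborel. \<phi>' x) = integral {y..l} \<phi>'"
      using True by (intro set_borel_integral_eq_integral borel_integrable_atLeastAtMost' continuous_on_subset[OF \<phi>']) auto
    also have "\<dots> = \<phi> l - \<phi> y"
      using True by (intro integral_unique fundamental_theorem_of_calculus has_vector_derivative_within_subset[OF
        \<phi>[unfolded has_real_derivative_iff_has_vector_derivative]]) auto
    finally show ?thesis using True by (simp add: g0_def)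
  next
    case False
    then have "k x y = 0" for x by (auto simp: k_def g0_def)
    then show ?thesis using False by simp
  qed
  have i1: "set_integrable lborel {0..l} \<phi>'" by (rule borel_integrable_atLeastAtMost'[OF \<phi>'])
  have i2: "set_integrable lborel {0..l} (\<lambda>x. F x * \<phi>' x)"
    by (intro borel_integrable_atLeastAtMost' continuous_intros \<phi>' ac_continuous[OF F])
  have i3: "set_integrable lborel {0..l} (\<lambda>x. g x * \<phi> x)"
    by (intro set_integrable_mult_continuous ac_integrable[OF F] phi_cont)
  have "(LINT x:{0..l}|lborel. F x * \<phi>' x - F 0 * \<phi>' x) = (LINT x:{0..l}|lborel. \<phi> l * g x - g x * \<phi> x)"
    using fub unfolding inner1 inner2 set_lebesgue_integral_def by (simp add: algebra_simps)
  moreover have "(LINT x:{0..l}|lborel. F x * \<phi>' x - F 0 * \<phi>' x)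
      = (LINT x:{0..l}|lborel. F x * \<phi>' x) - F 0 * (LINT x:{0..l}|lborel. \<phi>' x)"
    using i1 i2 by (subst set_integral_diff) auto
  moreover have "(LINT x:{0..l}|lborel. \<phi> l * g x - g x * \<phi> x)
      = \<phi> l * (LINT x:{0..l}|lborel. g x) - (LINT x:{0..l}|lborel. g x * \<phi> x)"
    using ac_integrable[OF F] i3 by (subst set_integral_diff) auto
  moreover have "(LINT x:{0..l}|lborel. g x) = F l - F 0" using ac_integral[OF F, of l] l by simp
  moreover have "(LINT x:{0..l}|lborel. \<phi>' x) = \<phi> l - \<phi> 0"
    using ac_integral[OF \<open>ac l \<phi> \<phi>'\<close>, of l] l by simp
  ultimately show ?thesis by (simp add: algebra_simps)
qed

section \<open>Uniqueness of densities, and weak derivatives in dimension one\<close>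

lemma AE_zero_of_primitive_zero:
  fixes h :: "real \<Rightarrow> real"
  assumes h: "set_integrable lborel {0..l} h"
    and zero: "\<And>x. x \<in> {0..l} \<Longrightarrow> (LINT y:{0..x}|lborel. h y) = 0"
  shows "AE x in lborel. x \<in> {0..l} \<longrightarrow> h x = 0"
proof (cases "0 \<le> l")
  case True
  define h0 where "h0 x = indicator {0..l} x * h x" for x
  have h0: "integrable lborel h0" using h by (simp add: h0_def[abs_def] set_integrable_def)
  have h0A: "set_integrable lborel A h0" if "A \<in> sets borel" for A
    unfolding set_integrable_def using h0 that by (intro integrable_mult_indicator) auto
  \<comment> \<open>The sets over which \<open>h0\<close> integrates to zero contain the half-lines
    \<open>{..a}\<close>, an intersection-stable generator, and are closed under complements and
    countable disjoint unions; so every Borel set is among them.\<close>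
  have "(LINT x:A|lborel. h0 x) = 0" if A: "A \<in> sigma_sets UNIV (range (\<lambda>a. {..a::real}))" for A
  proof -
    have "Int_stable (range (\<lambda>a. {..a::real}))"
      by (rule Int_stableI_image, rule_tac x = "min i j" in bexI) auto
    moreover have "range (\<lambda>a. {..a::real}) \<subseteq> Pow UNIV" by simp
    ultimately show ?thesis using A
    proof (induction rule: sigma_sets_induct_disjoint)
      case (basic A)
      then obtain a where a: "A = {..a}" by auto
      show ?case
      proof (cases "0 \<le> a")
        case True
        have "(LINT x:A|lborel. h0 x) = (LINT x:{0..min a l}|lborel. h x)"
          unfolding set_lebesgue_integral_def a
          by (intro Bochner_Integration.integral_cong) (auto simp: h0_def indicator_def)
        also have "\<dots> = 0" using True \<open>0 \<le> l\<close> by (intro zero) auto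
        finally show ?thesis .
      next
        case False
        then have "(\<lambda>x. indicator A x *\<^sub>R h0 x) = (\<lambda>x. 0)" by (auto simp: a h0_def indicator_def)
        then show ?thesis by (simp add: set_lebesgue_integral_def)
      qed
    next
      case (compl A)
      have "(LINT x:UNIV|lborel. h0 x) = (LINT x:{0..l}|lborel. h x)"
        by (simp add: set_lebesgue_integral_def h0_def)
      also have "\<dots> = 0" using True by (intro zero) auto
      finally have "(LINT x:UNIV|lborel. h0 x) = 0" .
      moreover have [measurable]: "A \<in> sets borel" using compl(1) by (simp add: borel_eq_atMost)
      have "(LINT x:UNIV - A \<union> A|lborel. h0 x) = (LINT x:UNIV - A|lborel. h0 x) + (LINT x:A|lborel. h0 x)"
        by (intro set_integral_Un h0A) auto
      ultimately show ?case using compl(2) by simp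
    next
      case (union A)
      have A: "A i \<in> sets borel" for i using union(2) by (auto simp: borel_eq_atMost)
      have "(LINT x:(\<Union>i. A i)|lborel. h0 x) = (\<Sum>i. (LINT x:(A i)|lborel. h0 x))"
        using A union(1)
        by (intro lebesgue_integral_countable_add h0A) (auto simp: disjoint_family_on_def)
      then show ?case using union(3) by simp
    qed (auto simp: set_lebesgue_integral_def)
  qed
  then have "(LINT x:A|lborel. h0 x) = (LINT x:A|lborel. (0::real))" if "A \<in> sets lborel" for A
    using that by (simp add: borel_eq_atMost)
  then have "AE x in lborel. h0 x = 0" by (intro density_unique_real h0) auto
  then show ?thesis by eventually_elim (auto simp: h0_def)
qed auto

lemma ac_density_unique:
  assumes "ac l F g" "ac l F g'"
  shows "AE x in lborel. x \<in> {0..l} \<longrightarrow> g x = g' x"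
proof -
  have "ac l (\<lambda>x. 1 * F x + (-1) * F x) (\<lambda>x. 1 * g x + (-1) * g' x)" by (rule ac_lincomb[OF assms])
  from AE_zero_of_primitive_zero[OF ac_integrable[OF this]] ac_integral[OF this]
  have "AE x in lborel. x \<in> {0..l} \<longrightarrow> 1 * g x + (-1) * g' x = 0"
    by simp
  then show ?thesis by eventually_elim auto
qed

text \<open>A continuous function with compact support is the derivative of a test function as soon
  as its integral is zero: this makes its primitive vanish again to the right of the
  support.\<close>

lemma test_functionI_primitive:
  assumes \<psi>: "continuous_on UNIV \<psi>" and supp: "\<And>x. x \<notin> {p..q} \<Longrightarrow> \<psi> x = 0"
    and pq: "a < p" "p \<le> q" "q < b" and zero: "integral {p..q} \<psi> = 0"
  obtains \<phi> where "test_function a b \<phi>" "deriv \<phi> = \<psi>"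
proof -
  have "\<exists>F. \<forall>x. -\<infinity> < ereal x \<longrightarrow> ereal x < \<infinity> \<longrightarrow> (F has_vector_derivative \<psi> x) (at x)"
    by (rule einterval_antiderivative) (use \<psi> in \<open>auto simp: continuous_on_eq_continuous_at\<close>)
  then obtain F where F: "\<And>x. (F has_real_derivative \<psi> x) (at x)"
    by (auto simp: has_real_derivative_iff_has_vector_derivative)
  define \<phi> where "\<phi> x = F x - F p" for x
  have d: "(\<phi> has_real_derivative \<psi> x) (at x)" for x
    unfolding \<phi>_def by (auto intro!: derivative_eq_intros F)
  have int: "integral {u..v} \<psi> = \<phi> v - \<phi> u" if "u \<le> v" for u v
    using that by (intro integral_unique fundamental_theorem_of_calculus)
      (auto intro!: has_vector_derivative_at_within d[unfolded has_real_derivative_iff_has_vector_derivative])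
  have \<phi>p: "\<phi> p = 0" by (simp add: \<phi>_def)
  have \<phi>q: "\<phi> q = 0" using int[OF pq(2)] \<phi>p zero by simp
  have z: "\<phi> x = 0" if "x \<notin> {p..q}" for x
  proof (cases "x < p")
    case True
    have "integral {x..p} \<psi> = integral {x..p} (\<lambda>x. 0)"
      by (rule integral_spike[of "{p}"]) (use supp in auto)
    then show ?thesis using int[of x p] True \<phi>p by simp
  next
    case False
    then have x: "q < x" using that by auto
    have "integral {q..x} \<psi> = integral {q..x} (\<lambda>x. 0)"
      by (rule integral_spike[of "{q}"]) (use supp in auto)
    then show ?thesis using int[of q x] x \<phi>q by simp
  qed
  have deriv: "deriv \<phi> = \<psi>" using d by (auto intro: DERIV_imp_deriv)
  moreover have "test_function a b \<phi>"
    unfolding test_function_def deriv using \<psi> z pq d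
    by (intro conjI allI exI[of _ p] exI[of _ q]) (auto intro: real_differentiable_def[THEN iffD2])
  ultimately show ?thesis using that by blast
qed

text \<open>The lemma of du Bois-Reymond. A continuous function with compact support becomes the
  derivative of a test function after subtraction of a multiple of one fixed bump, so
  \<open>f\<close> acts on it like a constant \<open>c\<close>. Approximating indicators of
  intervals then shows that the primitive of \<open>f - c\<close> is constant.\<close>

lemma weak_deriv_zero_const:
  assumes l: "0 < l" and f: "set_integrable lborel {0<..<l} f"
    and weak: "\<And>\<phi>. test_function 0 l \<phi> \<Longrightarrow> (LINT x:{0<..<l}|lborel. f x * deriv \<phi> x) = 0"
  shows "\<exists>c. AE x in lborel. x \<in> {0..l} \<longrightarrow> f x = c"
proof -
  define f0 where "f0 x = indicator {0<..<l} x * f x" for x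
  have f0: "integrable lborel f0" using f by (simp add: f0_def[abs_def] set_integrable_def)
  have [measurable]: "f0 \<in> borel_measurable borel" using borel_measurable_integrable[OF f0] by auto
  define W where "W \<psi> \<longleftrightarrow> continuous_on UNIV \<psi> \<and> (\<exists>p q. 0 < p \<and> p \<le> q \<and> q < l \<and> (\<forall>x. x \<notin> {p..q} \<longrightarrow> \<psi> x = 0))" for \<psi> :: "real \<Rightarrow> real"
  have Wint: "integrable lborel \<psi> \<and> integrable lborel (\<lambda>x. f0 x * \<psi> x)" if W: "W \<psi>" for \<psi>
  proof -
    obtain p q where pq: "0 < p" "p \<le> q" "q < l" "\<And>x. x \<notin> {p..q} \<Longrightarrow> \<psi> x = 0" and c: "continuous_on UNIV \<psi>"
      using W by (auto simp: W_def)
    have "set_integrable lborel {p..q} \<psi>" by (intro borel_integrable_atLeastAtMost' continuous_on_subset[OF c]) auto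
    moreover have "(\<lambda>x. indicator {p..q} x *\<^sub>R \<psi> x) = \<psi>"
      using pq(4) by (auto simp: indicator_def fun_eq_iff)
    ultimately have 1: "integrable lborel \<psi>" by (simp add: set_integrable_def)
    have "set_integrable lborel {p..q} (\<lambda>x. f0 x * \<psi> x)"
      using f0 by (intro set_integrable_mult_continuous continuous_on_subset[OF c])
        (auto simp: set_integrable_def intro!: integrable_mult_indicator[of _ _ f0, simplified])
    moreover have "(\<lambda>x. indicator {p..q} x *\<^sub>R (f0 x * \<psi> x)) = (\<lambda>x. f0 x * \<psi> x)"
      using pq(4) by (auto simp: indicator_def fun_eq_iff)
    ultimately have "integrable lborel (\<lambda>x. f0 x * \<psi> x)" by (simp add: set_integrable_def)
    with 1 show ?thesis by simp
  qed
  have W0: "(LINT x|lborel. f0 x * \<psi> x) = 0" if W: "W \<psi>" and z: "(LINT x|lborel. \<psi> x) = 0" for \<psi>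
  proof -
    obtain p q where pq: "0 < p" "p \<le> q" "q < l" "\<And>x. x \<notin> {p..q} \<Longrightarrow> \<psi> x = 0" and c: "continuous_on UNIV \<psi>"
      using W by (auto simp: W_def)
    have "set_integrable lborel {p..q} \<psi>" by (intro borel_integrable_atLeastAtMost' continuous_on_subset[OF c]) auto
    then have "integral {p..q} \<psi> = (LINT x:{p..q}|lborel. \<psi> x)"
      by (rule set_borel_integral_eq_integral(2)[symmetric])
    also have "\<dots> = (LINT x|lborel. \<psi> x)"
      unfolding set_lebesgue_integral_def using pq(4)
      by (intro Bochner_Integration.integral_cong) (auto simp: indicator_def)
    finally have "integral {p..q} \<psi> = 0" using z by simp
    then obtain \<phi> where \<phi>: "test_function 0 l \<phi>" "deriv \<phi> = \<psi>"
      using test_functionI_primitive[OF c pq(4,1,2,3)] by blast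
    show ?thesis using weak[OF \<phi>(1)] unfolding \<phi>(2) set_lebesgue_integral_def
      by (simp add: f0_def mult.assoc)
  qed
  \<comment> \<open>A tent supported in the middle half of the interval. Any such function with
    nonzero integral would do, since it only serves to correct the integral of other
    functions.\<close>
  define \<theta> where "\<theta> x = max 0 (l/4 - \<bar>x - l/2\<bar>)" for x
  have W\<theta>: "W \<theta>"
    unfolding W_def \<theta>_def using l
    by (intro conjI continuous_intros exI[of _ "l/4"] exI[of _ "3*l/4"])
       (auto simp: max_def abs_if)
  have "(LINT x|lborel. \<theta> x) \<noteq> 0"
  proof
    assume "(LINT x|lborel. \<theta> x) = 0"
    then have "AE x in lborel. \<theta> x = 0"
      using Wint[OF W\<theta>] by (subst (asm) integral_nonneg_eq_0_iff_AE) (auto simp: \<theta>_def)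
    then have "AE x in lborel. x \<notin> {3*l/8<..<5*l/8}"
      by eventually_elim (auto simp: \<theta>_def max_def abs_if split: if_splits)
    then have "{3*l/8<..<5*l/8} \<in> null_sets lborel" by (subst (asm) AE_iff_null_sets[symmetric]) auto
    then show False using l by (auto simp: null_sets_def)
  qed
  define c where "c = (LINT x|lborel. f0 x * \<theta> x) / (LINT x|lborel. \<theta> x)"
  have Wc: "(LINT x|lborel. f0 x * \<psi> x) = c * (LINT x|lborel. \<psi> x)" if W: "W \<psi>" for \<psi>
  proof -
    define k where "k = (LINT x|lborel. \<psi> x) / (LINT x|lborel. \<theta> x)"
    have "W (\<lambda>x. \<psi> x - k * \<theta> x)"
    proof -
      obtain p q p' q' where *: "0 < p" "p \<le> q" "q < l" "\<And>x. x \<notin> {p..q} \<Longrightarrow> \<psi> x = 0" 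
       "0 < p'" "p' \<le> q'" "q' < l" "\<And>x. x \<notin> {p'..q'} \<Longrightarrow> \<theta> x = 0" 
       "continuous_on UNIV \<psi>" "continuous_on UNIV \<theta>"
        using W W\<theta> unfolding W_def by metis
      have "\<psi> x - k * \<theta> x = 0" if "x \<notin> {min p p'..max q q'}" for x
      proof -
        have "x \<notin> {p..q}" "x \<notin> {p'..q'}" using that by auto
        then have "\<psi> x = 0" "\<theta> x = 0" using *(4,8) by blast+
        then show ?thesis by simp
      qed
      then show ?thesis unfolding W_def using *
        by (intro conjI continuous_intros exI[of _ "min p p'"] exI[of _ "max q q'"]) auto
    qed
    moreover have "(LINT x|lborel. \<psi> x - k * \<theta> x) = 0"
      using Wint[OF W] Wint[OF W\<theta>] \<open>(LINT x|lborel. \<theta> x) \<noteq> 0\<close> by (simp add: k_def)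
    ultimately have "(LINT x|lborel. f0 x * (\<psi> x - k * \<theta> x)) = 0" by (rule W0)
    also have "(LINT x|lborel. f0 x * (\<psi> x - k * \<theta> x)) = (LINT x|lborel. f0 x * \<psi> x - k * (f0 x * \<theta> x))"
      by (simp add: algebra_simps)
    also have "\<dots> = (LINT x|lborel. f0 x * \<psi> x) - k * (LINT x|lborel. f0 x * \<theta> x)"
      using Wint[OF W] Wint[OF W\<theta>] by simp
    finally show ?thesis by (simp add: c_def k_def)
  qed
  have Iab: "(LINT x:{a..b}|lborel. f0 x) = c * (b - a)" if ab: "0 < a" "a \<le> b" "b < l" for a b
  proof -
    \<comment> \<open>Trapezoids that equal 1 on \<open>{a..b}\<close> and fall off with slope
      \<open>Suc n\<close>; from \<open>n0\<close> on their supports stay inside the open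
      interval.\<close>
    define \<eta> where "\<eta> n x = max 0 (1 - real (Suc n) * max 0 (max (a - x) (x - b)))" for n x
    obtain n0 where n0: "n0 > 0" "1 / real n0 < min a (l - b)"
      using ab by (metis diff_gt_0_iff_gt min_less_iff_conj nat_approx_posE zero_less_Suc)
    have W\<eta>: "W (\<eta> n)" if n: "n \<ge> n0" for n
    proof -
      define r where "r = 1 / real (Suc n)"
      have "r \<le> 1 / real n0" unfolding r_def using n n0(1) by (intro divide_left_mono) auto
      then have r: "r < min a (l - b)" "0 < r" "real (Suc n) * r = 1"
        using n0(2) by (auto simp: r_def)
      have "\<eta> n x = 0" if x: "x \<notin> {a - r..b + r}" for x
      proof -
        have "r \<le> max 0 (max (a - x) (x - b))" using x by auto
        then have "real (Suc n) * r \<le> real (Suc n) * max 0 (max (a - x) (x - b))"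
          by (rule mult_left_mono) simp
        then show ?thesis unfolding r by (simp add: \<eta>_def)
      qed
      moreover have "continuous_on UNIV (\<eta> n)" unfolding \<eta>_def by (intro continuous_intros)
      ultimately show ?thesis unfolding W_def using ab r
        by (intro conjI exI[of _ "a - r"] exI[of _ "b + r"]) auto
    qed
    have lim: "(\<lambda>n. \<eta> n x) \<longlonglongrightarrow> indicator {a..b} x" for x
    proof (cases "x \<in> {a..b}")
      case False
      define d where "d = max 0 (max (a - x) (x - b))"
      have d: "d > 0" using False by (auto simp: d_def)
      obtain m where m: "1 / d < real m" using reals_Archimedean2 by blast
      have "\<eta> n x = 0" if "n \<ge> m" for n
      proof -
        have "1 / d < real (Suc n)" using m that by linarith
        then have "1 < real (Suc n) * d" using d by (simp add: pos_divide_less_eq)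
        then show ?thesis by (simp add: \<eta>_def d_def)
      qed
      then have "\<forall>\<^sub>F n in sequentially. \<eta> n x = indicator {a..b} x"
        using False by (auto simp: eventually_sequentially)
      then show ?thesis by (rule tendsto_eventually)
    qed (auto simp: \<eta>_def max_def)
    have \<eta>m[measurable]: "\<eta> n \<in> borel_measurable borel" for n
      unfolding \<eta>_def by measurable
    have \<eta>01: "\<bar>\<eta> n x\<bar> \<le> 1" for n x by (auto simp: \<eta>_def max_def)
    have L1: "(\<lambda>n. LINT x|lborel. f0 x * \<eta> n x) \<longlonglongrightarrow> (LINT x|lborel. f0 x * indicator {a..b} x)"
    proof (rule integral_dominated_convergence)
      show "integrable lborel (\<lambda>x. \<bar>f0 x\<bar>)" using f0 by simp
      show "AE x in lborel. (\<lambda>n. f0 x * \<eta> n x) \<longlonglongrightarrow> f0 x * indicator {a..b} x"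
        using lim by (intro AE_I2 tendsto_mult tendsto_const)
      show "AE x in lborel. norm (f0 x * \<eta> n x) \<le> \<bar>f0 x\<bar>" for n
        using \<eta>01 by (auto simp: abs_mult mult_left_le)
    qed measurable
    have L2: "(\<lambda>n. LINT x|lborel. \<eta> n x) \<longlonglongrightarrow> (LINT x|lborel. indicator {a..b} x)"
    proof (rule integral_dominated_convergence)
      show "integrable lborel (indicator {a - 1..b + 1} :: real \<Rightarrow> real)" by (intro integrable_real_indicator) (auto simp: emeasure_lborel_Icc_eq)
      show "AE x in lborel. (\<lambda>n. \<eta> n x) \<longlonglongrightarrow> indicator {a..b} x" using lim by auto
      show "AE x in lborel. norm (\<eta> n x) \<le> indicator {a - 1..b + 1} x" for n
      proof (intro AE_I2)
        fix x
        show "norm (\<eta> n x) \<le> indicator {a - 1..b + 1} x"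
        proof (cases "x \<in> {a - 1..b + 1}")
          case False
          then have "1 \<le> max 0 (max (a - x) (x - b))" by auto
          then have "1 * 1 \<le> real (Suc n) * max 0 (max (a - x) (x - b))" by (intro mult_mono) auto
          then show ?thesis by (simp add: \<eta>_def)
        qed (use \<eta>01 in auto)
      qed
    qed measurable
    have "(\<lambda>n. LINT x|lborel. f0 x * \<eta> n x) \<longlonglongrightarrow> c * (LINT x|lborel. indicator {a..b} x)"
    proof (rule Lim_transform_eventually[OF tendsto_mult_left[OF L2]])
      show "\<forall>\<^sub>F n in sequentially. c * (LINT x|lborel. \<eta> n x) = (LINT x|lborel. f0 x * \<eta> n x)"
        using Wc[OF W\<eta>] unfolding eventually_sequentially by metis
    qed
    from LIMSEQ_unique[OF L1 this] show ?thesis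
      using ab by (simp add: set_lebesgue_integral_def mult.commute)
  qed
  define h where "h x = f x - c" for x
  have h: "set_integrable lborel {0..l} h"
    unfolding h_def[abs_def]
  proof (rule set_integral_diff(1))
    show "set_integrable lborel {0..l} f" using f by (simp add: set_integrable_Icc_iff_Ioo)
  qed (intro borel_integrable_atLeastAtMost' continuous_intros)
  have ac: "ac l (\<lambda>x. LINT y:{0..x}|lborel. h y) h" (is "ac l ?H h")
    using h by (simp add: ac_def)
  have sub: "set_integrable lborel {a..b} h" if "0 \<le> a" "b \<le> l" for a b
    using that by (intro set_integrable_subset[OF h]) auto
  have inc: "?H b = ?H a" if ab: "0 < a" "a \<le> b" "b < l" for a b
  proof -
    have "(LINT x:{a..b}|lborel. h x) = (LINT x:{a..b}|lborel. f0 x - c)"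
      unfolding set_lebesgue_integral_def using ab
      by (intro Bochner_Integration.integral_cong) (auto simp: h_def f0_def indicator_def)
    also have "\<dots> = (LINT x:{a..b}|lborel. f0 x) - (LINT x:{a..b}|lborel. c)"
    proof (rule set_integral_diff(2))
      show "set_integrable lborel {a..b} f0"
        unfolding set_integrable_def using f0 by (intro integrable_mult_indicator) auto
    qed (intro borel_integrable_atLeastAtMost' continuous_intros)
    also have "\<dots> = 0" using Iab[OF ab] ab by (simp add: set_lebesgue_integral_def)
    finally have "integral {a..b} h = 0"
      using ab by (subst set_borel_integral_eq_integral(2)[OF sub, symmetric]) auto
    moreover have "integral {0..a} h + integral {a..b} h = integral {0..b} h"
      using ab by (intro Henstock_Kurzweil_Integration.integral_combine set_borel_integral_eq_integral(1) sub) auto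
    ultimately show ?thesis
      using ab by (simp add: set_integral_upto_eq_integral[OF h])
  qed
  have eq: "?H x = ?H (l/2)" if "x \<in> {0<..<l}" for x
    using inc[of x "l/2"] inc[of "l/2" x] l that by (cases "x \<le> l/2") auto
  \<comment> \<open>By continuity the constant value is also taken at 0, where the primitive
    vanishes.\<close>
  have const: "?H x = ?H (l/2)" if "x \<in> {0..l}" for x
  proof (rule continuous_constant_on_closure[of "{0<..<l}" ?H "?H (l/2)"])
    show "continuous_on (closure {0<..<l}) ?H" using l ac_continuous[OF ac] by simp
    show "x \<in> closure {0<..<l}" using that l by simp
  qed (rule eq)
  have "?H x = 0" if "x \<in> {0..l}" for x
  proof -
    have "?H x = ?H (l/2)" by (rule const[OF that])
    also have "\<dots> = ?H 0" by (rule const[symmetric]) (use l in simp)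
    finally show ?thesis by simp
  qed
  then have "AE x in lborel. x \<in> {0..l} \<longrightarrow> h x = 0" by (rule AE_zero_of_primitive_zero[OF h])
  then have "AE x in lborel. x \<in> {0..l} \<longrightarrow> f x = c" by eventually_elim (auto simp: h_def)
  then show ?thesis by blast
qed

text \<open>From left to right, \<open>f\<close> minus the primitive of \<open>g\<close> has weak
  derivative zero, hence is constant. From right to left, integration by parts leaves no boundary
  terms because test functions vanish at both ends.\<close>

lemma weak_deriv_iff_ac:
  assumes l: "0 < l" and f: "set_integrable lborel {0<..<l} f" and g: "set_integrable lborel {0<..<l} g"
  shows "weak_deriv 0 l f g \<longleftrightarrow> (\<exists>F. ac l F g \<and> (AE x in lborel. x \<in> {0<..<l} \<longrightarrow> f x = F x))"
proof -
  have parts: "(LINT x:{0<..<l}|lborel. F x * deriv \<phi> x) = - (LINT x:{0<..<l}|lborel. g x * \<phi> x)"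
    if F: "ac l F g" and \<phi>: "test_function 0 l \<phi>" for F \<phi>
  proof -
    have "(LINT x:{0..l}|lborel. g x * \<phi> x) = F l * \<phi> l - F 0 * \<phi> 0 - (LINT x:{0..l}|lborel. F x * deriv \<phi> x)"
      using \<phi> l by (intro ac_by_parts F)
        (auto simp: test_function_def DERIV_deriv_iff_real_differentiable
          intro: continuous_on_subset has_field_derivative_at_within)
    moreover have "\<phi> 0 = 0" "\<phi> l = 0" using \<phi> by (auto simp: test_function_def)
    ultimately show ?thesis by (simp add: set_integral_Icc_Ioo)
  qed
  have cong: "(LINT x:{0<..<l}|lborel. f x * k x) = (LINT x:{0<..<l}|lborel. F x * k x)"
    if "ac l F g" "AE x in lborel. x \<in> {0<..<l} \<longrightarrow> f x = F x" "continuous_on UNIV k" for F k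
  proof -
    have [measurable]: "k \<in> borel_measurable borel" using that(3) by (rule borel_measurable_continuous_onI)
    have [measurable]: "(\<lambda>x. indicator {0<..<l} x * f x) \<in> borel_measurable borel"
      using f unfolding set_integrable_def by (auto dest: borel_measurable_integrable)
    have "set_integrable lborel {0<..<l} F"
      using ac_set_integrable[OF that(1)] by (simp add: set_integrable_Icc_iff_Ioo)
    then have [measurable]: "(\<lambda>x. indicator {0<..<l} x * F x) \<in> borel_measurable borel"
      unfolding set_integrable_def by (auto dest: borel_measurable_integrable)
    have "(LINT x|lborel. indicator {0<..<l} x * f x * k x) = (LINT x|lborel. indicator {0<..<l} x * F x * k x)"
    proof (rule integral_cong_AE)
      show "AE x in lborel. indicator {0<..<l} x * f x * k x = indicator {0<..<l} x * F x * k x"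
        using that(2) by eventually_elim (auto simp: indicator_def)
    qed measurable
    then show ?thesis by (simp add: set_lebesgue_integral_def mult.assoc)
  qed
  have cont: "continuous_on UNIV (deriv \<phi>)" if "test_function 0 l \<phi>" for \<phi>
    using that by (simp add: test_function_def)
  show ?thesis
  proof
    assume weak: "weak_deriv 0 l f g"
    define G where "G x = (LINT y:{0..x}|lborel. g y)" for x
    have G: "ac l G g"
      using g by (simp add: ac_def G_def set_integrable_Icc_iff_Ioo)
    have "\<exists>c. AE x in lborel. x \<in> {0..l} \<longrightarrow> f x - G x = c"
    proof (rule weak_deriv_zero_const[OF l])
      show fG: "set_integrable lborel {0<..<l} (\<lambda>x. f x - G x)"
        using f ac_set_integrable[OF G] by (intro set_integral_diff) (auto simp: set_integrable_Icc_iff_Ioo)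
      fix \<phi> assume \<phi>: "test_function 0 l \<phi>"
      have "(LINT x:{0<..<l}|lborel. (f x - G x) * deriv \<phi> x) = 
         (LINT x:{0<..<l}|lborel. f x * deriv \<phi> x) - (LINT x:{0<..<l}|lborel. G x * deriv \<phi> x)"
      proof -
        have k: "continuous_on {0..l} (deriv \<phi>)" by (rule continuous_on_subset[OF cont[OF \<phi>]]) simp
        have "set_integrable lborel {0<..<l} (\<lambda>x. f x * deriv \<phi> x)"
          "set_integrable lborel {0<..<l} (\<lambda>x. G x * deriv \<phi> x)"
          using set_integrable_mult_continuous[OF _ k] ac_set_integrable[OF G] f
          unfolding set_integrable_Icc_iff_Ioo by auto
        then show ?thesis unfolding left_diff_distrib by (rule set_integral_diff)
      qed
      then show "(LINT x:{0<..<l}|lborel. (f x - G x) * deriv \<phi> x) = 0"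
        using parts[OF G \<phi>] weak \<phi> unfolding weak_deriv_def by auto
    qed
    then obtain c where c: "AE x in lborel. x \<in> {0..l} \<longrightarrow> f x - G x = c" by blast
    have "ac l (\<lambda>x. c + G x) g"
    proof (rule acI)
      show "c + G x = c + G 0 + integral {0..x} g" if "x \<in> {0..l}" for x
        using ac_eq[OF G that] by linarith
    qed (rule ac_integrable[OF G])
    moreover have "AE x in lborel. x \<in> {0<..<l} \<longrightarrow> f x = c + G x"
      using c by eventually_elim auto
    ultimately show "\<exists>F. ac l F g \<and> (AE x in lborel. x \<in> {0<..<l} \<longrightarrow> f x = F x)" by blast
  next
    assume "\<exists>F. ac l F g \<and> (AE x in lborel. x \<in> {0<..<l} \<longrightarrow> f x = F x)"
    then obtain F where F: "ac l F g" "AE x in lborel. x \<in> {0<..<l} \<longrightarrow> f x = F x" by blast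
    show "weak_deriv 0 l f g"
      unfolding weak_deriv_def
    proof (intro allI impI)
      fix \<phi> assume \<phi>: "test_function 0 l \<phi>"
      show "(LINT x:{0<..<l}|lborel. f x * deriv \<phi> x) = - (LINT x:{0<..<l}|lborel. g x * \<phi> x)"
        by (rule trans[OF cong[OF F cont[OF \<phi>]] parts[OF F(1) \<phi>]])
    qed
  qed
qed

section \<open>Sobolev functions on the network\<close>

text \<open>The interior points where two continuous functions differ form an open set, and an open
  null set is empty; the ends follow by continuity. This is what makes node values of a class well
  defined.\<close>

lemma continuous_AE_eq:
  fixes f g :: "real \<Rightarrow> real"
  assumes "continuous_on {0..l} f" "continuous_on {0..l} g"
    and ae: "AE x in lborel. x \<in> {0<..<l} \<longrightarrow> f x = g x" and l: "0 < l" and x: "x \<in> {0..l}"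
  shows "f x = g x"
proof -
  define d where "d x = f x - g x" for x
  have cont: "continuous_on {0..l} d" unfolding d_def by (intro continuous_intros assms)
  define S where "S = {0<..<l} \<inter> d -` (- {0})"
  have "open S"
    unfolding S_def by (rule continuous_open_preimage[OF continuous_on_subset[OF cont]]) auto
  have "AE x in lborel. x \<notin> S" using ae by eventually_elim (auto simp: S_def d_def)
  then have "S \<in> null_sets lborel" using \<open>open S\<close> by (subst AE_iff_null_sets) auto
  then have "negligible S" by (simp add: negligible_iff_null_sets null_sets_completionI)
  then have "S = {}" using open_not_negligible \<open>open S\<close> by blast
  then have 0: "d y = 0" if "y \<in> {0<..<l}" for y using that by (auto simp: S_def)
  have "d x = 0"
  proof (rule continuous_constant_on_closure[of "{0<..<l}" d 0])
    show "continuous_on (closure {0<..<l}) d" "x \<in> closure {0<..<l}" using l cont x by simp_all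
  qed (rule 0)
  then show ?thesis by (simp add: d_def)
qed

lemma ac_cong_density:
  assumes "ac l F g" "set_integrable lborel {0..l} g'" "AE x in lborel. x \<in> {0<..<l} \<longrightarrow> g x = g' x"
  shows "ac l F g'"
proof (rule acI)
  fix x assume x: "x \<in> {0..l}"
  have i: "set_integrable lborel {0..x} g" "set_integrable lborel {0..x} g'"
    using x assms(2) ac_integrable[OF assms(1)] by (auto intro: set_integrable_subset)
  have "(LINT y:{0<..<x}|lborel. g y) = (LINT y:{0<..<x}|lborel. g' y)"
    unfolding set_lebesgue_integral_def
  proof (rule integral_cong_AE)
    show "(\<lambda>y. indicator {0<..<x} y *\<^sub>R g y) \<in> borel_measurable lborel"
      "(\<lambda>y. indicator {0<..<x} y *\<^sub>R g' y) \<in> borel_measurable lborel"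
      using i unfolding set_integrable_Icc_iff_Ioo unfolding set_integrable_def
      by (auto dest: borel_measurable_integrable)
    show "AE y in lborel. indicator {0<..<x} y *\<^sub>R g y = indicator {0<..<x} y *\<^sub>R g' y"
      using assms(3) by eventually_elim (use x in \<open>auto simp: indicator_def\<close>)
  qed
  then have "integral {0..x} g = integral {0..x} g'"
    using i by (simp flip: set_integral_Icc_Ioo add: set_borel_integral_eq_integral(2))
  then show "F x = F 0 + integral {0..x} g'" using ac_eq[OF assms(1) x] by linarith
qed (rule assms(2))

subsection \<open>Tuples of functions\<close>

lemma integrable_rep_l1: "integrable lborel (rep_l1 f i)"
  using l1rel_rep[of f] by (simp add: l1rel_def)

lemma l1_eq_iff: "f = g \<longleftrightarrow> (\<forall>i. AE x in lborel. rep_l1 f i x = rep_l1 g i x)"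
  unfolding Quotient_rel_rep[OF Quotient_l1, symmetric] by (simp add: l1rel_def integrable_rep_l1)

lemma rep_abs_l1:
  "(\<And>i. integrable lborel (F i)) \<Longrightarrow> AE x in lborel. rep_l1 (abs_l1 F) i x = F i x"
  using Quotient_rep_abs[OF Quotient_l1, of F] by (simp add: l1rel_def)

definition arc_integrable :: "('m \<Rightarrow> real) \<Rightarrow> ('m \<Rightarrow> real \<Rightarrow> real) \<Rightarrow> bool" where
  "arc_integrable L F \<longleftrightarrow> (\<forall>i. set_integrable lborel {0..L i} (F i))"

lemma arc_integrable_indicator:
  assumes "arc_integrable L F"
  shows "integrable lborel (\<lambda>x. indicator {0<..<L i} x * F i x)"
proof -
  have "set_integrable lborel {0<..<L i} (F i)"
    using assms by (simp add: arc_integrable_def flip: set_integrable_Icc_iff_Ioo)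
  then show ?thesis by (simp add: set_integrable_def)
qed

lemma rep_of_funs:
  "arc_integrable L F \<Longrightarrow> AE x in lborel. rep_l1 (of_funs L F) i x = indicator {0<..<L i} x * F i x"
  unfolding of_funs_def by (rule rep_abs_l1) (rule arc_integrable_indicator)

lemma of_funs_eq_iff:
  assumes "arc_integrable L F" "arc_integrable L G"
  shows "of_funs L F = of_funs L G \<longleftrightarrow> (\<forall>i. AE x in lborel. x \<in> {0<..<L i} \<longrightarrow> F i x = G i x)"
proof -
  have "(AE x in lborel. rep_l1 (of_funs L F) i x = rep_l1 (of_funs L G) i x)
    \<longleftrightarrow> (AE x in lborel. x \<in> {0<..<L i} \<longrightarrow> F i x = G i x)" for i
  proof
    assume "AE x in lborel. rep_l1 (of_funs L F) i x = rep_l1 (of_funs L G) i x"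
    with rep_of_funs[OF assms(1), of i] rep_of_funs[OF assms(2), of i]
    show "AE x in lborel. x \<in> {0<..<L i} \<longrightarrow> F i x = G i x" by eventually_elim auto
  next
    assume "AE x in lborel. x \<in> {0<..<L i} \<longrightarrow> F i x = G i x"
    with rep_of_funs[OF assms(1), of i] rep_of_funs[OF assms(2), of i]
    show "AE x in lborel. rep_l1 (of_funs L F) i x = rep_l1 (of_funs L G) i x"
      by eventually_elim (auto simp: indicator_def)
  qed
  then show ?thesis by (simp add: l1_eq_iff)
qed

lemma of_funs_L1A: "arc_integrable L F \<Longrightarrow> of_funs L F \<in> L1A L"
  unfolding L1A_def mem_Collect_eq
proof
  fix i assume "arc_integrable L F"
  from rep_of_funs[OF this, of i]
  show "AE x in lborel. x \<notin> {0<..<L i} \<longrightarrow> rep_l1 (of_funs L F) i x = 0"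
    by eventually_elim auto
qed

lemma arc_integrable_rep: "arc_integrable L (rep_l1 f)"
  unfolding arc_integrable_def set_integrable_def
  using integrable_rep_l1[of f] by (auto intro!: integrable_mult_indicator[of _ _ "rep_l1 f _", simplified])

lemma L1A_iff_of_funs: "f \<in> L1A L \<longleftrightarrow> of_funs L (rep_l1 f) = f"
proof
  assume f: "f \<in> L1A L"
  show "of_funs L (rep_l1 f) = f"
    unfolding l1_eq_iff
  proof
    fix i
    have "AE x in lborel. x \<notin> {0<..<L i} \<longrightarrow> rep_l1 f i x = 0" using f by (simp add: L1A_def)
    with rep_of_funs[OF arc_integrable_rep, of L f i]
    show "AE x in lborel. rep_l1 (of_funs L (rep_l1 f)) i x = rep_l1 f i x"
      by eventually_elim (auto simp: indicator_def)
  qed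
qed (metis of_funs_L1A arc_integrable_rep)

lemma norm_l1_rep: "norm f = (\<Sum>i\<in>UNIV. (LINT x|lborel. \<bar>rep_l1 f i x\<bar>))"
  by (metis abs_rep_l1 l1rel_rep norm_abs_l1)

lemma norm_of_funs:
  fixes L :: "'m::finite \<Rightarrow> real"
  assumes "arc_integrable L F"
  shows "norm (of_funs L F) = (\<Sum>i\<in>UNIV. (LINT x:{0..L i}|lborel. \<bar>F i x\<bar>))"
proof -
  have "norm (of_funs L F) = (\<Sum>i\<in>UNIV. (LINT x|lborel. \<bar>indicator {0<..<L i} x * F i x\<bar>))"
    unfolding of_funs_def
    by (rule norm_abs_l1) (simp add: l1rel_def arc_integrable_indicator[OF assms])
  then show ?thesis
    unfolding set_integral_Icc_Ioo by (simp add: set_lebesgue_integral_def abs_mult)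
qed

lemma arc_integrable_lincomb:
  assumes "arc_integrable L F" "arc_integrable L G"
  shows "arc_integrable L (\<lambda>i x. a i * F i x + b i * G i x)"
  using assms unfolding arc_integrable_def by (intro allI set_integral_add) auto

lemma plus_abs_l1:
  "l1rel f f \<Longrightarrow> l1rel g g \<Longrightarrow> abs_l1 f + abs_l1 g = abs_l1 (\<lambda>i x. f i x + g i x)"
  by (rule plus_l1.abs_eq)

lemma of_funs_lincomb:
  fixes L :: "'m::finite \<Rightarrow> real"
  assumes "arc_integrable L F" "arc_integrable L G"
  shows "of_funs L (\<lambda>i x. a i * F i x + b i * G i x)
    = arcscale a (of_funs L F) + arcscale b (of_funs L G)"
proof -
  note i = arc_integrable_indicator[OF assms(1)] arc_integrable_indicator[OF assms(2)]
  have r: "l1rel (\<lambda>i x. indicator {0<..<L i} x * F i x) (\<lambda>i x. indicator {0<..<L i} x * F i x)"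
    "l1rel (\<lambda>i x. indicator {0<..<L i} x * G i x) (\<lambda>i x. indicator {0<..<L i} x * G i x)"
    using i by (simp_all add: l1rel_def)
  have r': "l1rel (\<lambda>i x. a i * (indicator {0<..<L i} x * F i x)) (\<lambda>i x. a i * (indicator {0<..<L i} x * F i x))"
    "l1rel (\<lambda>i x. b i * (indicator {0<..<L i} x * G i x)) (\<lambda>i x. b i * (indicator {0<..<L i} x * G i x))"
    using i by (simp_all add: l1rel_def)
  show ?thesis
    unfolding of_funs_def arcscale.abs_eq[OF r(1)] arcscale.abs_eq[OF r(2)] plus_abs_l1[OF r']
    by (simp add: algebra_simps)
qed

lemma arcscale_const: "arcscale (\<lambda>i. c) (f :: 'm::finite l1) = c *\<^sub>R f"
  by transfer (auto simp: l1rel_def)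

lemma arcscale_of_funs:
  fixes L :: "'m::finite \<Rightarrow> real"
  assumes "arc_integrable L F"
  shows "arcscale a (of_funs L F) = of_funs L (\<lambda>i x. a i * F i x)"
  using of_funs_lincomb[OF assms assms, of a "\<lambda>i. 0"] by (simp add: arcscale_const)

lemma of_funs_scale:
  fixes L :: "'m::finite \<Rightarrow> real"
  assumes "arc_integrable L F"
  shows "of_funs L (\<lambda>i x. c * F i x) = c *\<^sub>R of_funs L F"
  using arcscale_of_funs[OF assms, of "\<lambda>i. c"] by (simp add: arcscale_const)

lemma of_funs_add:
  fixes L :: "'m::finite \<Rightarrow> real"
  assumes "arc_integrable L F" "arc_integrable L G"
  shows "of_funs L (\<lambda>i x. F i x + G i x) = of_funs L F + of_funs L G"
  using of_funs_lincomb[OF assms, of "\<lambda>i. 1" "\<lambda>i. 1"] by (simp add: arcscale_const)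

text \<open>A projection of norm at most 1 onto \<open>L1A L\<close>. It presents that set as the
  solutions of a linear equation, which makes it a closed subspace, and it is the \<open>P\<close>
  required by \<open>generated_semigroup\<close>.\<close>

definition restr :: "('m \<Rightarrow> real) \<Rightarrow> 'm l1 \<Rightarrow> 'm l1" where
  "restr L f = of_funs L (rep_l1 f)"

lemma rep_plus: "AE x in lborel. rep_l1 (f + g :: 'm::finite l1) i x = rep_l1 f i x + rep_l1 g i x"
proof -
  have "f + g = abs_l1 (\<lambda>i x. rep_l1 f i x + rep_l1 g i x)"
    using plus_abs_l1[OF l1rel_rep l1rel_rep, of f g] by (simp add: abs_rep_l1)
  then show ?thesis
    using rep_abs_l1[of "\<lambda>i x. rep_l1 f i x + rep_l1 g i x" i]
    by (simp add: integrable_rep_l1)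
qed

lemma rep_scale: "AE x in lborel. rep_l1 (c *\<^sub>R f :: 'm::finite l1) i x = c * rep_l1 f i x"
proof -
  have "c *\<^sub>R f = abs_l1 (\<lambda>i x. c * rep_l1 f i x)"
    using scaleR_l1.abs_eq[OF l1rel_rep, of c f] by (simp add: abs_rep_l1)
  then show ?thesis
    using rep_abs_l1[of "\<lambda>i x. c * rep_l1 f i x" i] by (simp add: integrable_rep_l1)
qed

lemma bounded_linear_restr:
  fixes L :: "'m::finite \<Rightarrow> real"
  shows "bounded_linear (restr L)"
proof (rule bounded_linear_intro[where K = 1])
  fix f g :: "'m l1" and c :: real
  have 1: "restr L (f + g) = of_funs L (\<lambda>i x. rep_l1 f i x + rep_l1 g i x)"
    unfolding restr_def
  proof (subst of_funs_eq_iff)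
    show "arc_integrable L (\<lambda>i x. rep_l1 f i x + rep_l1 g i x)"
      using arc_integrable_lincomb[OF arc_integrable_rep arc_integrable_rep, of L "\<lambda>_. 1" f "\<lambda>_. 1" g] by simp
    show "\<forall>i. AE x in lborel. x \<in> {0<..<L i} \<longrightarrow> rep_l1 (f + g) i x = rep_l1 f i x + rep_l1 g i x"
    proof
      fix i from rep_plus[of f g i]
      show "AE x in lborel. x \<in> {0<..<L i} \<longrightarrow> rep_l1 (f + g) i x = rep_l1 f i x + rep_l1 g i x"
        by eventually_elim simp
    qed
  qed (rule arc_integrable_rep)
  then show "restr L (f + g) = restr L f + restr L g"
    by (simp add: restr_def of_funs_add arc_integrable_rep)
  have "restr L (c *\<^sub>R f) = of_funs L (\<lambda>i x. c * rep_l1 f i x)"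
    unfolding restr_def
  proof (subst of_funs_eq_iff)
    show "arc_integrable L (\<lambda>i x. c * rep_l1 f i x)"
      using arc_integrable_lincomb[OF arc_integrable_rep arc_integrable_rep, of L "\<lambda>_. c" f "\<lambda>_. 0" f] by simp
    show "\<forall>i. AE x in lborel. x \<in> {0<..<L i} \<longrightarrow> rep_l1 (c *\<^sub>R f) i x = c * rep_l1 f i x"
    proof
      fix i from rep_scale[of c f i]
      show "AE x in lborel. x \<in> {0<..<L i} \<longrightarrow> rep_l1 (c *\<^sub>R f) i x = c * rep_l1 f i x"
        by eventually_elim simp
    qed
  qed (rule arc_integrable_rep)
  then show "restr L (c *\<^sub>R f) = c *\<^sub>R restr L f"
    by (simp add: restr_def of_funs_scale arc_integrable_rep)
  have "(LINT x:{0..L i}|lborel. \<bar>rep_l1 f i x\<bar>) \<le> (LINT x|lborel. \<bar>rep_l1 f i x\<bar>)" for i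
    unfolding set_lebesgue_integral_def
    using integrable_rep_l1[of f i]
    by (intro integral_mono integrable_mult_indicator) (auto simp: indicator_def)
  then show "norm (restr L f) \<le> norm f * 1"
    unfolding restr_def norm_of_funs[OF arc_integrable_rep] norm_l1_rep[of f] by (auto intro: sum_mono)
qed

lemma restr_L1A: "restr L f \<in> L1A L"
  unfolding restr_def by (rule of_funs_L1A[OF arc_integrable_rep])

lemma restr_id: "f \<in> L1A L \<Longrightarrow> restr L f = f"
  by (simp add: restr_def L1A_iff_of_funs)

lemma subspace_L1A: "subspace (L1A (L :: 'm::finite \<Rightarrow> real))"
  and closed_L1A: "closed (L1A (L :: 'm::finite \<Rightarrow> real))"
proof -
  have eq: "L1A L = {f. restr L f = f}" by (auto simp: restr_def L1A_iff_of_funs)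
  interpret bounded_linear "restr L" by (rule bounded_linear_restr)
  show "subspace (L1A L)" unfolding eq by (auto simp: subspace_def zero add scale)
  show "closed (L1A L)" unfolding eq
    by (intro closed_Collect_eq continuous_intros bounded_linear.continuous_on[OF bounded_linear_restr])
qed

subsection \<open>Weak derivatives and point values\<close>

lemma has_wder_iff:
  assumes L: "\<And>i. 0 < L i"
  shows "has_wder L f g \<longleftrightarrow> (\<forall>i. \<exists>F. ac (L i) F (rep_l1 g i) \<and>
     (AE x in lborel. x \<in> {0<..<L i} \<longrightarrow> rep_l1 f i x = F x))"
  unfolding has_wder_def
  using arc_integrable_rep[of L f] arc_integrable_rep[of L g] L
  by (intro all_cong1 weak_deriv_iff_ac) (simp_all add: arc_integrable_def set_integrable_Icc_iff_Ioo)

text \<open>Two continuous representatives of \<open>f\<close> coincide on the whole closed arc, so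
  \<open>g\<close> and \<open>g'\<close> are densities of the same function; off the arc both
  vanish. This resolves the \<open>THE\<close> in \<open>wder\<close>.\<close>

lemma has_wder_unique:
  assumes L: "\<And>i. 0 < L i" and "has_wder L f g" "has_wder L f g'" "g \<in> L1A L" "g' \<in> L1A L"
  shows "g = g'"
proof -
  have "AE x in lborel. rep_l1 g i x = rep_l1 g' i x" for i
  proof -
    obtain F F' where F: "ac (L i) F (rep_l1 g i)" "AE x in lborel. x \<in> {0<..<L i} \<longrightarrow> rep_l1 f i x = F x" 
     and F': "ac (L i) F' (rep_l1 g' i)" "AE x in lborel. x \<in> {0<..<L i} \<longrightarrow> rep_l1 f i x = F' x" 
      using assms(2,3) unfolding has_wder_iff[OF L] by blast
    have "AE x in lborel. x \<in> {0<..<L i} \<longrightarrow> F x = F' x" using F(2) F'(2) by eventually_elim auto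
    then have "F x = F' x" if "x \<in> {0..L i}" for x
      using continuous_AE_eq[OF ac_continuous[OF F(1)] ac_continuous[OF F'(1)] _ L that] by blast
    then have "ac (L i) F' (rep_l1 g i)" by (rule ac_cong[OF F(1)])
    then have "AE x in lborel. x \<in> {0..L i} \<longrightarrow> rep_l1 g i x = rep_l1 g' i x"
      using F'(1) by (rule ac_density_unique)
    moreover have "AE x in lborel. x \<notin> {0<..<L i} \<longrightarrow> rep_l1 g i x = 0" 
      "AE x in lborel. x \<notin> {0<..<L i} \<longrightarrow> rep_l1 g' i x = 0" 
      using assms by (auto simp: L1A_def)
    ultimately show ?thesis by eventually_elim auto
  qed
  then show ?thesis by (simp add: l1_eq_iff)
qed

lemma wder_eqI:
  assumes "\<And>i. 0 < L i" "has_wder L f g" "g \<in> L1A L"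
  shows "wder L f = g"
  unfolding wder_def using assms has_wder_unique by (intro the_equality) blast+

lemma ac_arc_integrable:
  assumes "\<And>i. ac (L i) (F i) (G i)"
  shows "arc_integrable L F" "arc_integrable L G"
  unfolding arc_integrable_def using ac_integrable[OF assms] ac_set_integrable[OF assms] by blast+

lemma has_wder_of_funs:
  assumes L: "\<And>i. 0 < L i" and F: "\<And>i. ac (L i) (F i) (G i)"
  shows "has_wder L (of_funs L F) (of_funs L G)"
  unfolding has_wder_iff[OF L]
proof (intro allI exI conjI)
  fix i
  note arc = ac_arc_integrable[of L F G, OF F]
  have "AE x in lborel. x \<in> {0<..<L i} \<longrightarrow> G i x = rep_l1 (of_funs L G) i x"
    using rep_of_funs[OF arc(2), of i] by eventually_elim auto
  then show "ac (L i) (F i) (rep_l1 (of_funs L G) i)"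
    using arc_integrable_rep[of L "of_funs L G"]
    by (intro ac_cong_density[OF F]) (simp_all add: arc_integrable_def)
  show "AE x in lborel. x \<in> {0<..<L i} \<longrightarrow> rep_l1 (of_funs L F) i x = F i x"
    using rep_of_funs[OF arc(1), of i] by eventually_elim auto
qed

lemma wder_of_funs:
  assumes L: "\<And>i. 0 < L i" and F: "\<And>i. ac (L i) (F i) (G i)"
  shows "wder L (of_funs L F) = of_funs L G"
  using assms ac_arc_integrable[of L F G] by (intro wder_eqI has_wder_of_funs of_funs_L1A) auto

lemma pval_of_funs:
  assumes L: "\<And>i. 0 < L i" and F: "arc_integrable L F" "continuous_on {0..L i} (F i)"
    and p: "p \<in> {0..L i}"
  shows "pval L (of_funs L F) i p = F i p"
  unfolding pval_def
proof (rule the_equality)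
  have 1: "AE x in lborel. x \<in> {0<..<L i} \<longrightarrow> rep_l1 (of_funs L F) i x = F i x"
    using rep_of_funs[OF F(1), of i] by eventually_elim auto
  with F(2) show "\<exists>c. continuous_on {0..L i} c \<and>
     (AE x in lborel. x \<in> {0<..<L i} \<longrightarrow> rep_l1 (of_funs L F) i x = c x) \<and> F i p = c p" by blast
  fix v assume "\<exists>c. continuous_on {0..L i} c \<and>
     (AE x in lborel. x \<in> {0<..<L i} \<longrightarrow> rep_l1 (of_funs L F) i x = c x) \<and> v = c p"
  then obtain c where c: "continuous_on {0..L i} c" "v = c p"
    "AE x in lborel. x \<in> {0<..<L i} \<longrightarrow> rep_l1 (of_funs L F) i x = c x" by blast
  have "AE x in lborel. x \<in> {0<..<L i} \<longrightarrow> c x = F i x" using 1 c(3) by eventually_elim auto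
  then show "v = F i p" unfolding c(2) by (rule continuous_AE_eq[OF c(1) F(2) _ L p])
qed

lemma has_wder_ac:
  assumes L: "\<And>i. 0 < L i" and f: "f \<in> L1A L" and w: "has_wder L f g"
  obtains F where "\<And>i. ac (L i) (F i) (rep_l1 g i)" "f = of_funs L F"
proof -
  have "\<exists>F. \<forall>i. ac (L i) (F i) (rep_l1 g i) \<and> (AE x in lborel. x \<in> {0<..<L i} \<longrightarrow> rep_l1 f i x = F i x)"
    using w unfolding has_wder_iff[OF L] by (rule choice)
  then obtain F where F: "\<And>i. ac (L i) (F i) (rep_l1 g i)"
    "\<And>i. AE x in lborel. x \<in> {0<..<L i} \<longrightarrow> rep_l1 f i x = F i x" by blast
  have "of_funs L (rep_l1 f) = of_funs L F"
    using F ac_arc_integrable(1)[of L F "rep_l1 g"] arc_integrable_rep by (subst of_funs_eq_iff) auto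
  then have "f = of_funs L F" using f by (simp add: L1A_iff_of_funs)
  with F(1) show ?thesis by (rule that)
qed

text \<open>A pointwise model of W^{2,1}: actual functions with their first and second derivatives,
  the last one merely integrable. Weak derivatives and node values are computed on the functions
  (\<open>sobolev2_wder\<close>, \<open>sobolev2_pval\<close>), and every class arises in this way
  (\<open>WA_2_sobolev2\<close>).\<close>

definition sobolev2 ::
  "('m \<Rightarrow> real) \<Rightarrow> ('m \<Rightarrow> real \<Rightarrow> real) \<Rightarrow> ('m \<Rightarrow> real \<Rightarrow> real) \<Rightarrow> ('m \<Rightarrow> real \<Rightarrow> real) \<Rightarrow> bool" where
  "sobolev2 L W V G \<longleftrightarrow> (\<forall>i. ac (L i) (W i) (V i) \<and> ac (L i) (V i) (G i))"

lemma sobolev2_ac: "sobolev2 L W V G \<Longrightarrow> ac (L i) (W i) (V i)" "sobolev2 L W V G \<Longrightarrow> ac (L i) (V i) (G i)"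
  by (auto simp: sobolev2_def)

lemma sobolev2_arc_integrable:
  assumes "sobolev2 L W V G"
  shows "arc_integrable L W" "arc_integrable L V" "arc_integrable L G"
  using ac_arc_integrable[of L W V] ac_arc_integrable[of L V G] assms by (auto simp: sobolev2_def)

lemma sobolev2_lincomb:
  assumes "sobolev2 L W V G" "sobolev2 L W' V' G'"
  shows "sobolev2 L (\<lambda>i x. a * W i x + b * W' i x) (\<lambda>i x. a * V i x + b * V' i x) (\<lambda>i x. a * G i x + b * G' i x)"
  using assms unfolding sobolev2_def by (auto intro!: ac_lincomb)

lemma sobolev2_wder:
  assumes L: "\<And>i. 0 < L i" and s: "sobolev2 L W V G"
  shows "wder L (of_funs L W) = of_funs L V" "wder L (wder L (of_funs L W)) = of_funs L G"
    "of_funs L W \<in> WA L 2"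
proof -
  show 1: "wder L (of_funs L W) = of_funs L V"
    by (rule wder_of_funs[OF L sobolev2_ac(1)[OF s]])
  show "wder L (wder L (of_funs L W)) = of_funs L G"
    unfolding 1 by (rule wder_of_funs[OF L sobolev2_ac(2)[OF s]])
  note i = sobolev2_arc_integrable[OF s, THEN of_funs_L1A]
  have "of_funs L V \<in> WA L (Suc 0)"
    using i has_wder_of_funs[of L V G, OF L sobolev2_ac(2)[OF s]] by auto
  then have "of_funs L W \<in> WA L (Suc (Suc 0))"
    using i has_wder_of_funs[of L W V, OF L sobolev2_ac(1)[OF s]] unfolding WA.simps(2)[of L "Suc 0"] by blast
  then show "of_funs L W \<in> WA L 2" by (simp only: numeral_2_eq_2)
qed

lemma sobolev2_pval:
  assumes L: "\<And>i. 0 < L i" and s: "sobolev2 L W V G" and p: "p \<in> {0..L i}"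
  shows "pval L (of_funs L W) i p = W i p" "pval L (wder L (of_funs L W)) i p = V i p"
  unfolding sobolev2_wder(1)[OF L s]
  by (intro pval_of_funs L p sobolev2_arc_integrable[OF s] ac_continuous[OF sobolev2_ac(1)[OF s]]
    ac_continuous[OF sobolev2_ac(2)[OF s]])+

lemma WA_2_sobolev2:
  assumes L: "\<And>i. 0 < L i" and w: "w \<in> WA L 2"
  obtains W V G where "sobolev2 L W V G" "w = of_funs L W"
proof -
  obtain v g where *: "w \<in> L1A L" "v \<in> L1A L" "has_wder L w v" "has_wder L v g" 
    using w unfolding numeral_2_eq_2 by auto
  obtain V where V: "\<And>i. ac (L i) (V i) (rep_l1 g i)" "v = of_funs L V"
    using has_wder_ac[OF L *(2,4)] by blast
  obtain W where W: "\<And>i. ac (L i) (W i) (rep_l1 v i)" "w = of_funs L W"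
    using has_wder_ac[OF L *(1,3)] by blast
  have arcV: "arc_integrable L V" using ac_arc_integrable[of L V "rep_l1 g"] V by blast
  \<comment> \<open>\<open>W\<close> comes with an arbitrary representative of \<open>v\<close> as
    its density, which is exchanged here for the continuous one.\<close>
  have "ac (L i) (W i) (V i)" for i
  proof (rule ac_cong_density[OF W(1)])
    show "set_integrable lborel {0..L i} (V i)" using arcV by (simp add: arc_integrable_def)
    show "AE x in lborel. x \<in> {0<..<L i} \<longrightarrow> rep_l1 v i x = V i x"
      using rep_of_funs[OF arcV, of i] unfolding V(2) by eventually_elim auto
  qed
  then show ?thesis
  proof (intro that[of W V "rep_l1 g"])
    assume *: "\<And>i. ac (L i) (W i) (V i)"
    show "sobolev2 L W V (rep_l1 g)" using * V(1) by (simp add: sobolev2_def)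
  qed (rule W(2))
qed

section \<open>The operator on a single arc\<close>

lemma ac_restrict: "ac l F g \<Longrightarrow> x \<in> {0..l} \<Longrightarrow> ac x F g"
  by (rule acI) (auto intro: set_integrable_subset ac_integrable intro!: ac_eq)

text \<open>This is integration by parts on \<open>{0..x}\<close> for every
  \<open>x\<close>.\<close>

lemma ac_mult:
  assumes F: "ac l F g"
    and \<phi>: "\<And>x. x \<in> {0..l} \<Longrightarrow> (\<phi> has_real_derivative \<phi>' x) (at x within {0..l})"
    and \<phi>': "continuous_on {0..l} \<phi>'"
  shows "ac l (\<lambda>x. F x * \<phi> x) (\<lambda>x. g x * \<phi> x + F x * \<phi>' x)"
proof (rule acI)
  have \<phi>c: "continuous_on {0..l} \<phi>" by (rule ac_continuous[OF acI_derivative[OF \<phi> \<phi>']])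
  have i: "set_integrable lborel {0..l} (\<lambda>x. g x * \<phi> x)" "set_integrable lborel {0..l} (\<lambda>x. F x * \<phi>' x)"
    by (intro set_integrable_mult_continuous ac_integrable[OF F] ac_set_integrable[OF F] \<phi>c \<phi>')+
  then show i3: "set_integrable lborel {0..l} (\<lambda>x. g x * \<phi> x + F x * \<phi>' x)"
    by (rule set_integral_add)
  fix x assume x: "x \<in> {0..l}"
  have "(LINT y:{0..x}|lborel. g y * \<phi> y) = F x * \<phi> x - F 0 * \<phi> 0 - (LINT y:{0..x}|lborel. F y * \<phi>' y)"
    using x by (intro ac_by_parts ac_restrict[OF F] DERIV_subset[OF \<phi>] continuous_on_subset[OF \<phi>']) auto
  moreover have "(LINT y:{0..x}|lborel. g y * \<phi> y + F y * \<phi>' y)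
      = (LINT y:{0..x}|lborel. g y * \<phi> y) + (LINT y:{0..x}|lborel. F y * \<phi>' y)"
    using x by (intro set_integral_add(2) set_integrable_subset[OF i(1)] set_integrable_subset[OF i(2)]) auto
  ultimately show "F x * \<phi> x = F 0 * \<phi> 0 + integral {0..x} (\<lambda>x. g x * \<phi> x + F x * \<phi>' x)"
    using set_integral_upto_eq_integral(1)[OF i3 x] by linarith
qed

lemma ac_add_const: "ac l F g \<Longrightarrow> ac l (\<lambda>x. c + F x) g"
proof (rule acI)
  fix x assume "ac l F g" "x \<in> {0..l}"
  from ac_eq[OF this] show "c + F x = c + F 0 + integral {0..x} g" by linarith
qed (rule ac_integrable)

text \<open>The integrating factor is \<open>exp (- r * x)\<close>; the constant of integration
  \<open>C\<close> is adjusted to the value prescribed at \<open>p\<close>.\<close>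

lemma ac_first_order_ode:
  assumes g: "set_integrable lborel {0..l} g"
  shows "\<exists>v. ac l v (\<lambda>x. r * v x + g x) \<and> v p = c"
proof -
  define G where "G x = (LINT y:{0..x}|lborel. g y * exp (- r * y))" for x
  have G: "ac l G (\<lambda>x. g x * exp (- r * x))"
    unfolding ac_def G_def
    by (intro conjI ballI set_integrable_mult_continuous g continuous_intros) simp
  define C where "C = c * exp (- r * p) - G p"
  define v where "v x = (C + G x) * exp (r * x)" for x
  have "ac l v (\<lambda>x. g x * exp (- r * x) * exp (r * x) + (C + G x) * (r * exp (r * x)))"
    unfolding v_def by (intro ac_mult ac_add_const G) (auto intro!: derivative_eq_intros continuous_intros)
  moreover have "g x * exp (- r * x) * exp (r * x) + (C + G x) * (r * exp (r * x)) = r * v x + g x" for x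
    by (simp add: v_def mult.assoc flip: exp_add)
  ultimately have "ac l v (\<lambda>x. r * v x + g x)" by simp
  moreover have "v p = c" by (simp add: v_def C_def mult.assoc flip: exp_add)
  ultimately show ?thesis by blast
qed

text \<open>The equation factors with roots \<open>r1\<close> and \<open>r2\<close>: the function
  \<open>v = W' - r2 W\<close> solves \<open>v' = r1 v + g\<close>, so two first order equations are
  solved in succession. The value \<open>c1 - r2 * c0\<close> of \<open>v\<close> at
  \<open>p\<close> encodes the prescribed slope.\<close>

lemma ac_second_order_ode:
  assumes g: "set_integrable lborel {0..l} g"
  shows "\<exists>W V G. ac l W V \<and> ac l V G \<and> W p = c0 \<and> V p = c1 \<and>
     (\<forall>x. G x = (r1 + r2) * V x - r1 * r2 * W x + g x)"
proof -
  obtain v where v: "ac l v (\<lambda>x. r1 * v x + g x)" "v p = c1 - r2 * c0"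
    using ac_first_order_ode[OF g] by blast
  obtain W where W: "ac l W (\<lambda>x. r2 * W x + v x)" "W p = c0"
    using ac_first_order_ode[OF ac_set_integrable[OF v(1)]] by blast
  have "ac l (\<lambda>x. r2 * W x + 1 * v x) (\<lambda>x. r2 * (r2 * W x + v x) + 1 * (r1 * v x + g x))"
    by (rule ac_lincomb[OF W(1) v(1)])
  then have V: "ac l (\<lambda>x. r2 * W x + v x) (\<lambda>x. r2 * (r2 * W x + v x) + (r1 * v x + g x))" by simp
  show ?thesis
    using W V v(2)
    by (intro exI[of _ W] exI[of _ "\<lambda>x. r2 * W x + v x"] exI[of _ "\<lambda>x. r2 * (r2 * W x + v x) + (r1 * v x + g x)"])
      (auto simp: algebra_simps)
qed

subsection \<open>A smooth approximation of the sign function\<close>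

definition ssgn :: "real \<Rightarrow> real \<Rightarrow> real" where
  "ssgn d w = w / sqrt (w\<^sup>2 + d\<^sup>2)"

lemma ssgn_0 [simp]: "ssgn d 0 = 0"
  by (simp add: ssgn_def)

lemma sqrt_sq_pos: "0 < d \<Longrightarrow> 0 < sqrt (w\<^sup>2 + d\<^sup>2)" for w d :: real
  by (simp add: add_nonneg_pos)

lemma abs_ssgn: "0 < d \<Longrightarrow> \<bar>ssgn d w\<bar> \<le> 1"
proof -
  assume d: "0 < d"
  have "\<bar>w\<bar> = sqrt (w\<^sup>2)" by simp
  also have "\<dots> \<le> sqrt (w\<^sup>2 + d\<^sup>2)" by (intro real_sqrt_le_mono) simp
  finally show ?thesis using sqrt_sq_pos[OF d, of w] by (simp add: ssgn_def abs_divide)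
qed

lemma ssgn_deriv:
  assumes d: "0 < d"
  shows "(ssgn d has_real_derivative d\<^sup>2 / sqrt (w\<^sup>2 + d\<^sup>2) ^ 3) (at w)"
proof -
  define s where "s = sqrt (w\<^sup>2 + d\<^sup>2)"
  have s: "s > 0" "s\<^sup>2 = w\<^sup>2 + d\<^sup>2" using sqrt_sq_pos[OF d, of w] by (auto simp: s_def)
  have "((\<lambda>w. w / sqrt (w\<^sup>2 + d\<^sup>2)) has_real_derivative (1 * s - w * (2 * w * (inverse s / 2))) / (s * s)) (at w)"
    using s(1) unfolding s_def by (auto intro!: derivative_eq_intros simp: power2_eq_square)
  moreover have "(1 * s - w * (2 * w * (inverse s / 2))) / (s * s) = (s\<^sup>2 - w\<^sup>2) / s ^ 3"
    using s(1) by (simp add: field_simps power2_eq_square power3_eq_cube)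
  ultimately show ?thesis unfolding ssgn_def[abs_def] s_def[symmetric] using s(2) by simp
qed

lemma ssgn_mono: "0 < d \<Longrightarrow> x \<le> y \<Longrightarrow> ssgn d x \<le> ssgn d y"
  by (rule DERIV_nonneg_imp_nondecreasing) (auto intro!: ssgn_deriv exI)

text \<open>With \<open>s = sqrt (w\<^sup>2 + d\<^sup>2)\<close> the product is
  \<open>s - d * (d / s)\<close>, and \<open>d \<le> s\<close>. So testing with
  \<open>ssgn d\<close> instead of the sign loses at most \<open>d\<close>.\<close>

lemma ssgn_mult_ge:
  assumes d: "0 < d"
  shows "\<bar>w\<bar> - d \<le> w * ssgn d w"
proof -
  define s where "s = sqrt (w\<^sup>2 + d\<^sup>2)"
  have s: "s > 0" "s\<^sup>2 = w\<^sup>2 + d\<^sup>2" using sqrt_sq_pos[OF d, of w] by (auto simp: s_def)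
  have "\<bar>w\<bar> \<le> s" "d \<le> s" using d unfolding s_def by (auto intro!: real_le_rsqrt)
  have "w * ssgn d w = w\<^sup>2 / s" by (simp add: ssgn_def s_def power2_eq_square)
  also have "\<dots> = (s\<^sup>2 - d\<^sup>2) / s" by (simp add: s(2))
  also have "\<dots> = s - d * (d / s)" using s(1) by (simp add: field_simps power2_eq_square)
  also have "\<dots> \<ge> s - d * 1" using \<open>d \<le> s\<close> s d by (intro diff_left_mono mult_left_mono) auto
  finally show ?thesis using \<open>\<bar>w\<bar> \<le> s\<close> by linarith
qed

text \<open>Integration by parts of the flux leaves two interior integrals. The diffusive one has a
  sign since \<open>ssgn d\<close> increases; the convective one is the integral of a total
  derivative, whose primitive lies between \<open>- d\<close> and 0 and so costs at most
  \<open>\<mu> * d\<close>.\<close>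

lemma arc_dissipation:
  assumes l: "0 \<le> l" and d: "0 < d" and pos: "0 < \<epsilon>" "0 < \<mu>"
    and W: "ac l W V" and V: "ac l V G"
  shows "(LINT x:{0..l}|lborel. (\<epsilon> * G x - \<mu> * V x) * ssgn d (W x))
    \<le> (\<epsilon> * V l - \<mu> * W l) * ssgn d (W l) - (\<epsilon> * V 0 - \<mu> * W 0) * ssgn d (W 0) + \<mu> * d"
proof -
  define s where "s w = sqrt (w\<^sup>2 + d\<^sup>2)" for w
  have s: "s w > 0" for w using sqrt_sq_pos[OF d] by (simp add: s_def)
  have s': "d \<le> s w" for w using d by (auto simp: s_def intro!: real_le_rsqrt)
  define p where "p w = d\<^sup>2 / s w ^ 3" for w
  have sc: "continuous_on UNIV s" unfolding s_def by (intro continuous_intros)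
  note cW = ac_continuous[OF W] and cV = ac_continuous[OF V]
  have scW: "continuous_on {0..l} (\<lambda>x. s (W x))"
    by (rule continuous_on_compose2[OF sc cW]) simp
  have pc: "continuous_on {0..l} (\<lambda>x. p (W x))"
    unfolding p_def using s by (intro continuous_intros scW) (auto simp: less_imp_neq[symmetric])
  have Wd: "(W has_real_derivative V x) (at x within {0..l})" if "x \<in> {0..l}" for x
    using ac_derivative[OF W cV that] .
  have J: "ac l (\<lambda>x. \<epsilon> * V x + (-\<mu>) * W x) (\<lambda>x. \<epsilon> * G x + (-\<mu>) * V x)" by (rule ac_lincomb[OF V W])
  have \<phi>: "((\<lambda>x. ssgn d (W x)) has_real_derivative p (W x) * V x) (at x within {0..l})" if "x \<in> {0..l}" for x
    unfolding p_def s_def by (rule DERIV_chain2[OF ssgn_deriv[OF d] Wd[OF that]])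
  have 1: "(LINT x:{0..l}|lborel. (\<epsilon> * G x + (-\<mu>) * V x) * ssgn d (W x))
    = (\<epsilon> * V l + (-\<mu>) * W l) * ssgn d (W l) - (\<epsilon> * V 0 + (-\<mu>) * W 0) * ssgn d (W 0)
     - (LINT x:{0..l}|lborel. (\<epsilon> * V x + (-\<mu>) * W x) * (p (W x) * V x))"
    by (intro ac_by_parts J l \<phi> continuous_intros pc cV)
  \<comment> \<open>A primitive of \<open>w * p w\<close>, chosen to tend to 0 at infinity. Since
    \<open>s w\<close> is at least \<open>d\<close>, its size is at most \<open>d\<close>, uniformly
    in \<open>w\<close>.\<close>
  define \<Psi> where "\<Psi> w = - d\<^sup>2 / s w" for w
  have \<Psi>: "(\<Psi> has_real_derivative w * p w) (at w)" for w
  proof -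
    have "(\<Psi> has_real_derivative d\<^sup>2 * (2 * w * (inverse (s w) / 2)) / (s w * s w)) (at w)"
      using s[of w] unfolding \<Psi>_def s_def by (auto intro!: derivative_eq_intros simp: power2_eq_square)
    moreover have "d\<^sup>2 * (2 * w * (inverse (s w) / 2)) / (s w * s w) = w * p w"
      using s[of w] by (simp add: p_def field_simps power3_eq_cube)
    ultimately show ?thesis by simp
  qed
  have \<Psi>b: "- d \<le> \<Psi> w" "\<Psi> w \<le> 0" for w
  proof -
    show "\<Psi> w \<le> 0" using s[of w] by (simp add: \<Psi>_def)
    have "d * d \<le> d * s w" using s'[of w] d by (intro mult_left_mono) auto
    then show "- d \<le> \<Psi> w" using s[of w] by (simp add: \<Psi>_def field_simps power2_eq_square)
  qed
  have "ac l (\<lambda>x. \<Psi> (W x)) (\<lambda>x. W x * p (W x) * V x)"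
    by (intro acI_derivative DERIV_chain2[OF \<Psi> Wd] continuous_intros pc cW cV)
  then have 2: "(LINT x:{0..l}|lborel. W x * p (W x) * V x) = \<Psi> (W l) - \<Psi> (W 0)"
    using l by (intro ac_integral) auto
  have i: "set_integrable lborel {0..l} (\<lambda>x. W x * p (W x) * V x)"
    "set_integrable lborel {0..l} (\<lambda>x. p (W x) * (V x)\<^sup>2)"
    by (intro borel_integrable_atLeastAtMost' continuous_intros pc cW cV)+
  have "(LINT x:{0..l}|lborel. (\<epsilon> * V x + (-\<mu>) * W x) * (p (W x) * V x))
    = (LINT x:{0..l}|lborel. \<epsilon> * (p (W x) * (V x)\<^sup>2) - \<mu> * (W x * p (W x) * V x))"
    by (intro set_lebesgue_integral_cong) (auto simp: algebra_simps power2_eq_square)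
  also have "\<dots> = \<epsilon> * (LINT x:{0..l}|lborel. p (W x) * (V x)\<^sup>2) - \<mu> * (\<Psi> (W l) - \<Psi> (W 0))"
    unfolding 2[symmetric] using i by (subst set_integral_diff) auto
  also have "\<dots> \<ge> 0 - \<mu> * (0 - - d)"
  proof (intro diff_mono mult_left_mono)
    have "0 \<le> (LINT x:{0..l}|lborel. p (W x) * (V x)\<^sup>2)"
      unfolding set_lebesgue_integral_def using s by (intro integral_nonneg_AE AE_I2) (auto simp: p_def less_imp_le)
    then show "0 \<le> \<epsilon> * (LINT x:{0..l}|lborel. p (W x) * (V x)\<^sup>2)" using pos by simp
  qed (use \<Psi>b pos in auto)
  finally show ?thesis using 1 by simp
qed

lemma abs_set_integral_le: "\<bar>LINT x:A|M. f x\<bar> \<le> (LINT x:A|M. \<bar>f x\<bar>)" for f :: "'a \<Rightarrow> real"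
  unfolding set_lebesgue_integral_def
  using integral_abs_bound[of M "\<lambda>x. indicator A x *\<^sub>R f x"] by (simp add: abs_mult)

subsection \<open>The graph norm controls the Sobolev norm\<close>

lemma set_integral_const_Icc: "0 \<le> l \<Longrightarrow> (LINT x:{0..l}|lborel. c) = l * c" for c :: real
  by (simp add: set_lebesgue_integral_def)

text \<open>The flux \<open>J = \<epsilon> V - \<mu> W\<close> varies by at most the norm of its derivative, and testing it with
  \<open>\<psi> = x (l - x)\<close> bounds \<open>J 0\<close> without boundary terms.\<close>

lemma arc_first_derivative_bound:
  assumes l: "0 < l" and pos: "0 < \<epsilon>" "0 < \<mu>"
  shows "\<exists>C\<ge>0. \<forall>W V G. ac l W V \<longrightarrow> ac l V G \<longrightarrow> (LINT x:{0..l}|lborel. \<bar>V x\<bar>)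
     \<le> C * ((LINT x:{0..l}|lborel. \<bar>W x\<bar>) + (LINT x:{0..l}|lborel. \<bar>\<epsilon> * G x - \<mu> * V x\<bar>))"
proof -
  \<comment> \<open>The factor \<open>6 / l ^ 3\<close> is the inverse of the integral of the test
    function; the summand 1 makes \<open>c\<close> at least 1, so that it also dominates the
    coefficient of the norm of the derivative of the flux.\<close>
  define c where "c = (\<epsilon> * l + \<mu> * l\<^sup>2) * 6 / l ^ 3 + 1"
  define C where "C = (l * (c + 1) + \<mu>) / \<epsilon>"
  have c: "c \<ge> 0" using l pos by (simp add: c_def)
  have C: "C \<ge> 0" using l pos c by (simp add: C_def)
  have "(LINT x:{0..l}|lborel. \<bar>V x\<bar>)
     \<le> C * ((LINT x:{0..l}|lborel. \<bar>W x\<bar>) + (LINT x:{0..l}|lborel. \<bar>\<epsilon> * G x - \<mu> * V x\<bar>))" 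
    if W: "ac l W V" and V: "ac l V G" for W V G
  proof -
    define nW where "nW = (LINT x:{0..l}|lborel. \<bar>W x\<bar>)"
    define ng where "ng = (LINT x:{0..l}|lborel. \<bar>\<epsilon> * G x - \<mu> * V x\<bar>)"
    have n0: "nW \<ge> 0" "ng \<ge> 0"
      unfolding nW_def ng_def set_lebesgue_integral_def by (auto intro!: integral_nonneg_AE)
    define J where "J x = \<epsilon> * V x + (-\<mu>) * W x" for x
    have J: "ac l J (\<lambda>x. \<epsilon> * G x + (-\<mu>) * V x)" unfolding J_def by (rule ac_lincomb[OF V W])
    note cW = ac_continuous[OF W] and cV = ac_continuous[OF V] and cJ = ac_continuous[OF J]
    have osc: "\<bar>J x - J 0\<bar> \<le> ng" if x: "x \<in> {0..l}" for x
    proof -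
      have g: "set_integrable lborel {0..l} (\<lambda>y. \<bar>\<epsilon> * G y + (-\<mu>) * V y\<bar>)"
        using ac_integrable[OF J] by (rule set_integrable_abs)
      have "\<bar>J x - J 0\<bar> = \<bar>LINT y:{0..x}|lborel. \<epsilon> * G y + (-\<mu>) * V y\<bar>"
        using ac_integral[OF J x] by simp
      also have "\<dots> \<le> (LINT y:{0..x}|lborel. \<bar>\<epsilon> * G y + (-\<mu>) * V y\<bar>)"
        by (rule abs_set_integral_le)
      also have "\<dots> \<le> (LINT y:{0..l}|lborel. \<bar>\<epsilon> * G y + (-\<mu>) * V y\<bar>)"
      proof -
        have "set_integrable lborel {0..x} (\<lambda>y. \<bar>\<epsilon> * G y + (-\<mu>) * V y\<bar>)"
          by (rule set_integrable_subset[OF g]) (use x in auto)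
        then show ?thesis
          using g x unfolding set_lebesgue_integral_def set_integrable_def
          by (intro integral_mono) (auto simp: indicator_def)
      qed
      finally show ?thesis by (simp add: ng_def)
    qed
    define \<psi> where "\<psi> x = x * (l - x)" for x
    have \<psi>b: "0 \<le> \<psi> x" "\<psi> x \<le> l\<^sup>2" "\<bar>l - 2 * x\<bar> \<le> l" if "x \<in> {0..l}" for x
      using that l by (auto simp: \<psi>_def power2_eq_square intro!: mult_mono)
    have \<psi>i: "(LINT x:{0..l}|lborel. \<psi> x) = l ^ 3 / 6"
    proof -
      have "ac l (\<lambda>x. l * x\<^sup>2 / 2 - x ^ 3 / 3) \<psi>"
        by (rule acI_derivative) (auto simp: \<psi>_def power2_eq_square algebra_simps intro!: derivative_eq_intros continuous_intros)
      from ac_integral[OF this, of l] l show ?thesis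
        by (simp add: power2_eq_square power3_eq_cube)
    qed
    have \<psi>c: "continuous_on {0..l} \<psi>" unfolding \<psi>_def by (intro continuous_intros)
    have ci: "set_integrable lborel {0..l} f" if "continuous_on {0..l} f" for f :: "real \<Rightarrow> real"
      using that by (rule borel_integrable_atLeastAtMost')
    have "(LINT x:{0..l}|lborel. V x * \<psi> x) = W l * \<psi> l - W 0 * \<psi> 0 - (LINT x:{0..l}|lborel. W x * (l - 2 * x))"
      using l by (intro ac_by_parts W) (auto simp: \<psi>_def intro!: derivative_eq_intros continuous_intros)
    then have VW: "(LINT x:{0..l}|lborel. V x * \<psi> x) = - (LINT x:{0..l}|lborel. W x * (l - 2 * x))"
      by (simp add: \<psi>_def)
    have "(LINT x:{0..l}|lborel. J 0 * \<psi> x) = (LINT x:{0..l}|lborel. \<epsilon> * (V x * \<psi> x) - \<mu> * (W x * \<psi> x) - (J x - J 0) * \<psi> x)"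
      by (intro set_lebesgue_integral_cong) (auto simp: J_def algebra_simps)
    also have "\<dots> = \<epsilon> * (LINT x:{0..l}|lborel. V x * \<psi> x) - \<mu> * (LINT x:{0..l}|lborel. W x * \<psi> x)
        - (LINT x:{0..l}|lborel. (J x - J 0) * \<psi> x)"
      by (subst set_integral_diff, intro ci continuous_intros cV cW cJ \<psi>c, intro ci continuous_intros cV cW cJ \<psi>c,
          subst set_integral_diff) (auto intro!: ci continuous_intros cV cW cJ \<psi>c)
    finally have J0eq: "J 0 * (l ^ 3 / 6) = - \<epsilon> * (LINT x:{0..l}|lborel. W x * (l - 2 * x))
        - \<mu> * (LINT x:{0..l}|lborel. W x * \<psi> x) - (LINT x:{0..l}|lborel. (J x - J 0) * \<psi> x)"
      unfolding VW by (simp add: \<psi>i)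
    have bnd: "\<bar>LINT x:{0..l}|lborel. f x\<bar> \<le> (LINT x:{0..l}|lborel. k x)"
      if "continuous_on {0..l} f" "continuous_on {0..l} k" "\<And>x. x \<in> {0..l} \<Longrightarrow> \<bar>f x\<bar> \<le> k x" for f k :: "real \<Rightarrow> real"
    proof -
      have "\<bar>LINT x:{0..l}|lborel. f x\<bar> \<le> (LINT x:{0..l}|lborel. \<bar>f x\<bar>)"
        by (rule abs_set_integral_le)
      also have "\<dots> \<le> (LINT x:{0..l}|lborel. k x)"
        using that by (intro set_integral_mono ci continuous_intros) auto
      finally show ?thesis .
    qed
    have "\<bar>LINT x:{0..l}|lborel. W x * (l - 2 * x)\<bar> \<le> (LINT x:{0..l}|lborel. l * \<bar>W x\<bar>)"
    proof (rule bnd)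
      fix x assume "x \<in> {0..l}"
      from mult_left_mono[OF \<psi>b(3)[OF this] abs_ge_zero[of "W x"]]
      show "\<bar>W x * (l - 2 * x)\<bar> \<le> l * \<bar>W x\<bar>" by (simp add: abs_mult mult.commute)
    qed (intro continuous_intros cW)+
    moreover have "\<bar>LINT x:{0..l}|lborel. W x * \<psi> x\<bar> \<le> (LINT x:{0..l}|lborel. l\<^sup>2 * \<bar>W x\<bar>)"
    proof (rule bnd)
      fix x assume x: "x \<in> {0..l}"
      from mult_left_mono[OF \<psi>b(2)[OF x] abs_ge_zero[of "W x"]] \<psi>b(1)[OF x]
      show "\<bar>W x * \<psi> x\<bar> \<le> l\<^sup>2 * \<bar>W x\<bar>" by (simp add: abs_mult mult.commute)
    qed (intro continuous_intros cW \<psi>c)+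
    moreover have "\<bar>LINT x:{0..l}|lborel. (J x - J 0) * \<psi> x\<bar> \<le> (LINT x:{0..l}|lborel. ng * \<psi> x)"
    proof (rule bnd)
      fix x assume x: "x \<in> {0..l}"
      from mult_right_mono[OF osc[OF x] \<psi>b(1)[OF x]] \<psi>b(1)[OF x]
      show "\<bar>(J x - J 0) * \<psi> x\<bar> \<le> ng * \<psi> x" by (simp add: abs_mult)
    qed (intro continuous_intros cJ \<psi>c)+
    ultimately have "\<bar>LINT x:{0..l}|lborel. W x * (l - 2 * x)\<bar> \<le> l * nW"
      "\<bar>LINT x:{0..l}|lborel. W x * \<psi> x\<bar> \<le> l\<^sup>2 * nW"
      "\<bar>LINT x:{0..l}|lborel. (J x - J 0) * \<psi> x\<bar> \<le> ng * (l ^ 3 / 6)"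
      by (simp_all add: nW_def \<psi>i)
    then have "\<epsilon> * \<bar>LINT x:{0..l}|lborel. W x * (l - 2 * x)\<bar> \<le> \<epsilon> * (l * nW)"
      "\<mu> * \<bar>LINT x:{0..l}|lborel. W x * \<psi> x\<bar> \<le> \<mu> * (l\<^sup>2 * nW)"
      "\<bar>LINT x:{0..l}|lborel. (J x - J 0) * \<psi> x\<bar> \<le> ng * (l ^ 3 / 6)"
      using pos by (auto intro: mult_left_mono)
    moreover have "\<bar>- \<epsilon> * a - \<mu> * b - e\<bar> \<le> \<epsilon> * \<bar>a\<bar> + \<mu> * \<bar>b\<bar> + \<bar>e\<bar>" for a b e
      using pos abs_mult[of \<epsilon> a] abs_mult[of \<mu> b] by simp
    ultimately have "\<bar>J 0 * (l ^ 3 / 6)\<bar> \<le> \<epsilon> * (l * nW) + \<mu> * (l\<^sup>2 * nW) + ng * (l ^ 3 / 6)"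
      unfolding J0eq by (meson add_mono order_trans)
    then have "\<bar>J 0\<bar> * (l ^ 3 / 6) \<le> (\<epsilon> * l + \<mu> * l\<^sup>2) * nW + ng * (l ^ 3 / 6)"
      using l by (simp add: abs_mult algebra_simps)
    then have "\<bar>J 0\<bar> \<le> (c - 1) * nW + ng"
      using l by (simp add: c_def field_simps)
    then have J0': "\<bar>J 0\<bar> \<le> c * (nW + ng)"
    proof -
      have "1 \<le> c" using l pos by (simp add: c_def)
      then have "(c - 1) * nW \<le> c * nW" "1 * ng \<le> c * ng" using n0 by (intro mult_right_mono; simp)+
      then have "(c - 1) * nW + ng \<le> c * nW + c * ng" by simp
      then show ?thesis using \<open>\<bar>J 0\<bar> \<le> (c - 1) * nW + ng\<close> by (simp add: distrib_left)
    qed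
    have "(LINT x:{0..l}|lborel. \<bar>V x\<bar>) \<le> (LINT x:{0..l}|lborel. ((\<bar>J 0\<bar> + ng) + \<mu> * \<bar>W x\<bar>) / \<epsilon>)"
    proof (rule set_integral_mono)
      fix x assume x: "x \<in> {0..l}"
      have "\<epsilon> * V x = J x + \<mu> * W x" by (simp add: J_def)
      then have "\<epsilon> * \<bar>V x\<bar> = \<bar>J x + \<mu> * W x\<bar>" using pos by (metis abs_mult abs_of_pos)
      also have "\<dots> \<le> (\<bar>J 0\<bar> + ng) + \<mu> * \<bar>W x\<bar>"
        using osc[OF x] pos abs_triangle_ineq[of "J x" "\<mu> * W x"] by (simp add: abs_mult)
      finally show "\<bar>V x\<bar> \<le> ((\<bar>J 0\<bar> + ng) + \<mu> * \<bar>W x\<bar>) / \<epsilon>" using pos by (simp add: field_simps)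
    next
      show "set_integrable lborel {0..l} (\<lambda>x. \<bar>V x\<bar>)" by (intro ci continuous_intros cV)
      show "set_integrable lborel {0..l} (\<lambda>x. ((\<bar>J 0\<bar> + ng) + \<mu> * \<bar>W x\<bar>) / \<epsilon>)"
        using pos(1) by (intro ci continuous_intros cW) auto
    qed
    also have "\<dots> = (LINT x:{0..l}|lborel. (\<bar>J 0\<bar> + ng) / \<epsilon>) + (LINT x:{0..l}|lborel. (\<mu> / \<epsilon>) * \<bar>W x\<bar>)"
      by (subst set_integral_add(2)[symmetric]) (use pos(1) in \<open>auto simp: add_divide_distrib intro!: ci continuous_intros cW\<close>)
    also have "\<dots> = (l * (\<bar>J 0\<bar> + ng) + \<mu> * nW) / \<epsilon>"
      using l by (simp add: nW_def set_integral_const_Icc add_divide_distrib distrib_left)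
    also have "\<dots> \<le> (l * (c * (nW + ng) + (nW + ng)) + \<mu> * (nW + ng)) / \<epsilon>"
      using J0' n0 l pos by (intro divide_right_mono add_mono mult_left_mono) auto
    also have "\<dots> = C * (nW + ng)" by (simp add: C_def algebra_simps)
    finally show ?thesis by (simp add: nW_def ng_def)
  qed
  then show ?thesis using C by blast
qed

subsection \<open>Density\<close>

text \<open>Functions that vanish to first order at both end points satisfy all node conditions, whatever
  \<open>K\<close> is, so they lie in the domain of \<open>A\<^sub>0\<^sup>\<epsilon>\<close>.\<close>

definition flat_approx :: "real \<Rightarrow> (real \<Rightarrow> real) \<Rightarrow> bool" where
  "flat_approx l f \<longleftrightarrow> set_integrable lborel {0..l} f \<and> (\<forall>e>0. \<exists>w v g. ac l w v \<and> ac l v g \<and>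
     w 0 = 0 \<and> w l = 0 \<and> v 0 = 0 \<and> v l = 0 \<and> (LINT x:{0..l}|lborel. \<bar>f x - w x\<bar>) < e)"

lemma flat_approx_closed:
  assumes f: "set_integrable lborel {0..l} f"
    and ap: "\<And>e. 0 < e \<Longrightarrow> \<exists>k. flat_approx l k \<and> (LINT x:{0..l}|lborel. \<bar>f x - k x\<bar>) < e"
  shows "flat_approx l f"
  unfolding flat_approx_def
proof (intro conjI allI impI f)
  fix e :: real assume "0 < e"
  then obtain k where k: "flat_approx l k" "(LINT x:{0..l}|lborel. \<bar>f x - k x\<bar>) < e / 2"
    using ap[of "e / 2"] by auto
  obtain w v g where w: "ac l w v" "ac l v g" "w 0 = 0" "w l = 0" "v 0 = 0" "v l = 0"
    "(LINT x:{0..l}|lborel. \<bar>k x - w x\<bar>) < e / 2"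
    using k(1) \<open>0 < e\<close> unfolding flat_approx_def by (meson half_gt_zero)
  have ki: "set_integrable lborel {0..l} k" using k(1) by (simp add: flat_approx_def)
  note i = set_integrable_abs[OF set_integral_diff(1)[OF f ki]]
    set_integrable_abs[OF set_integral_diff(1)[OF ki ac_set_integrable[OF w(1)]]]
    set_integrable_abs[OF set_integral_diff(1)[OF f ac_set_integrable[OF w(1)]]]
  have "(LINT x:{0..l}|lborel. \<bar>f x - w x\<bar>) \<le> (LINT x:{0..l}|lborel. \<bar>f x - k x\<bar> + \<bar>k x - w x\<bar>)"
    by (intro set_integral_mono set_integral_add(1) i) auto
  also have "\<dots> = (LINT x:{0..l}|lborel. \<bar>f x - k x\<bar>) + (LINT x:{0..l}|lborel. \<bar>k x - w x\<bar>)"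
    by (intro set_integral_add(2) i)
  also have "\<dots> < e" using k(2) w(7) by simp
  finally show "\<exists>w v g. ac l w v \<and> ac l v g \<and>
     w 0 = 0 \<and> w l = 0 \<and> v 0 = 0 \<and> v l = 0 \<and> (LINT x:{0..l}|lborel. \<bar>f x - w x\<bar>) < e"
    using w by blast
qed

text \<open>Dominated convergence turns the pointwise limit into a limit in L^1, to which
  \<open>flat_approx_closed\<close> applies.\<close>

lemma flat_approx_limit:
  assumes k: "\<And>n. flat_approx l (k n)"
    and lim: "AE x in lborel. x \<in> {0..l} \<longrightarrow> (\<lambda>n. k n x) \<longlonglongrightarrow> f x"
    and f: "set_integrable lborel {0..l} f" and d: "set_integrable lborel {0..l} d"
    and bound: "\<And>n. AE x in lborel. x \<in> {0..l} \<longrightarrow> \<bar>k n x\<bar> \<le> d x"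
  shows "flat_approx l f"
proof (rule flat_approx_closed[OF f])
  fix e :: real assume e: "0 < e"
  have ki: "set_integrable lborel {0..l} (k n)" for n using k by (simp add: flat_approx_def)
  have "(\<lambda>n. LINT x|lborel. indicator {0..l} x *\<^sub>R \<bar>f x - k n x\<bar>) \<longlonglongrightarrow> (LINT x|(lborel :: real measure). 0)"
  proof (rule integral_dominated_convergence)
    show "integrable lborel (\<lambda>x. indicator {0..l} x *\<^sub>R (\<bar>f x\<bar> + d x))"
      using set_integral_add(1)[OF set_integrable_abs[OF f] d] by (simp add: set_integrable_def)
    show "(\<lambda>x. indicator {0..l} x *\<^sub>R \<bar>f x - k n x\<bar>) \<in> borel_measurable lborel" for n
      using set_integrable_abs[OF set_integral_diff(1)[OF f ki[of n]]] unfolding set_integrable_def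
      by (rule borel_measurable_integrable)
    show "AE x in lborel. (\<lambda>n. indicator {0..l} x *\<^sub>R \<bar>f x - k n x\<bar>) \<longlonglongrightarrow> 0"
      using lim
    proof eventually_elim
      case (elim x)
      show ?case
      proof (cases "x \<in> {0..l}")
        case True
        with elim have "(\<lambda>n. indicator {0..l} x *\<^sub>R \<bar>f x - k n x\<bar>) \<longlonglongrightarrow> indicator {0..l} x *\<^sub>R \<bar>f x - f x\<bar>"
          by (intro tendsto_intros) auto
        then show ?thesis by simp
      qed simp
    qed
    show "AE x in lborel. norm (indicator {0..l} x *\<^sub>R \<bar>f x - k n x\<bar>) \<le> indicator {0..l} x *\<^sub>R (\<bar>f x\<bar> + d x)" for n
      using bound[of n] by eventually_elim (auto simp: indicator_def)
  qed simp
  then have "(\<lambda>n. LINT x:{0..l}|lborel. \<bar>f x - k n x\<bar>) \<longlonglongrightarrow> 0" by (simp add: set_lebesgue_integral_def)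
  then have "\<forall>\<^sub>F n in sequentially. (LINT x:{0..l}|lborel. \<bar>f x - k n x\<bar>) < e"
    using e by (rule order_tendstoD)
  then obtain n where "(LINT x:{0..l}|lborel. \<bar>f x - k n x\<bar>) < e" using eventually_happens' by force
  then show "\<exists>k. flat_approx l k \<and> (LINT x:{0..l}|lborel. \<bar>f x - k x\<bar>) < e" using k by blast
qed

lemma flat_approx_lincomb:
  assumes "flat_approx l f" "flat_approx l k"
  shows "flat_approx l (\<lambda>x. a * f x + b * k x)"
  unfolding flat_approx_def
proof (intro conjI allI impI)
  have i: "set_integrable lborel {0..l} f" "set_integrable lborel {0..l} k"
    using assms by (auto simp: flat_approx_def)
  then show fk: "set_integrable lborel {0..l} (\<lambda>x. a * f x + b * k x)" by (intro set_integral_add) auto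
  fix e :: real assume e: "0 < e"
  define d where "d = e / (\<bar>a\<bar> + \<bar>b\<bar> + 1)"
  have d: "0 < d" "(\<bar>a\<bar> + \<bar>b\<bar> + 1) * d = e" using e by (auto simp: d_def add_nonneg_pos)
  obtain w v g where w: "ac l w v" "ac l v g" "w 0 = 0" "w l = 0" "v 0 = 0" "v l = 0"
    "(LINT x:{0..l}|lborel. \<bar>f x - w x\<bar>) < d"
    using assms(1) d unfolding flat_approx_def by meson
  obtain w' v' g' where w': "ac l w' v'" "ac l v' g'" "w' 0 = 0" "w' l = 0" "v' 0 = 0" "v' l = 0"
    "(LINT x:{0..l}|lborel. \<bar>k x - w' x\<bar>) < d"
    using assms(2) d unfolding flat_approx_def by meson
  note j = set_integrable_abs[OF set_integral_diff(1)[OF i(1) ac_set_integrable[OF w(1)]]]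
    set_integrable_abs[OF set_integral_diff(1)[OF i(2) ac_set_integrable[OF w'(1)]]]
  note W = ac_lincomb[OF w(1) w'(1), of a b]
  have "(LINT x:{0..l}|lborel. \<bar>(a * f x + b * k x) - (a * w x + b * w' x)\<bar>)
      \<le> (LINT x:{0..l}|lborel. \<bar>a\<bar> * \<bar>f x - w x\<bar> + \<bar>b\<bar> * \<bar>k x - w' x\<bar>)"
  proof (intro set_integral_mono set_integral_add(1) set_integrable_abs set_integral_diff(1) fk ac_set_integrable[OF W])
    fix x
    have "(a * f x + b * k x) - (a * w x + b * w' x) = a * (f x - w x) + b * (k x - w' x)" by (simp add: algebra_simps)
    then show "\<bar>(a * f x + b * k x) - (a * w x + b * w' x)\<bar> \<le> \<bar>a\<bar> * \<bar>f x - w x\<bar> + \<bar>b\<bar> * \<bar>k x - w' x\<bar>"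
      using abs_triangle_ineq[of "a * (f x - w x)" "b * (k x - w' x)"] by (simp add: abs_mult)
  qed (use i j ac_set_integrable[OF w(1)] ac_set_integrable[OF w'(1)] in auto)
  also have "\<dots> = \<bar>a\<bar> * (LINT x:{0..l}|lborel. \<bar>f x - w x\<bar>) + \<bar>b\<bar> * (LINT x:{0..l}|lborel. \<bar>k x - w' x\<bar>)"
    using j by (subst set_integral_add(2)) auto
  also have "\<dots> \<le> \<bar>a\<bar> * d + \<bar>b\<bar> * d" using w(7) w'(7) by (intro add_mono mult_left_mono) auto
  also have "\<dots> < e" unfolding d(2)[symmetric] using d(1) by (simp add: algebra_simps)
  finally show "\<exists>w v g. ac l w v \<and> ac l v g \<and> w 0 = 0 \<and> w l = 0 \<and> v 0 = 0 \<and> v l = 0 \<and>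
     (LINT x:{0..l}|lborel. \<bar>a * f x + b * k x - w x\<bar>) < e"
    using w w' W ac_lincomb[OF w(2) w'(2), of a b]
    by (intro exI[of _ "\<lambda>x. a * w x + b * w' x"] exI[of _ "\<lambda>x. a * v x + b * v' x"]
      exI[of _ "\<lambda>x. a * g x + b * g' x"]) simp
qed

lemma flat_approx_cong:
  assumes "flat_approx l f" "\<And>x. x \<in> {0..l} \<Longrightarrow> f x = k x"
  shows "flat_approx l k"
proof -
  have f: "set_integrable lborel {0..l} f" using assms(1) by (simp add: flat_approx_def)
  have "(\<lambda>x. indicator {0..l} x *\<^sub>R f x) = (\<lambda>x. indicator {0..l} x *\<^sub>R k x)"
    using assms(2) by (auto simp: indicator_def)
  then have k: "set_integrable lborel {0..l} k" using f by (simp add: set_integrable_def)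
  show ?thesis
    by (rule flat_approx_limit[OF assms(1) _ k set_integrable_abs[OF f]])
      (auto simp: assms(2))
qed

lemma set_integrable_indicator_Icc:
  fixes A :: "real set"
  assumes "A \<in> sets borel"
  shows "set_integrable lborel {a..b} (indicat_real A)"
proof -
  have "emeasure lborel ({a..b} \<inter> A) \<le> emeasure lborel {a..b}" by (intro emeasure_mono) auto
  also have "\<dots> < \<infinity>" by (simp add: emeasure_lborel_Icc_eq)
  finally have "integrable lborel (indicat_real ({a..b} \<inter> A))"
    using assms by (intro integrable_real_indicator) auto
  moreover have "(\<lambda>x. indicator {a..b} x *\<^sub>R indicat_real A x) = indicat_real ({a..b} \<inter> A)"
    by (auto simp: indicator_def)
  ultimately show ?thesis by (simp add: set_integrable_def)
qed

text \<open>\<open>S n\<close> is a smooth step that tends to the indicator away from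
  \<open>a\<close>; \<open>B n\<close> tends to 1 inside the arc but is 0 at both ends. The
  approximation is \<open>S n\<close> times the square of \<open>B n\<close>, so that its derivative
  vanishes at the ends too. \<open>S1\<close>, \<open>S2\<close>, \<open>B1\<close>,
  \<open>B2\<close> are the successive derivatives of the factors.\<close>

lemma flat_approx_atMost:
  assumes l: "0 < l"
  shows "flat_approx l (indicator {..a})"
proof (rule flat_approx_limit)
  define B where "B n x = 1 - exp (- real n * (x * (l - x)))" for n x
  define B1 where "B1 n x = real n * (l - 2 * x) * exp (- real n * (x * (l - x)))" for n x
  define B2 where "B2 n x = (- 2 * real n - (real n * (l - 2 * x))\<^sup>2) * exp (- real n * (x * (l - x)))" for n x
  define S where "S n x = 1 / 2 - arctan (real n * (x - a)) / pi" for n x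
  define S1 where "S1 n x = - real n / pi * inverse (1 + (real n * (x - a))\<^sup>2)" for n x
  define S2 where "S2 n x = - real n / pi * - (2 * (real n * (x - a)) * real n * inverse ((1 + (real n * (x - a))\<^sup>2) ^ Suc (Suc 0)))" for n x
  have pos: "1 + (real n * (x - a))\<^sup>2 \<noteq> 0" for n x by (smt (verit) zero_le_power2)
  have dB: "(B n has_real_derivative B1 n x) (at x)" "(B1 n has_real_derivative B2 n x) (at x)" for n x
    unfolding B_def B1_def B2_def
    by (auto intro!: derivative_eq_intros simp: power2_eq_square algebra_simps)
  have dS: "(S n has_real_derivative S1 n x) (at x)" for n x
  proof -
    have "(S n has_real_derivative 0 - inverse (1 + (real n * (x - a))\<^sup>2) * (real n * 1) / pi) (at x)"
      unfolding S_def by (auto intro!: derivative_eq_intros)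
    then show ?thesis by (simp add: S1_def divide_inverse mult_ac)
  qed
  have dS1: "(S1 n has_real_derivative S2 n x) (at x)" for n x
    unfolding S1_def S2_def
  proof (intro DERIV_cmult DERIV_inverse_fun pos)
    show "((\<lambda>x. 1 + (real n * (x - a))\<^sup>2) has_real_derivative 2 * (real n * (x - a)) * real n) (at x)"
      by (auto intro!: derivative_eq_intros)
  qed
  define w where "w n x = S n x * (B n x * B n x)" for n x
  define v where "v n x = S1 n x * (B n x * B n x) + S n x * (2 * B n x * B1 n x)" for n x
  define g where "g n x = S2 n x * (B n x * B n x) + 2 * S1 n x * (2 * B n x * B1 n x)
     + S n x * (2 * B1 n x * B1 n x + 2 * B n x * B2 n x)" for n x
  note d = dB dS dS1
  have dw: "(w n has_real_derivative v n x) (at x)" for n x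
    unfolding w_def v_def by (auto intro!: derivative_eq_intros d simp: algebra_simps)
  have dv: "(v n has_real_derivative g n x) (at x)" for n x
    unfolding v_def g_def by (auto intro!: derivative_eq_intros d simp: algebra_simps)
  have S2c: "continuous_on UNIV (S2 n)" for n
    unfolding S2_def using pos by (intro continuous_intros) (auto simp del: power_Suc)
  have c: "continuous_on UNIV (B n)" "continuous_on UNIV (B1 n)" "continuous_on UNIV (S n)" "continuous_on UNIV (S1 n)"
     "continuous_on UNIV (v n)" "continuous_on UNIV (w n)" for n
    using dB dS dS1 dv dw by (auto intro!: DERIV_continuous_on)
  have B2c: "continuous_on UNIV (B2 n)" for n unfolding B2_def by (intro continuous_intros)
  have gc: "continuous_on UNIV (g n)" for n unfolding g_def by (intro continuous_intros c B2c S2c)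
  have ac1: "ac l (w n) (v n)" for n
    by (rule acI_derivative[OF has_field_derivative_at_within[OF dw] continuous_on_subset[OF c(5)]]) simp
  have ac2: "ac l (v n) (g n)" for n
    by (rule acI_derivative[OF has_field_derivative_at_within[OF dv] continuous_on_subset[OF gc]]) simp
  have bd: "w n 0 = 0" "w n l = 0" "v n 0 = 0" "v n l = 0" for n
    by (simp_all add: w_def v_def B_def)
  show "flat_approx l (w n)" for n
    unfolding flat_approx_def
  proof (intro conjI allI impI ac_set_integrable[OF ac1])
    fix e :: real assume "0 < e"
    then have "(LINT x:{0..l}|lborel. \<bar>w n x - w n x\<bar>) < e" by simp
    with ac1[of n] ac2[of n] bd[of n]
    show "\<exists>u v g. ac l u v \<and> ac l v g \<and> u 0 = 0 \<and> u l = 0 \<and> v 0 = 0 \<and> v l = 0 \<and>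
        (LINT x:{0..l}|lborel. \<bar>w n x - u x\<bar>) < e" by blast
  qed
  show "set_integrable lborel {0..l} (\<lambda>x. 1 :: real)"
    by (intro borel_integrable_atLeastAtMost' continuous_intros)
  show "set_integrable lborel {0..l} (indicat_real {..a})"
    by (rule set_integrable_indicator_Icc) simp
  have B01: "0 \<le> B n x" "B n x \<le> 1" if "x \<in> {0..l}" for n x
    using that by (auto simp: B_def)
  have S01: "0 \<le> S n x" "S n x \<le> 1" for n x
    using arctan_lbound[of "real n * (x - a)"] arctan_ubound[of "real n * (x - a)"] 
    by (auto simp: S_def field_simps)
  show "AE x in lborel. x \<in> {0..l} \<longrightarrow> \<bar>w n x\<bar> \<le> 1" for n
  proof (intro AE_I2 impI)
    fix x assume x: "x \<in> {0..l}"
    have "S n x * (B n x * B n x) \<le> 1 * (1 * 1)" using B01[OF x] S01 by (intro mult_mono) auto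
    moreover have "0 \<le> S n x * (B n x * B n x)" using B01[OF x] S01 by (intro mult_nonneg_nonneg)
    ultimately show "\<bar>w n x\<bar> \<le> 1" by (simp add: w_def)
  qed
  have "AE x in lborel. x \<noteq> 0 \<and> x \<noteq> l \<and> x \<noteq> a"
    using AE_lborel_singleton[of 0] AE_lborel_singleton[of l] AE_lborel_singleton[of a] by eventually_elim auto
  then show "AE x in lborel. x \<in> {0..l} \<longrightarrow> (\<lambda>n. w n x) \<longlonglongrightarrow> indicator {..a} x"
  proof eventually_elim
    case (elim x)
    show ?case
    proof
      assume x: "x \<in> {0..l}"
      have u: "0 < x * (l - x)" using x elim by auto
      have "filterlim (\<lambda>n. - (x * (l - x)) * real n) at_bot sequentially"
        by (rule filterlim_tendsto_neg_mult_at_bot[OF tendsto_const _ filterlim_real_sequentially]) (use u in auto)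
      then have "(\<lambda>n. exp (- (x * (l - x)) * real n)) \<longlonglongrightarrow> 0"
        by (rule filterlim_compose[OF exp_at_bot])
      then have "(\<lambda>n. 1 - exp (- (x * (l - x)) * real n)) \<longlonglongrightarrow> 1 - 0"
        by (intro tendsto_intros)
      then have B: "(\<lambda>n. B n x) \<longlonglongrightarrow> 1" by (simp add: B_def mult.commute)
      have S: "(\<lambda>n. S n x) \<longlonglongrightarrow> indicator {..a} x"
      proof (cases "x < a")
        case True
        have "filterlim (\<lambda>n. (x - a) * real n) at_bot sequentially"
          by (rule filterlim_tendsto_neg_mult_at_bot[OF tendsto_const _ filterlim_real_sequentially]) (use True in auto)
        then have "(\<lambda>n. arctan ((x - a) * real n)) \<longlonglongrightarrow> - (pi / 2)"
          by (rule filterlim_compose[OF tendsto_arctan_at_bot])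
        then have "(\<lambda>n. 1 / 2 - arctan ((x - a) * real n) / pi) \<longlonglongrightarrow> 1 / 2 - (- (pi / 2)) / pi"
          by (intro tendsto_intros) auto
        then show ?thesis using True by (simp add: S_def mult.commute)
      next
        case False
        then have xa: "a < x" using elim by auto
        have "filterlim (\<lambda>n. (x - a) * real n) at_top sequentially"
          by (rule filterlim_tendsto_pos_mult_at_top[OF tendsto_const _ filterlim_real_sequentially]) (use xa in auto)
        then have "(\<lambda>n. arctan ((x - a) * real n)) \<longlonglongrightarrow> (pi / 2)"
          by (rule filterlim_compose[OF tendsto_arctan_at_top])
        then have "(\<lambda>n. 1 / 2 - arctan ((x - a) * real n) / pi) \<longlonglongrightarrow> 1 / 2 - (pi / 2) / pi"
          by (intro tendsto_intros) auto
        then show ?thesis using xa by (simp add: S_def mult.commute)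
      qed
      have "(\<lambda>n. S n x * (B n x * B n x)) \<longlonglongrightarrow> indicator {..a} x * (1 * 1)"
        by (intro tendsto_intros B S)
      then show "(\<lambda>n. w n x) \<longlonglongrightarrow> indicator {..a} x" by (simp add: w_def)
    qed
  qed
qed

text \<open>Half-lines form an intersection-stable generator of the Borel sets, and approximability
  passes to complements by linearity and to countable disjoint unions by dominated
  convergence.\<close>

lemma flat_approx_borel:
  assumes l: "0 < l" and A: "A \<in> sets borel"
  shows "flat_approx l (indicator A)"
proof -
  have "Int_stable (range (\<lambda>a. {..a::real}))"
    by (rule Int_stableI_image, rule_tac x = "min i j" in bexI) auto
  moreover have "range (\<lambda>a. {..a::real}) \<subseteq> Pow UNIV" by simp
  moreover have "A \<in> sigma_sets UNIV (range (\<lambda>a. {..a::real}))" using A by (simp add: borel_eq_atMost)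
  ultimately show ?thesis
  proof (induction rule: sigma_sets_induct_disjoint)
    case (basic A)
    then show ?case using flat_approx_atMost[OF l] by auto
  next
    case empty
    show ?case
      using flat_approx_lincomb[OF flat_approx_atMost[OF l] flat_approx_atMost[OF l], of 0 0 0 0]
      by (rule flat_approx_cong) simp
  next
    case (compl A)
    \<comment> \<open>The half-line \<open>{..l}\<close> stands for the whole space here, as its
      indicator is 1 on the arc.\<close>
    show ?case
      using flat_approx_lincomb[OF flat_approx_atMost[OF l, of l] compl(2), of 1 "-1"]
      by (rule flat_approx_cong) (auto simp: indicator_def)
  next
    case (union A)
    have A: "A i \<in> sets borel" for i using union(2) by (auto simp: borel_eq_atMost)
    have fin: "flat_approx l (indicator (\<Union>i<n. A i))" for n
    proof (induction n)
      case 0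
      show ?case
        using flat_approx_lincomb[OF flat_approx_atMost[OF l] flat_approx_atMost[OF l], of 0 0 0 0]
        by (rule flat_approx_cong) simp
    next
      case (Suc n)
      have "A i \<inter> A n = {}" if "i < n" for i
        using union(1) that unfolding disjoint_family_on_def by (metis UNIV_I less_irrefl)
      then have "(\<Union>i<n. A i) \<inter> A n = {}" by blast
      then show ?case
        using flat_approx_lincomb[OF Suc union(3)[of n], of 1 1]
        by (elim flat_approx_cong) (auto simp: indicator_def lessThan_Suc)
    qed
    show ?case
    proof (rule flat_approx_limit[OF fin])
      show "AE x in lborel. x \<in> {0..l} \<longrightarrow> (\<lambda>n. indicat_real (\<Union>i<n. A i) x) \<longlonglongrightarrow> indicat_real (\<Union>i. A i) x"
        by (intro AE_I2 impI LIMSEQ_indicator_UN)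
      show "set_integrable lborel {0..l} (indicat_real (\<Union>i. A i))" using A by (intro set_integrable_indicator_Icc) auto
      show "set_integrable lborel {0..l} (\<lambda>x. 1 :: real)"
        by (intro borel_integrable_atLeastAtMost' continuous_intros)
    qed (auto simp: indicator_def)
  qed
qed

text \<open>The approximable functions contain the indicators, are closed under linear combinations
  and under dominated limits; this is the induction principle for integrable functions.\<close>

lemma flat_approx_integrable:
  assumes l: "0 < l" and f: "integrable lborel f"
  shows "flat_approx l f"
  using f
proof (induction rule: integrable_induct)
  case (base A c)
  have "flat_approx l (\<lambda>x. c * indicator A x + 0 * indicator A x)"
    using base by (intro flat_approx_lincomb flat_approx_borel[OF l]) auto
  then show ?case by (rule flat_approx_cong) simp
next
  case (add f g)
  then show ?case using flat_approx_lincomb[of l f g 1 1] by simp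
next
  case (lim f s)
  have fi: "set_integrable lborel {0..l} f"
    unfolding set_integrable_def by (intro integrable_mult_indicator lim.hyps) auto
  show ?case
  proof (rule flat_approx_limit[of l s])
    show "set_integrable lborel {0..l} (\<lambda>x. 2 * \<bar>f x\<bar>)" using set_integrable_abs[OF fi] by simp
    show "AE x in lborel. x \<in> {0..l} \<longrightarrow> (\<lambda>n. s n x) \<longlonglongrightarrow> f x" using lim by simp
    show "AE x in lborel. x \<in> {0..l} \<longrightarrow> \<bar>s n x\<bar> \<le> 2 * \<bar>f x\<bar>" for n using lim by simp
  qed (use lim fi in auto)
qed

section \<open>The operator on the network\<close>

lemma choice_triple: "\<forall>i. \<exists>a b c. P i a b c \<Longrightarrow> \<exists>a b c. \<forall>i. P i (a i) (b i) (c i)"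
  by metis

text \<open>The diagonal entry of \<open>alpha\<close> collects the weights \<open>K i k\<close>, so
  that only differences of node values remain.\<close>

lemma alpha_sum:
  fixes K :: "'m::finite \<Rightarrow> 'm \<Rightarrow> real"
  shows "(\<Sum>j\<in>UNIV. alpha K i j * w j) = (\<Sum>j\<in>UNIV. K i j * (w i - w j))"
proof -
  have "(\<Sum>j\<in>UNIV. alpha K i j * w j) = alpha K i i * w i + (\<Sum>j\<in>UNIV - {i}. alpha K i j * w j)"
    by (rule sum.remove) auto
  also have "(\<Sum>j\<in>UNIV - {i}. alpha K i j * w j) = (\<Sum>j\<in>UNIV - {i}. - (K i j * w j))"
    by (intro sum.cong) (auto simp: alpha_def)
  also have "alpha K i i * w i + \<dots> = (\<Sum>j\<in>UNIV - {i}. K i j * (w i - w j))"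
    by (simp add: alpha_def sum_distrib_right sum_negf right_diff_distrib sum_subtractf)
  also have "\<dots> = (\<Sum>j\<in>UNIV. K i j * (w i - w j))"
    using sum.remove[of UNIV i "\<lambda>j. K i j * (w i - w j)"] by simp
  finally show ?thesis .
qed

text \<open>Adding to the double sum its copy with \<open>i\<close> and \<open>j\<close> exchanged
  gives, by symmetry of \<open>K\<close>, the terms
  \<open>K i j * ((w i - w j) * (ssgn d (w i) - ssgn d (w j)))\<close>, which are nonnegative
  because \<open>ssgn d\<close> is monotone.\<close>

lemma coupling_dissipative:
  fixes K :: "'m::finite \<Rightarrow> 'm \<Rightarrow> real"
  assumes K: "\<And>i j. K i j \<ge> 0" "\<And>i j. K i j = K j i" and d: "0 < d"
  shows "0 \<le> (\<Sum>i\<in>UNIV. (\<Sum>j\<in>UNIV. alpha K i j * w j) * ssgn d (w i))"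
proof -
  let ?S = "\<Sum>i\<in>UNIV. \<Sum>j\<in>UNIV. K i j * (w i - w j) * ssgn d (w i)"
  have S: "(\<Sum>i\<in>UNIV. (\<Sum>j\<in>UNIV. alpha K i j * w j) * ssgn d (w i)) = ?S"
    by (simp add: alpha_sum sum_distrib_right)
  have "?S = (\<Sum>j\<in>UNIV. \<Sum>i\<in>UNIV. K i j * (w i - w j) * ssgn d (w i))" by (rule sum.swap)
  also have "\<dots> = (\<Sum>i\<in>UNIV. \<Sum>j\<in>UNIV. K i j * (w j - w i) * ssgn d (w j))"
    by (intro sum.cong refl) (simp add: K(2))
  finally have "?S + ?S = (\<Sum>i\<in>UNIV. \<Sum>j\<in>UNIV. K i j * (w i - w j) * ssgn d (w i))
    + (\<Sum>i\<in>UNIV. \<Sum>j\<in>UNIV. K i j * (w j - w i) * ssgn d (w j))" by simp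
  also have "\<dots> = (\<Sum>i\<in>UNIV. \<Sum>j\<in>UNIV. K i j * ((w i - w j) * (ssgn d (w i) - ssgn d (w j))))"
    by (simp add: algebra_simps flip: sum.distrib)
  also have "\<dots> \<ge> 0"
  proof (intro sum_nonneg mult_nonneg_nonneg[OF K(1)])
    fix i j
    show "0 \<le> (w i - w j) * (ssgn d (w i) - ssgn d (w j))"
      using ssgn_mono[OF d, of "w i" "w j"] ssgn_mono[OF d, of "w j" "w i"]
      by (cases "w i \<le> w j") (auto intro: mult_nonneg_nonneg mult_nonpos_nonpos)
  qed
  finally show ?thesis unfolding S by simp
qed

locale network =
  fixes I :: "'m::finite set" and L lam :: "'m \<Rightarrow> real" and K :: "'m \<Rightarrow> 'm \<Rightarrow> real" and \<epsilon> :: real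
  assumes L: "\<And>i. 0 < L i" and lam: "\<And>i. 0 < lam i"
    and K0: "\<And>i j. K i j \<ge> 0" and K_sym: "\<And>i j. K i j = K j i" and eps: "0 < \<epsilon>"
begin

lemmas WA_cases = WA_2_sobolev2[where L = L, OF L]
lemmas wders = sobolev2_wder[where L = L, OF L]
lemmas pvals = sobolev2_pval[where L = L, OF L]

abbreviation "N \<equiv> ptN I L"
abbreviation "E \<equiv> pte I L"
abbreviation "D \<equiv> dom_A0 I L lam K \<epsilon>"
abbreviation "A \<equiv> advdiff L lam \<epsilon>"

lemma N_in: "N i \<in> {0..L i}" and E_in: "E i \<in> {0..L i}"
  using L[of i] by (auto simp: ptN_def pte_def)

definition admissible :: "('m \<Rightarrow> real \<Rightarrow> real) \<Rightarrow> ('m \<Rightarrow> real \<Rightarrow> real) \<Rightarrow> bool" where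
  "admissible W V \<longleftrightarrow> (\<forall>i. W i (E i) = 0 \<and>
     beta I i * (lam i * W i (N i) - \<epsilon> * V i (N i)) = (\<Sum>j\<in>UNIV. alpha K i j * W j (N j)))"

lemma of_funs_D_iff:
  assumes "sobolev2 L W V G"
  shows "of_funs L W \<in> D \<longleftrightarrow> admissible W V"
  using wders(3)[OF assms]
  by (simp add: dom_A0_def admissible_def pvals(1)[OF assms E_in]
      pvals[OF assms N_in])

lemma A_of_funs:
  assumes s: "sobolev2 L W V G"
  shows "A (of_funs L W) = of_funs L (\<lambda>i x. \<epsilon> * G i x - lam i * V i x)"
proof -
  note i = sobolev2_arc_integrable[OF s]
  have "A (of_funs L W) = \<epsilon> *\<^sub>R of_funs L G - arcscale lam (of_funs L V)"
    using wders(2)[OF s] by (simp add: advdiff_def wders(1)[OF s])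
  also have "\<dots> = arcscale (\<lambda>_. \<epsilon>) (of_funs L G) + (-1) *\<^sub>R arcscale lam (of_funs L V)"
    by (simp add: arcscale_const)
  also have "(-1) *\<^sub>R arcscale lam (of_funs L V) = arcscale (\<lambda>i. - lam i) (of_funs L V)"
  proof -
    have "arc_integrable L (\<lambda>i x. lam i * V i x)"
      using arc_integrable_lincomb[OF i(2,2), of lam "\<lambda>_. 0"] by simp
    from of_funs_scale[OF this, of "-1"] show ?thesis by (simp add: arcscale_of_funs[OF i(2)])
  qed
  also have "arcscale (\<lambda>_. \<epsilon>) (of_funs L G) + \<dots> = of_funs L (\<lambda>i x. \<epsilon> * G i x + (- lam i) * V i x)"
    by (rule of_funs_lincomb[OF i(3,2), symmetric])
  finally show ?thesis by simp
qed

lemma D_cases: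
  assumes "w \<in> D"
  obtains W V G where "sobolev2 L W V G" "w = of_funs L W" "admissible W V"
proof -
  have "w \<in> WA L 2" using assms by (simp add: dom_A0_def)
  then obtain W V G where s: "sobolev2 L W V G" "w = of_funs L W"
    using WA_cases by blast
  then show ?thesis using that of_funs_D_iff[OF s(1)] assms by blast
qed

lemma arc_integrable_A: "sobolev2 L W V G \<Longrightarrow> arc_integrable L (\<lambda>i x. \<epsilon> * G i x - lam i * V i x)"
  using arc_integrable_lincomb[OF sobolev2_arc_integrable(3,2), of L W V G W V G "\<lambda>_. \<epsilon>" "\<lambda>i. - lam i"] by simp

lemma A_linear:
  assumes "v \<in> WA L 2" "w \<in> WA L 2"
  shows "A (a *\<^sub>R v + b *\<^sub>R w) = a *\<^sub>R A v + b *\<^sub>R A w"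
proof -
  obtain V V1 V2 where V: "sobolev2 L V V1 V2" "v = of_funs L V" using WA_cases[OF assms(1)] by blast
  obtain W W1 W2 where W: "sobolev2 L W W1 W2" "w = of_funs L W" using WA_cases[OF assms(2)] by blast
  note s = sobolev2_lincomb[OF V(1) W(1), of a b]
  note i = sobolev2_arc_integrable[OF V(1)] sobolev2_arc_integrable[OF W(1)]
  have "a *\<^sub>R v + b *\<^sub>R w = of_funs L (\<lambda>i x. a * V i x + b * W i x)"
    using of_funs_lincomb[OF i(1,4), of "\<lambda>_. a" "\<lambda>_. b"] by (simp add: V W arcscale_const)
  then have "A (a *\<^sub>R v + b *\<^sub>R w)
      = of_funs L (\<lambda>i x. \<epsilon> * (a * V2 i x + b * W2 i x) - lam i * (a * V1 i x + b * W1 i x))"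
    using A_of_funs[OF s] by simp
  also have "\<dots> = of_funs L (\<lambda>i x. a * (\<epsilon> * V2 i x - lam i * V1 i x) + b * (\<epsilon> * W2 i x - lam i * W1 i x))"
    by (simp add: algebra_simps)
  also have "\<dots> = a *\<^sub>R A v + b *\<^sub>R A w"
    using of_funs_lincomb[OF arc_integrable_A[OF V(1)] arc_integrable_A[OF W(1)], of "\<lambda>_. a" "\<lambda>_. b"]
    by (simp add: V W arcscale_const A_of_funs[OF V(1)] A_of_funs[OF W(1)])
  finally show ?thesis .
qed

lemma D_WA: "w \<in> D \<Longrightarrow> w \<in> WA L 2"
  by (simp add: dom_A0_def)

lemma WA_L1A: "w \<in> WA L 2 \<Longrightarrow> w \<in> L1A L"
  by (simp add: numeral_2_eq_2)

lemma subspace_D: "subspace D"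
proof (rule subspaceI)
  have 0: "sobolev2 L (\<lambda>i x. 0) (\<lambda>i x. 0) (\<lambda>i x. 0)"
    by (auto simp: sobolev2_def intro!: acI_derivative)
  have "arc_integrable L (\<lambda>i x. 0)" by (rule sobolev2_arc_integrable[OF 0])
  then have "of_funs L (\<lambda>i x. 0) = 0" using of_funs_scale[of L "\<lambda>i x. 0" 0] by simp
  moreover have "of_funs L (\<lambda>i x. 0) \<in> D" by (simp add: of_funs_D_iff[OF 0] admissible_def)
  ultimately show "0 \<in> D" by simp
next
  have *: "a *\<^sub>R x + b *\<^sub>R y \<in> D" if xy: "x \<in> D" "y \<in> D" for x y a b
  proof -
    obtain V V1 V2 where V: "sobolev2 L V V1 V2" "x = of_funs L V" "admissible V V1" using D_cases[OF xy(1)] by blast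
    obtain W W1 W2 where W: "sobolev2 L W W1 W2" "y = of_funs L W" "admissible W W1" using D_cases[OF xy(2)] by blast
    note i = sobolev2_arc_integrable[OF V(1)] sobolev2_arc_integrable[OF W(1)]
    have eq: "a *\<^sub>R x + b *\<^sub>R y = of_funs L (\<lambda>i x. a * V i x + b * W i x)"
      using of_funs_lincomb[OF i(1,4), of "\<lambda>_. a" "\<lambda>_. b"] by (simp add: V W arcscale_const)
    have "admissible (\<lambda>i x. a * V i x + b * W i x) (\<lambda>i x. a * V1 i x + b * W1 i x)"
      unfolding admissible_def
    proof (intro allI conjI)
      fix i
      show "a * V i (E i) + b * W i (E i) = 0" using V(3) W(3) by (simp add: admissible_def)
      have "beta I i * (lam i * (a * V i (N i) + b * W i (N i)) - \<epsilon> * (a * V1 i (N i) + b * W1 i (N i)))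
        = a * (beta I i * (lam i * V i (N i) - \<epsilon> * V1 i (N i))) + b * (beta I i * (lam i * W i (N i) - \<epsilon> * W1 i (N i)))"
        by (simp add: algebra_simps)
      also have "\<dots> = a * (\<Sum>j\<in>UNIV. alpha K i j * V j (N j)) + b * (\<Sum>j\<in>UNIV. alpha K i j * W j (N j))"
        using V(3) W(3) unfolding admissible_def by presburger
      also have "\<dots> = (\<Sum>j\<in>UNIV. alpha K i j * (a * V j (N j) + b * W j (N j)))"
        by (simp add: algebra_simps sum.distrib sum_distrib_left)
      finally show "beta I i * (lam i * (a * V i (N i) + b * W i (N i)) - \<epsilon> * (a * V1 i (N i) + b * W1 i (N i)))
         = (\<Sum>j\<in>UNIV. alpha K i j * (a * V j (N j) + b * W j (N j)))" .
    qed
    then show ?thesis unfolding eq using of_funs_D_iff[OF sobolev2_lincomb[OF V(1) W(1), of a b]] by simp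
  qed
  show "x + y \<in> D" if "x \<in> D" "y \<in> D" for x y using *[OF that, of 1 1] by simp
  show "c *\<^sub>R x \<in> D" if "x \<in> D" for x c using *[OF that that, of c 0] by simp
qed

text \<open>On every arc \<open>w - h A w\<close> is tested with \<open>ssgn d (W i x)\<close>. The
  node terms of all arcs together have the right sign by \<open>coupling_dissipative\<close>, the
  remaining errors are proportional to \<open>d\<close>, and \<open>d\<close> is arbitrary.\<close>

lemma A_dissipative:
  assumes h: "0 < h" and w: "w \<in> D"
  shows "norm w \<le> norm (w - h *\<^sub>R A w)"
proof -
  obtain W V G where s: "sobolev2 L W V G" and wW: "w = of_funs L W" and adm: "admissible W V"
    using D_cases[OF w] by blast
  note i = sobolev2_arc_integrable[OF s] arc_integrable_A[OF s]
  define F where "F i x = 1 * W i x + (- h) * (\<epsilon> * G i x - lam i * V i x)" for i x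
  have Fi: "arc_integrable L F" unfolding F_def by (rule arc_integrable_lincomb[OF i(1,4)])
  have eq: "w - h *\<^sub>R A w = of_funs L F"
    using of_funs_lincomb[OF i(1,4), of "\<lambda>_. 1" "\<lambda>_. - h"]
    unfolding F_def by (simp add: arcscale_const wW A_of_funs[OF s])
  define C where "C = (\<Sum>i\<in>UNIV. L i + h * lam i)"
  have C: "0 \<le> C" unfolding C_def using L lam h by (intro sum_nonneg add_nonneg_nonneg mult_nonneg_nonneg) (auto simp: less_imp_le)
  have main: "norm w \<le> norm (w - h *\<^sub>R A w) + C * d" if d: "0 < d" for d
  proof -
    define b where "b i = (\<epsilon> * V i (L i) - lam i * W i (L i)) * ssgn d (W i (L i))
        - (\<epsilon> * V i 0 - lam i * W i 0) * ssgn d (W i 0)" for i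
    \<comment> \<open>At the outer end \<open>W\<close> vanishes. At the inner node,
      \<open>beta\<close> accounts for \<open>N\<close> being the right end of an incoming arc and
      the left end of an outgoing one, so in both cases the boundary term is minus the coupling
      term.\<close>
    have b: "b i = - ((\<Sum>j\<in>UNIV. alpha K i j * W j (N j)) * ssgn d (W i (N i)))" for i
    proof -
      have "W i (E i) = 0" and eqN: "(\<Sum>j\<in>UNIV. alpha K i j * W j (N j)) = beta I i * (lam i * W i (N i) - \<epsilon> * V i (N i))"
        using adm unfolding admissible_def by auto
      then show ?thesis unfolding eqN
        by (cases "i \<in> I") (auto simp: b_def beta_def ptN_def pte_def algebra_simps)
    qed
    have bsum: "(\<Sum>i\<in>UNIV. b i) \<le> 0"
      unfolding b sum_negf using coupling_dissipative[of K d "\<lambda>i. W i (N i)"] K0 K_sym d by simp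
    have arc: "(LINT x:{0..L i}|lborel. \<bar>W i x\<bar>)
        \<le> (LINT x:{0..L i}|lborel. \<bar>F i x\<bar>) + (L i * d + h * (b i + lam i * d))" for i
    proof -
      note ac = sobolev2_ac[OF s, of i]
      have cs: "continuous_on {0..L i} (\<lambda>x. ssgn d (W i x))"
        using continuous_on_compose2[OF DERIV_continuous_on[OF has_field_derivative_at_within[OF ssgn_deriv[OF d]]] ac_continuous[OF ac(1)]] by auto
      have ints: "set_integrable lborel {0..L i} (\<lambda>x. W i x * ssgn d (W i x))"
        "set_integrable lborel {0..L i} (\<lambda>x. (\<epsilon> * G i x - lam i * V i x) * ssgn d (W i x))"
        "set_integrable lborel {0..L i} (\<lambda>x. F i x * ssgn d (W i x))"
        "set_integrable lborel {0..L i} (\<lambda>x. \<bar>W i x\<bar>)"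
        "set_integrable lborel {0..L i} (\<lambda>x. \<bar>F i x\<bar>)"
        using i Fi unfolding arc_integrable_def
        by (auto intro!: set_integrable_mult_continuous cs set_integrable_abs)
      have ci: "set_integrable lborel {0..L i} (\<lambda>x. d)" by (intro borel_integrable_atLeastAtMost' continuous_intros)
      have "(LINT x:{0..L i}|lborel. \<bar>W i x\<bar>) - L i * d = (LINT x:{0..L i}|lborel. \<bar>W i x\<bar> - d)"
        using L[of i] by (subst set_integral_diff(2)[OF ints(4) ci]) (simp add: set_integral_const_Icc)
      also have "\<dots> \<le> (LINT x:{0..L i}|lborel. W i x * ssgn d (W i x))"
        by (intro set_integral_mono set_integral_diff(1) ints ci ssgn_mult_ge d)
      also have "\<dots> = (LINT x:{0..L i}|lborel. F i x * ssgn d (W i x) + h * ((\<epsilon> * G i x - lam i * V i x) * ssgn d (W i x)))"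
        by (intro set_lebesgue_integral_cong) (auto simp: F_def algebra_simps)
      also have "\<dots> = (LINT x:{0..L i}|lborel. F i x * ssgn d (W i x))
          + h * (LINT x:{0..L i}|lborel. (\<epsilon> * G i x - lam i * V i x) * ssgn d (W i x))"
        using ints by (subst set_integral_add(2)) auto
      also have "\<dots> \<le> (LINT x:{0..L i}|lborel. \<bar>F i x\<bar>) + h * (b i + lam i * d)"
      proof (intro add_mono mult_left_mono)
        show "(LINT x:{0..L i}|lborel. F i x * ssgn d (W i x)) \<le> (LINT x:{0..L i}|lborel. \<bar>F i x\<bar>)"
        proof (intro set_integral_mono ints)
          fix x
          have "F i x * ssgn d (W i x) \<le> \<bar>F i x\<bar> * \<bar>ssgn d (W i x)\<bar>" by (metis abs_ge_self abs_mult)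
          also have "\<dots> \<le> \<bar>F i x\<bar>" using abs_ssgn[OF d] by (intro mult_left_le) auto
          finally show "F i x * ssgn d (W i x) \<le> \<bar>F i x\<bar>" .
        qed
        show "(LINT x:{0..L i}|lborel. (\<epsilon> * G i x - lam i * V i x) * ssgn d (W i x)) \<le> b i + lam i * d"
          unfolding b_def by (rule arc_dissipation[OF less_imp_le[OF L] d eps lam ac])
      qed (use h in simp)
      finally show ?thesis by simp
    qed
    have "norm w = (\<Sum>i\<in>UNIV. LINT x:{0..L i}|lborel. \<bar>W i x\<bar>)" unfolding wW by (rule norm_of_funs[OF i(1)])
    also have "\<dots> \<le> (\<Sum>i\<in>UNIV. (LINT x:{0..L i}|lborel. \<bar>F i x\<bar>) + (L i * d + h * (b i + lam i * d)))"
      by (rule sum_mono[OF arc])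
    also have "\<dots> = norm (w - h *\<^sub>R A w) + (h * (\<Sum>i\<in>UNIV. b i) + C * d)"
      unfolding eq norm_of_funs[OF Fi] C_def
      by (simp add: sum.distrib sum_distrib_left sum_distrib_right algebra_simps)
    also have "\<dots> \<le> norm (w - h *\<^sub>R A w) + C * d" using bsum h by (simp add: mult_nonneg_nonpos)
    finally show ?thesis .
  qed
  show ?thesis
  proof (rule field_le_epsilon)
    fix e :: real assume e: "0 < e"
    \<comment> \<open>The denominator is \<open>C + 1\<close> because \<open>C\<close> is only known
      to be nonnegative.\<close>
    have "C * (e / (C + 1)) \<le> (C + 1) * (e / (C + 1))" using C e by (intro mult_right_mono) auto
    also have "\<dots> = e" using C by simp
    finally show "norm w \<le> norm (w - h *\<^sub>R A w) + e"
      using main[of "e / (C + 1)"] C e by fastforce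
  qed
qed

lemma D_dense:
  assumes f: "f \<in> L1A L" and e: "0 < e"
  shows "\<exists>w\<in>D. norm (f - w) < e"
proof -
  define d where "d = e / CARD('m)"
  have d: "0 < d" using e by (simp add: d_def)
  have "\<forall>i. \<exists>w v g. ac (L i) w v \<and> ac (L i) v g \<and> w 0 = 0 \<and> w (L i) = 0 \<and> v 0 = 0 \<and> v (L i) = 0 \<and>
      (LINT x:{0..L i}|lborel. \<bar>rep_l1 f i x - w x\<bar>) < d"
    using flat_approx_integrable[OF L integrable_rep_l1[of f]] d unfolding flat_approx_def by blast
  from choice_triple[OF this] obtain W V G where W: "\<And>i. ac (L i) (W i) (V i)" "\<And>i. ac (L i) (V i) (G i)"
    "\<And>i. W i 0 = 0" "\<And>i. W i (L i) = 0" "\<And>i. V i 0 = 0" "\<And>i. V i (L i) = 0"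
    "\<And>i. (LINT x:{0..L i}|lborel. \<bar>rep_l1 f i x - W i x\<bar>) < d"
    by blast
  have s: "sobolev2 L W V G" using W(1,2) by (simp add: sobolev2_def)
  have N: "W i (N i) = 0" "V i (N i) = 0" "W i (E i) = 0" for i
    using W by (simp_all add: ptN_def pte_def)
  have "admissible W V" by (simp add: admissible_def N)
  then have D: "of_funs L W \<in> D" using of_funs_D_iff[OF s] by simp
  note i = sobolev2_arc_integrable(1)[OF s]
  have "f - of_funs L W = of_funs L (\<lambda>i x. 1 * rep_l1 f i x + (-1) * W i x)"
    using of_funs_lincomb[OF arc_integrable_rep i, of "\<lambda>_. 1" f "\<lambda>_. -1"] f
    by (simp add: arcscale_const L1A_iff_of_funs)
  then have "norm (f - of_funs L W) = (\<Sum>i\<in>UNIV. LINT x:{0..L i}|lborel. \<bar>1 * rep_l1 f i x + (-1) * W i x\<bar>)"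
    using norm_of_funs[OF arc_integrable_lincomb[OF arc_integrable_rep i, of "\<lambda>_. 1" f "\<lambda>_. -1"]] by simp
  also have "\<dots> < (\<Sum>i\<in>(UNIV::'m set). d)" using W(7) by (intro sum_strict_mono) auto
  also have "\<dots> = e" by (simp add: d_def)
  finally show ?thesis using D by blast
qed

lemma A_in: "w \<in> WA L 2 \<Longrightarrow> A w \<in> L1A L"
proof -
  assume "w \<in> WA L 2"
  then obtain W V G where "sobolev2 L W V G" "w = of_funs L W" using WA_cases by blast
  then show "A w \<in> L1A L" by (simp add: A_of_funs of_funs_L1A arc_integrable_A)
qed

text \<open>Shooting from the outer ends. On each arc the solutions with value 0 at
  \<open>E i\<close> are a particular one plus \<open>c $ i\<close> times the homogeneous one with
  slope 1. The node conditions are as many linear equations as there are slopes, and a kernel vector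
  consists of the slopes of some \<open>w\<close> in \<open>D\<close> with
  \<open>w - h A w = 0\<close>, which is zero by dissipativity.\<close>

lemma resolvent_exists:
  assumes h: "0 < h" and f: "f \<in> L1A L"
  shows "\<exists>w\<in>D. w - h *\<^sub>R A w = f"
proof -
  \<comment> \<open>\<open>r1\<close> and \<open>r2\<close> are the roots of
    \<open>\<epsilon> * r\<^sup>2 - lam i * r - 1 / h\<close>, and \<open>\<rho>\<close> is the
    square root of its discriminant.\<close>
  define \<rho> where "\<rho> i = sqrt ((lam i)\<^sup>2 + 4 * \<epsilon> / h)" for i
  define r1 r2 where "r1 i = (lam i - \<rho> i) / (2 * \<epsilon>)" and "r2 i = (lam i + \<rho> i) / (2 * \<epsilon>)" for i
  have r: "r1 i + r2 i = lam i / \<epsilon>" "r1 i * r2 i = - 1 / (h * \<epsilon>)" for i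
  proof -
    show "r1 i + r2 i = lam i / \<epsilon>" using eps by (simp add: r1_def r2_def field_simps)
    have "0 \<le> (lam i)\<^sup>2 + 4 * \<epsilon> / h" using h eps by (intro add_nonneg_nonneg) auto
    then have "(\<rho> i)\<^sup>2 = (lam i)\<^sup>2 + 4 * \<epsilon> / h" unfolding \<rho>_def by (rule real_sqrt_pow2)
    then have "(lam i - \<rho> i) * (lam i + \<rho> i) = - 4 * \<epsilon> / h"
      by (simp add: algebra_simps power2_eq_square)
    then have "r1 i * r2 i = (- 4 * \<epsilon> / h) / ((2 * \<epsilon>) * (2 * \<epsilon>))"
      unfolding r1_def r2_def by (simp add: times_divide_times_eq)
    also have "\<dots> = - 1 / (h * \<epsilon>)" using eps h by (simp add: field_simps)
    finally show "r1 i * r2 i = - 1 / (h * \<epsilon>)" .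
  qed
  have solve: "\<exists>W V G. ac (L i) W V \<and> ac (L i) V G \<and> W (E i) = 0 \<and> V (E i) = c \<and>
      (\<forall>x. W x - h * (\<epsilon> * G x - lam i * V x) = k x)"
    if k: "set_integrable lborel {0..L i} k" for i k c
  proof -
    have "set_integrable lborel {0..L i} (\<lambda>x. - 1 / (h * \<epsilon>) * k x)"
      using k by (intro set_integrable_mult_right)
    from ac_second_order_ode[OF this, of "E i" 0 c "r1 i" "r2 i"]
    obtain W V G where *: "ac (L i) W V" "ac (L i) V G" "W (E i) = 0" "V (E i) = c"
      "\<And>x. G x = (lam i / \<epsilon>) * V x - (- 1 / (h * \<epsilon>)) * W x + - 1 / (h * \<epsilon>) * k x"
      unfolding r by blast
    have "W x - h * (\<epsilon> * G x - lam i * V x) = k x" for x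
      unfolding *(5) using eps h by (simp add: field_simps)
    with * show ?thesis by blast
  qed
  have fi: "set_integrable lborel {0..L i} (rep_l1 f i)" for i
    using arc_integrable_rep[of L f] by (simp add: arc_integrable_def)
  have zi: "set_integrable lborel {0..L i} (\<lambda>x. 0)" for i by (simp add: set_integrable_def)
  have "\<forall>i. \<exists>W V G. ac (L i) W V \<and> ac (L i) V G \<and> W (E i) = 0 \<and> V (E i) = 0 \<and>
      (\<forall>x. W x - h * (\<epsilon> * G x - lam i * V x) = rep_l1 f i x)"
    by (intro allI solve fi)
  from choice_triple[OF this] obtain W0 V0 G0 where W0: "\<And>i. ac (L i) (W0 i) (V0 i)" "\<And>i. ac (L i) (V0 i) (G0 i)"
    "\<And>i. W0 i (E i) = 0" "\<And>i x. W0 i x - h * (\<epsilon> * G0 i x - lam i * V0 i x) = rep_l1 f i x"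
    by blast
  have "\<forall>i. \<exists>W V G. ac (L i) W V \<and> ac (L i) V G \<and> W (E i) = 0 \<and> V (E i) = 1 \<and>
      (\<forall>x. W x - h * (\<epsilon> * G x - lam i * V x) = 0)"
    by (intro allI solve zi)
  from choice_triple[OF this] obtain W1 V1 G1 where W1: "\<And>i. ac (L i) (W1 i) (V1 i)" "\<And>i. ac (L i) (V1 i) (G1 i)"
    "\<And>i. W1 i (E i) = 0" "\<And>i. V1 i (E i) = 1" "\<And>i x. W1 i x - h * (\<epsilon> * G1 i x - lam i * V1 i x) = 0"
    by blast
  \<comment> \<open>\<open>B\<close> is the defect in the node condition, linear in the pair
    \<open>W\<close>, \<open>V\<close>; \<open>M\<close> is the part of the defect caused by the
    homogeneous solutions with slopes \<open>c\<close>.\<close>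
  define B where "B W V i = beta I i * (lam i * W i (N i) - \<epsilon> * V i (N i)) - (\<Sum>j\<in>UNIV. alpha K i j * W j (N j))"
    for W V :: "'m \<Rightarrow> real \<Rightarrow> real" and i
  define W where "W c i x = W0 i x + (c $ i) * W1 i x" for c :: "real ^ 'm" and i x
  define M where "M c = (\<chi> i. B (\<lambda>i x. (c $ i) * W1 i x) (\<lambda>i x. (c $ i) * V1 i x) i)" for c :: "real ^ 'm"
  have "linear M"
    by (rule linearI) (simp_all add: M_def B_def vec_eq_iff algebra_simps sum.distrib sum_distrib_left)
  moreover have "inj M"
    unfolding linear_injective_0[OF \<open>linear M\<close>]
  proof (intro allI impI)
    fix c assume c: "M c = 0"
    define Wc Vc Gc where "Wc i x = c $ i * W1 i x" and "Vc i x = c $ i * V1 i x" and "Gc i x = c $ i * G1 i x" for i x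
    have s: "sobolev2 L Wc Vc Gc"
      unfolding sobolev2_def
    proof
      fix i
      show "ac (L i) (Wc i) (Vc i) \<and> ac (L i) (Vc i) (Gc i)"
        using ac_lincomb[OF W1(1) W1(1), of i "c $ i" 0] ac_lincomb[OF W1(2) W1(2), of i "c $ i" 0]
        unfolding Wc_def Vc_def Gc_def by simp
    qed
    have "B Wc Vc i = 0" for i
    proof -
      have "B Wc Vc i = M c $ i" unfolding M_def Wc_def Vc_def by simp
      then show ?thesis by (simp add: c)
    qed
    then have "admissible Wc Vc" unfolding admissible_def B_def by (simp add: Wc_def W1)
    then have D: "of_funs L Wc \<in> D" using of_funs_D_iff[OF s] by simp
    note i = sobolev2_arc_integrable(1)[OF s] arc_integrable_A[OF s]
    have "of_funs L Wc - h *\<^sub>R A (of_funs L Wc)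
        = of_funs L (\<lambda>i x. 1 * Wc i x + (- h) * (\<epsilon> * Gc i x - lam i * Vc i x))"
      using of_funs_lincomb[OF i, of "\<lambda>_. 1" "\<lambda>_. - h"] by (simp add: arcscale_const A_of_funs[OF s])
    also have "\<dots> = of_funs L (\<lambda>i x. 0 * Wc i x)"
    proof -
      have "1 * Wc i x + (- h) * (\<epsilon> * Gc i x - lam i * Vc i x) = 0 * Wc i x" for i x
      proof -
        have "Wc i x - h * (\<epsilon> * Gc i x - lam i * Vc i x)
            = c $ i * (W1 i x - h * (\<epsilon> * G1 i x - lam i * V1 i x))"
          by (simp add: Wc_def Vc_def Gc_def algebra_simps)
        then show ?thesis by (simp add: W1)
      qed
      then show ?thesis by (simp only:)
    qed
    also have "\<dots> = 0" unfolding of_funs_scale[OF i(1)] by simp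
    finally have w0: "of_funs L Wc = 0" using A_dissipative[OF h D] by simp
    have s0: "sobolev2 L (\<lambda>i x. 0) (\<lambda>i x. 0) (\<lambda>i x. 0)"
      by (auto simp: sobolev2_def intro!: acI_derivative)
    have "of_funs L (\<lambda>i x. 0) = 0"
      using of_funs_scale[OF sobolev2_arc_integrable(1)[OF s0], of 0] by simp
    \<comment> \<open>The slope of \<open>Wc\<close> at the outer end is \<open>c $ i\<close>, and
      \<open>Wc\<close> represents the zero class.\<close>
    then have "c $ i = 0" for i
      using pvals(2)[OF s E_in, of i] pvals(2)[OF s0 E_in, of i] by (simp add: w0 Vc_def W1)
    then show "c = 0" by (simp add: vec_eq_iff)
  qed
  ultimately have "surj M" using linear_inj_imp_surj by blast
  \<comment> \<open>These slopes cancel the defect of the particular solution.\<close>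
  then obtain c where c: "M c = (\<chi> i. - B W0 V0 i)" by (metis surjD)
  define Vc Gc where "Vc i x = V0 i x + c $ i * V1 i x" and "Gc i x = G0 i x + c $ i * G1 i x" for i x
  have s: "sobolev2 L (W c) Vc Gc"
    unfolding sobolev2_def
  proof
    fix i
    show "ac (L i) (W c i) (Vc i) \<and> ac (L i) (Vc i) (Gc i)"
      using ac_lincomb[OF W0(1) W1(1), of i 1 "c $ i"] ac_lincomb[OF W0(2) W1(2), of i 1 "c $ i"]
      unfolding W_def Vc_def Gc_def by simp
  qed
  have "B (W c) Vc i = 0" for i
  proof -
    have "B (W c) Vc i = B W0 V0 i + M c $ i"
      by (simp add: M_def B_def W_def Vc_def algebra_simps sum.distrib)
    then show ?thesis by (simp add: c)
  qed
  then have "admissible (W c) Vc" unfolding admissible_def B_def by (simp add: W_def W0 W1)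
  then have D: "of_funs L (W c) \<in> D" using of_funs_D_iff[OF s] by simp
  note i = sobolev2_arc_integrable(1)[OF s] arc_integrable_A[OF s]
  have "of_funs L (W c) - h *\<^sub>R A (of_funs L (W c))
      = of_funs L (\<lambda>i x. 1 * W c i x + (- h) * (\<epsilon> * Gc i x - lam i * Vc i x))"
    using of_funs_lincomb[OF i, of "\<lambda>_. 1" "\<lambda>_. - h"] by (simp add: arcscale_const A_of_funs[OF s])
  also have "\<dots> = of_funs L (rep_l1 f)"
  proof -
    have "1 * W c i x + (- h) * (\<epsilon> * Gc i x - lam i * Vc i x) = rep_l1 f i x" for i x
    proof -
      have "W c i x - h * (\<epsilon> * Gc i x - lam i * Vc i x)
          = (W0 i x - h * (\<epsilon> * G0 i x - lam i * V0 i x)) + c $ i * (W1 i x - h * (\<epsilon> * G1 i x - lam i * V1 i x))"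
        by (simp add: W_def Vc_def Gc_def algebra_simps)
      then show ?thesis by (simp add: W0 W1)
    qed
    then show ?thesis by (simp only:)
  qed
  also have "\<dots> = f" using f by (simp add: L1A_iff_of_funs)
  finally show ?thesis using D by blast
qed

section \<open>The network as an instance of the abstract theory\<close>

sublocale dissipative_op "L1A L" D A
proof
  show "A (x + y) = A x + A y" if "x \<in> D" "y \<in> D" for x y
    using A_linear[OF D_WA[OF that(1)] D_WA[OF that(2)], of 1 1] by simp
  show "A (c *\<^sub>R x) = c *\<^sub>R A x" if "x \<in> D" for x c
    using A_linear[OF D_WA[OF that] D_WA[OF that], of c 0] by simp
qed (auto intro: subspace_L1A closed_L1A subspace_D WA_L1A D_WA A_in D_dense A_dissipative resolvent_exists)

text \<open>\<open>generates_T\<close> exhibits a semigroup with this generator, so the choice in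
  \<open>tau\<close> succeeds. From here on \<open>tau\<close> is known only through this
  property.\<close>

lemma tau_generates: "generates (L1A L) D A (tau I L lam K \<epsilon>)"
  unfolding tau_def by (rule someI[where P = "generates (L1A L) D A", OF generates_T])

sublocale generated_semigroup "L1A L" D A "tau I L lam K \<epsilon>" "restr L"
  by (rule generated_semigroup.intro[OF tau_generates _ bounded_linear_restr restr_L1A restr_id])
    (auto intro: WA_L1A D_WA)

end

section \<open>The initial boundary value problem\<close>

text \<open>Functions that agree on \<open>{0..l}\<close> with a polynomial of degree at most 2 are
  stable under \<open>derivc l\<close>. Agreement is asserted on \<open>{0..l}\<close> only, because
  the derivative within the interval is unspecified elsewhere.\<close>

lemma quadratic_smooth_closed:
  assumes l: "0 < l"
  shows "smooth_closed l (\<lambda>x. a + b * x + c * x\<^sup>2)"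
    and "x \<in> {0..l} \<Longrightarrow> derivc l (\<lambda>x. a + b * x + c * x\<^sup>2) x = b + 2 * c * x"
proof -
  have d: "(f has_vector_derivative b + 2 * c * x) (at x within {0..l})"
    if f: "\<And>x. x \<in> {0..l} \<Longrightarrow> f x = a + b * x + c * x\<^sup>2" and x: "x \<in> {0..l}" for f a b c x
  proof -
    have "((\<lambda>x. a + b * x + c * x\<^sup>2) has_vector_derivative b + 2 * c * x) (at x within {0..l})"
      unfolding has_real_derivative_iff_has_vector_derivative[symmetric]
      by (auto intro!: derivative_eq_intros)
    then show ?thesis
      using f x by (auto intro: has_vector_derivative_transform)
  qed
  have dc: "derivc l f x = b + 2 * c * x"
    if f: "\<And>x. x \<in> {0..l} \<Longrightarrow> f x = a + b * x + c * x\<^sup>2" and x: "x \<in> {0..l}" for f a b c x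
    unfolding derivc_def by (rule vector_derivative_within_closed_interval[OF l x d[OF f x]])
  show "x \<in> {0..l} \<Longrightarrow> derivc l (\<lambda>x. a + b * x + c * x\<^sup>2) x = b + 2 * c * x"
    by (rule dc[OF refl])
  have "\<exists>a' b' c'. \<forall>x\<in>{0..l}. (derivc l ^^ n) (\<lambda>x. a + b * x + c * x\<^sup>2) x = a' + b' * x + c' * x\<^sup>2" for n
  proof (induction n)
    case (Suc n)
    then obtain a' b' c' where *: "\<And>x. x \<in> {0..l} \<Longrightarrow> (derivc l ^^ n) (\<lambda>x. a + b * x + c * x\<^sup>2) x = a' + b' * x + c' * x\<^sup>2"
      by blast
    have "\<forall>x\<in>{0..l}. (derivc l ^^ Suc n) (\<lambda>x. a + b * x + c * x\<^sup>2) x = b' + 2 * c' * x + 0 * x\<^sup>2"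
      using dc[OF *] by simp
    then show ?case by blast
  qed auto
  then show "smooth_closed l (\<lambda>x. a + b * x + c * x\<^sup>2)"
    unfolding smooth_closed_def differentiable_on_def by (blast intro: differentiableI_vector d)
qed

lemma smooth_closed_ac:
  assumes "smooth_closed l f"
  shows "ac l f (derivc l f)" "ac l (derivc l f) (derivc l (derivc l f))"
proof -
  have n: "(derivc l ^^ n) f differentiable_on {0..l}" for n using assms by (simp add: smooth_closed_def)
  have d: "(k has_real_derivative derivc l k x) (at x within {0..l})"
    if "k differentiable_on {0..l}" "x \<in> {0..l}" for k x
    using that unfolding derivc_def has_real_derivative_iff_has_vector_derivative differentiable_on_def
    by (simp add: vector_derivative_works)
  note n0 = n[of 0, simplified] and n1 = n[of 1, simplified] and n2 = n[of 2, unfolded numeral_2_eq_2, simplified]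
  show "ac l f (derivc l f)"
    by (rule acI_derivative[OF d[OF n0] differentiable_imp_continuous_on[OF n1]])
  show "ac l (derivc l f) (derivc l (derivc l f))"
    by (rule acI_derivative[OF d[OF n1] differentiable_imp_continuous_on[OF n2]])
qed

section \<open>Lifting of the boundary data, the solution and its uniqueness\<close>

context network
begin

lemma WA_lincomb:
  assumes "v \<in> WA L 2" "w \<in> WA L 2"
  shows "a *\<^sub>R v + b *\<^sub>R w \<in> WA L 2"
proof -
  obtain V V1 V2 where V: "sobolev2 L V V1 V2" "v = of_funs L V" using WA_cases[OF assms(1)] by blast
  obtain W W1 W2 where W: "sobolev2 L W W1 W2" "w = of_funs L W" using WA_cases[OF assms(2)] by blast
  have "a *\<^sub>R v + b *\<^sub>R w = of_funs L (\<lambda>i x. a * V i x + b * W i x)"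
    using of_funs_lincomb[OF sobolev2_arc_integrable(1)[OF V(1)] sobolev2_arc_integrable(1)[OF W(1)], of "\<lambda>_. a" "\<lambda>_. b"]
    by (simp add: V W arcscale_const)
  then show ?thesis using wders(3)[OF sobolev2_lincomb[OF V(1) W(1), of a b]] by simp
qed

lemma WA_add: "v \<in> WA L 2 \<Longrightarrow> w \<in> WA L 2 \<Longrightarrow> v + w \<in> WA L 2"
  and WA_diff: "v \<in> WA L 2 \<Longrightarrow> w \<in> WA L 2 \<Longrightarrow> v - w \<in> WA L 2"
  using WA_lincomb[of v w 1 1] WA_lincomb[of v w 1 "-1"] by auto

lemma A_WA_add: "v \<in> WA L 2 \<Longrightarrow> w \<in> WA L 2 \<Longrightarrow> A (v + w) = A v + A w"
  and A_WA_diff: "v \<in> WA L 2 \<Longrightarrow> w \<in> WA L 2 \<Longrightarrow> A (v - w) = A v - A w"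
  using A_linear[of v w 1 1] A_linear[of v w 1 "-1"] by auto

text \<open>The first derivative is controlled arc by arc; the second is then read off from
  \<open>\<epsilon> w'' = A w + lam w'\<close>. This is the direction that turns continuity in the
  graph norm into continuity in W^{2,1}.\<close>

lemma normW_bound: "\<exists>C\<ge>0. \<forall>w\<in>WA L 2. normW L 2 w \<le> C * (norm w + norm (A w))"
proof -
  have "\<forall>i. \<exists>C\<ge>0. \<forall>W V G. ac (L i) W V \<longrightarrow> ac (L i) V G \<longrightarrow> (LINT x:{0..L i}|lborel. \<bar>V x\<bar>)
     \<le> C * ((LINT x:{0..L i}|lborel. \<bar>W x\<bar>) + (LINT x:{0..L i}|lborel. \<bar>\<epsilon> * G x - lam i * V x\<bar>))"
    by (intro allI arc_first_derivative_bound L eps lam)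
  from choice[OF this] obtain c where c: "\<And>i. 0 \<le> c i"
    "\<And>i W V G. ac (L i) W V \<Longrightarrow> ac (L i) V G \<Longrightarrow> (LINT x:{0..L i}|lborel. \<bar>V x\<bar>)
     \<le> c i * ((LINT x:{0..L i}|lborel. \<bar>W x\<bar>) + (LINT x:{0..L i}|lborel. \<bar>\<epsilon> * G x - lam i * V x\<bar>))"
    by blast
  define C1 where "C1 = (\<Sum>i\<in>UNIV. c i)"
  define \<Lambda> where "\<Lambda> = (\<Sum>i\<in>UNIV. lam i)"
  have C1: "0 \<le> C1" unfolding C1_def by (intro sum_nonneg c)
  have \<Lambda>: "0 \<le> \<Lambda>" unfolding \<Lambda>_def using lam by (intro sum_nonneg less_imp_le)
  have bound: "normW L 2 w \<le> (1 + C1 + (1 + \<Lambda> * C1) / \<epsilon>) * (norm w + norm (A w))" if w: "w \<in> WA L 2" for w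
  proof -
    obtain W V G where s: "sobolev2 L W V G" and wW: "w = of_funs L W" using WA_cases[OF w] by blast
    note i = sobolev2_arc_integrable[OF s] arc_integrable_A[OF s]
    define n where "n = norm w + norm (A w)"
    have nw: "norm w = (\<Sum>i\<in>UNIV. LINT x:{0..L i}|lborel. \<bar>W i x\<bar>)" unfolding wW by (rule norm_of_funs[OF i(1)])
    have nA: "norm (A w) = (\<Sum>i\<in>UNIV. LINT x:{0..L i}|lborel. \<bar>\<epsilon> * G i x - lam i * V i x\<bar>)"
      unfolding wW A_of_funs[OF s] by (rule norm_of_funs[OF i(4)])
    have nonneg: "0 \<le> (LINT x:{0..L i}|lborel. \<bar>f x\<bar>)" for i and f :: "real \<Rightarrow> real"
      unfolding set_lebesgue_integral_def by (intro integral_nonneg_AE) auto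
    have n: "norm w \<le> n" "norm (A w) \<le> n" "0 \<le> n" by (auto simp: n_def)
    have part: "(LINT x:{0..L i}|lborel. \<bar>W i x\<bar>) + (LINT x:{0..L i}|lborel. \<bar>\<epsilon> * G i x - lam i * V i x\<bar>) \<le> n" for i
      unfolding n_def nw nA by (intro add_mono member_le_sum nonneg) auto
    have "norm (wder L w) = (\<Sum>i\<in>UNIV. LINT x:{0..L i}|lborel. \<bar>V i x\<bar>)"
      unfolding wW wders(1)[OF s] by (rule norm_of_funs[OF i(2)])
    also have "\<dots> \<le> (\<Sum>i\<in>UNIV. c i * n)"
      by (intro sum_mono order_trans[OF c(2)[OF sobolev2_ac[OF s]]] mult_left_mono part c(1))
    also have "\<dots> = C1 * n" by (simp add: C1_def sum_distrib_right)
    finally have V: "norm (wder L w) \<le> C1 * n" .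
    have arcscale_le: "norm (arcscale lam (wder L w)) \<le> \<Lambda> * norm (wder L w)"
    proof -
      have li: "arc_integrable L (\<lambda>i x. lam i * V i x)"
        using arc_integrable_lincomb[OF i(2,2), of lam "\<lambda>_. 0"] by simp
      have "norm (arcscale lam (wder L w)) = (\<Sum>i\<in>UNIV. LINT x:{0..L i}|lborel. \<bar>lam i * V i x\<bar>)"
        unfolding wW wders(1)[OF s] arcscale_of_funs[OF i(2)] by (rule norm_of_funs[OF li])
      also have "\<dots> = (\<Sum>i\<in>UNIV. lam i * (LINT x:{0..L i}|lborel. \<bar>V i x\<bar>))"
        using lam by (intro sum.cong) (auto simp: abs_mult less_imp_le abs_of_pos)
      also have "\<dots> \<le> (\<Sum>i\<in>UNIV. \<Lambda> * (LINT x:{0..L i}|lborel. \<bar>V i x\<bar>))"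
        unfolding \<Lambda>_def using lam by (intro sum_mono mult_right_mono nonneg member_le_sum) (auto simp: less_imp_le)
      also have "\<dots> = \<Lambda> * norm (wder L w)"
        unfolding wW wders(1)[OF s] norm_of_funs[OF i(2)] by (simp add: sum_distrib_left)
      finally show ?thesis .
    qed
    have "\<epsilon> *\<^sub>R wder L (wder L w) = A w + arcscale lam (wder L w)" by (simp add: advdiff_def)
    then have "\<epsilon> * norm (wder L (wder L w)) \<le> norm (A w) + norm (arcscale lam (wder L w))"
      using norm_triangle_ineq[of "A w" "arcscale lam (wder L w)"] eps by (metis norm_scaleR abs_of_pos)
    also have "\<dots> \<le> n + \<Lambda> * (C1 * n)"
      using arcscale_le mult_left_mono[OF V \<Lambda>] n by linarith
    finally have "norm (wder L (wder L w)) \<le> (1 + \<Lambda> * C1) / \<epsilon> * n"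
      using eps by (simp add: field_simps)
    moreover have "normW L 2 w = norm w + norm (wder L w) + norm (wder L (wder L w))"
      by (simp add: normW_def numeral_2_eq_2)
    ultimately show ?thesis
      using V n by (simp add: n_def[symmetric] distrib_right)
  qed
  have "0 \<le> 1 + C1 + (1 + \<Lambda> * C1) / \<epsilon>" using C1 \<Lambda> eps by simp
  with bound show ?thesis by blast
qed

lemma lifting_sobolev2:
  assumes "is_lifting I L u0 q"
  shows "sobolev2 L q (\<lambda>i. derivc (L i) (q i)) (\<lambda>i. derivc (L i) (derivc (L i) (q i)))"
  using assms smooth_closed_ac unfolding is_lifting_def sobolev2_def by blast

lemma A_lifting:
  assumes "is_lifting I L u0 q"
  shows "A (of_funs L q) = of_funs L (forcing L lam \<epsilon> q)"
  unfolding A_of_funs[OF lifting_sobolev2[OF assms]] forcing_def[abs_def] ..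

text \<open>The parabola \<open>c i * (x - N i)\<^sup>2\<close> has a double zero at the inner node,
  and \<open>c i\<close> scales it to the prescribed value at the outer end, which is at distance
  \<open>L i\<close>.\<close>

lemma lifting_exists: "\<exists>q. is_lifting I L u0 q"
proof -
  define c where "c i = vale I L u0 i / (L i)\<^sup>2" for i
  define q where "q i x = c i * (N i)\<^sup>2 + (- 2 * c i * N i) * x + c i * x\<^sup>2" for i x
  have "q i (E i) = vale I L u0 i" for i
    using L[of i] by (auto simp: q_def c_def ptN_def pte_def power2_eq_square field_simps)
  moreover have "q i (N i) = 0" for i by (simp add: q_def power2_eq_square algebra_simps)
  moreover have "derivc (L i) (q i) (N i) = 0" for i
    unfolding q_def by (subst quadratic_smooth_closed(2)[OF L N_in]) simp
  moreover have "smooth_closed (L i) (q i)" for i unfolding q_def by (rule quadratic_smooth_closed(1)[OF L])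
  ultimately show ?thesis unfolding is_lifting_def by blast
qed

text \<open>\<open>q\<close> vanishes with its derivative at the inner node, so subtracting it
  leaves the transmission condition as it is, while at the outer end it turns the prescribed value
  into zero. What remains is a change of sign and the passage from \<open>alpha\<close> to
  \<open>K\<close>.\<close>

lemma diff_lifting_D_iff:
  assumes q: "is_lifting I L u0 q" and w: "w \<in> WA L 2"
  shows "w - of_funs L q \<in> D \<longleftrightarrow>
    transmission I L lam K \<epsilon> w \<and> (\<forall>i. vale I L w i = vale I L u0 i)"
proof -
  note sq = lifting_sobolev2[OF q]
  obtain W V G where s: "sobolev2 L W V G" and wW: "w = of_funs L W" using WA_cases[OF w] by blast
  have sd: "sobolev2 L (\<lambda>i x. 1 * W i x + (-1) * q i x) (\<lambda>i x. 1 * V i x + (-1) * derivc (L i) (q i) x)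
      (\<lambda>i x. 1 * G i x + (-1) * derivc (L i) (derivc (L i) (q i)) x)"
    by (rule sobolev2_lincomb[OF s sq])
  have eq: "w - of_funs L q = of_funs L (\<lambda>i x. 1 * W i x + (-1) * q i x)"
    using of_funs_lincomb[OF sobolev2_arc_integrable(1)[OF s] sobolev2_arc_integrable(1)[OF sq], of "\<lambda>_. 1" "\<lambda>_. -1"]
    by (simp add: wW arcscale_const)
  have q0: "q i (E i) = vale I L u0 i" "q i (N i) = 0" "derivc (L i) (q i) (N i) = 0" for i
    using q unfolding is_lifting_def by auto
  have p: "vale I L w i = W i (E i)" "valN I L w i = W i (N i)" "valN I L (wder L w) i = V i (N i)" for i
    unfolding wW by (intro pvals[OF s] E_in N_in)+
  have neg: "beta I i * (- lam i * a + \<epsilon> * b) = (\<Sum>j\<in>UNIV. K i j * (W j (N j) - W i (N i)))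
     \<longleftrightarrow> beta I i * (lam i * a - \<epsilon> * b) = (\<Sum>j\<in>UNIV. K i j * (W i (N i) - W j (N j)))" for i a b
  proof -
    have "beta I i * (- lam i * a + \<epsilon> * b) = - (beta I i * (lam i * a - \<epsilon> * b))" by (simp add: algebra_simps)
    moreover have "(\<Sum>j\<in>UNIV. K i j * (W j (N j) - W i (N i))) = - (\<Sum>j\<in>UNIV. K i j * (W i (N i) - W j (N j)))"
      by (simp add: algebra_simps flip: sum_negf)
    ultimately show ?thesis by simp
  qed
  show ?thesis
    unfolding eq of_funs_D_iff[OF sd] admissible_def transmission_def p q0 alpha_sum neg
    by auto
qed

text \<open>Duhamel's formula with forcing \<open>A Q\<close>, which for
  \<open>Q = of_funs L q\<close> is the \<open>F\<close> of the problem by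
  \<open>A_lifting\<close>.\<close>

definition sol :: "'m l1 \<Rightarrow> 'm l1 \<Rightarrow> real \<Rightarrow> 'm l1" where
  "sol u0 Q t = tau I L lam K \<epsilon> t (u0 - Q) + Y (A Q) t + Q"

lemma sol_is_solution:
  assumes u0: "u0 \<in> WA L 2" "transmission I L lam K \<epsilon> u0" and q: "is_lifting I L u0 q"
  shows "is_solution I L lam K \<epsilon> u0 (sol u0 (of_funs L q))"
proof -
  let ?T = "tau I L lam K \<epsilon>"
  define Q where "Q = of_funs L q"
  define F where "F = A Q"
  define w0 where "w0 = u0 - Q"
  define u where "u = sol u0 Q"
  have Q: "Q \<in> WA L 2" unfolding Q_def by (rule wders(3)[OF lifting_sobolev2[OF q]])
  have F: "F \<in> L1A L" unfolding F_def by (rule A_in[OF Q])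
  have w0: "w0 \<in> D" using diff_lifting_D_iff[OF q u0(1)] u0(2) by (simp add: w0_def Q_def)
  have u_eq: "u t = (?T t w0 + Y F t) + Q" for t by (simp add: u_def sol_def w0_def F_def)
  have vD: "?T t w0 + Y F t \<in> D" if "0 \<le> t" for t
    using that w0 F by (intro D_intros T_D Y_D)
  have uW: "u t \<in> WA L 2" if "0 \<le> t" for t
    unfolding u_eq by (rule WA_add[OF D_WA[OF vD[OF that]] Q])
  define u' where "u' t = ?T t (A w0) + ?T t F" for t
  \<comment> \<open>The term \<open>- F\<close> from \<open>A_Y\<close> is cancelled by
    \<open>A Q = F\<close>. Here \<open>A\<close> acts on all of \<open>WA L 2\<close>, since
    \<open>Q\<close> need not lie in \<open>D\<close>.\<close>
  have Au: "A (u t) = u' t" if t: "0 \<le> t" for t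
  proof -
    have "A (u t) = A (?T t w0 + Y F t) + F" unfolding u_eq F_def by (rule A_WA_add[OF D_WA[OF vD[OF t, unfolded F_def]] Q])
    also have "A (?T t w0 + Y F t) = A (?T t w0) + A (Y F t)"
      by (rule A_WA_add[OF D_WA[OF T_D[OF w0 t]] D_WA[OF Y_D[OF F t]]])
    also have "\<dots> = ?T t (A w0) + (?T t F - F)" by (simp only: A_T[OF w0 t] A_Y[OF F t])
    finally show ?thesis by (simp add: u'_def)
  qed
  have u'_cont: "continuous_on {0..} u'"
    unfolding u'_def by (intro continuous_on_add T_cont F A_X w0)
  have deriv: "(u has_vector_derivative u' t) (at t within {0..})" if t: "0 \<le> t" for t
  proof -
    have "((\<lambda>t. (?T t w0 + Y F t) + Q) has_vector_derivative (?T t (A w0) + ?T t F) + 0) (at t within {0..})"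
      by (intro has_vector_derivative_add T_derivative w0 t Y_derivative F has_vector_derivative_const)
    then show ?thesis unfolding u_eq[abs_def, symmetric] u'_def by (simp add: u_eq)
  qed
  obtain C where C: "0 \<le> C" "\<And>w. w \<in> WA L 2 \<Longrightarrow> normW L 2 w \<le> C * (norm w + norm (A w))"
    using normW_bound by blast
  \<comment> \<open>Continuity of \<open>u\<close> and of \<open>A u = u'\<close> in L^1 is
    continuity of \<open>u\<close> in the graph norm. At the initial time this uses that the
    identity \<open>A u = u'\<close> includes \<open>t = 0\<close>.\<close>
  have Wcont: "((\<lambda>s. normW L 2 (u s - u t)) \<longlongrightarrow> 0) (at t within {0..})" if t: "0 \<le> t" for t
  proof (rule tendsto_sandwich[where f = "\<lambda>_. 0" and h = "\<lambda>s. C * (norm (u s - u t) + norm (u' s - u' t))"])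
    have ut: "(u \<longlongrightarrow> u t) (at t within {0..})"
      using has_vector_derivative_continuous[OF deriv[OF t]] by (simp add: continuous_within)
    have u't: "(u' \<longlongrightarrow> u' t) (at t within {0..})"
      using u'_cont t by (auto simp: continuous_on_def)
    have "((\<lambda>s. C * (norm (u s - u t) + norm (u' s - u' t))) \<longlongrightarrow> C * (norm (u t - u t) + norm (u' t - u' t))) (at t within {0..})"
      by (intro tendsto_intros ut u't)
    then show "((\<lambda>s. C * (norm (u s - u t) + norm (u' s - u' t))) \<longlongrightarrow> 0) (at t within {0..})" by simp
    show "\<forall>\<^sub>F s in at t within {0..}. 0 \<le> normW L 2 (u s - u t)"
      by (intro always_eventually allI) (simp add: normW_def sum_nonneg)
    show "\<forall>\<^sub>F s in at t within {0..}. normW L 2 (u s - u t) \<le> C * (norm (u s - u t) + norm (u' s - u' t))"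
      unfolding eventually_at_filter
    proof (intro always_eventually allI impI)
      fix s :: real assume "s \<in> {0..}"
      then have s: "0 \<le> s" by simp
      have "normW L 2 (u s - u t) \<le> C * (norm (u s - u t) + norm (A (u s - u t)))"
        by (rule C(2)[OF WA_diff[OF uW[OF s] uW[OF t]]])
      also have "A (u s - u t) = u' s - u' t"
        unfolding A_WA_diff[OF uW[OF s] uW[OF t]] Au[OF s] Au[OF t] ..
      finally show "normW L 2 (u s - u t) \<le> C * (norm (u s - u t) + norm (u' s - u' t))" .
    qed
  qed simp
  have "u 0 = u0" unfolding u_eq using w0 DX by (simp add: T_0 Y_def w0_def subset_iff)
  moreover have bc: "transmission I L lam K \<epsilon> (u t) \<and> (\<forall>i. vale I L (u t) i = vale I L u0 i)" if "0 \<le> t" for t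
    using diff_lifting_D_iff[OF q uW[OF that]] vD[OF that] by (simp add: u_eq Q_def)
  moreover have "u' t = - arcscale lam (wder L (u t)) + \<epsilon> *\<^sub>R wder L (wder L (u t))" if "0 < t" for t
    using Au[of t] that by (simp add: advdiff_def)
  ultimately have "is_solution I L lam K \<epsilon> u0 u"
    unfolding is_solution_def using uW Wcont u'_cont deriv
    by (intro conjI allI impI exI[of _ u']) auto
  then show ?thesis by (simp add: u_def Q_def)
qed

text \<open>Subtracting one common lifting from both solutions shows that their difference lies in
  \<open>D\<close> for positive times. It solves the homogeneous equation with initial value
  zero.\<close>

lemma solution_unique:
  assumes u: "is_solution I L lam K \<epsilon> u0 u" and v: "is_solution I L lam K \<epsilon> u0 v" and t: "0 \<le> t"
  shows "u t = v t"
proof -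
  obtain q where q: "is_lifting I L u0 q" using lifting_exists by blast
  have sol: "w t - of_funs L q \<in> D" "w t \<in> WA L 2" if "is_solution I L lam K \<epsilon> u0 w" "0 < t" for w t
    using that diff_lifting_D_iff[OF q, of "w t"] unfolding is_solution_def by auto
  have deriv: "\<exists>w'. continuous_on {0..} w' \<and>
      (\<forall>t\<ge>0. (w has_vector_derivative w' t) (at t within {0..})) \<and> (\<forall>t>0. w' t = A (w t))"
    if "is_solution I L lam K \<epsilon> u0 w" for w
    using that unfolding is_solution_def advdiff_def by (simp add: algebra_simps) 
  obtain u' where u': "continuous_on {0..} u'" "\<And>t. 0 \<le> t \<Longrightarrow> (u has_vector_derivative u' t) (at t within {0..})"
    "\<And>t. 0 < t \<Longrightarrow> u' t = A (u t)" using deriv[OF u] by blast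
  obtain v' where v': "continuous_on {0..} v'" "\<And>t. 0 \<le> t \<Longrightarrow> (v has_vector_derivative v' t) (at t within {0..})"
    "\<And>t. 0 < t \<Longrightarrow> v' t = A (v t)" using deriv[OF v] by blast
  have "u t - v t = 0"
  proof (rule cauchy_problem_unique[where v = "\<lambda>t. u t - v t" and v' = "\<lambda>t. u' t - v' t"])
    show "((\<lambda>t. u t - v t) has_vector_derivative u' t - v' t) (at t within {0..})" if "0 \<le> t" for t
      by (intro has_vector_derivative_diff u' v' that)
    show "continuous_on {0..} (\<lambda>t. u' t - v' t)" by (intro continuous_on_diff u' v')
    show "u t - v t \<in> D \<and> u' t - v' t = A (u t - v t)" if t: "0 < t" for t
    proof
      have "(u t - of_funs L q) - (v t - of_funs L q) \<in> D" by (intro D_intros sol u v t)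
      then show "u t - v t \<in> D" by simp
      show "u' t - v' t = A (u t - v t)"
        unfolding u'(3)[OF t] v'(3)[OF t] by (rule A_WA_diff[OF sol(2)[OF u t] sol(2)[OF v t], symmetric])
    qed
    show "u 0 - v 0 = 0" using u v unfolding is_solution_def by simp
  qed (rule t)
  then show ?thesis by simp
qed

lemma sol_formula:
  assumes q: "is_lifting I L u0 q" and t: "0 \<le> t"
  shows "(\<lambda>s. tau I L lam K \<epsilon> (t - s) (of_funs L (forcing L lam \<epsilon> q))) integrable_on {0..t}"
    and "sol u0 (of_funs L q) t = tau I L lam K \<epsilon> t (u0 - of_funs L q)
      + integral {0..t} (\<lambda>s. tau I L lam K \<epsilon> (t - s) (of_funs L (forcing L lam \<epsilon> q))) + of_funs L q"
proof -
  have "A (of_funs L q) \<in> L1A L" by (rule A_in[OF wders(3)[OF lifting_sobolev2[OF q]]])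
  from Y_reflect[OF this t]
  have "((\<lambda>s. tau I L lam K \<epsilon> (t - s) (of_funs L (forcing L lam \<epsilon> q))) has_integral Y (A (of_funs L q)) t) {0..t}"
    unfolding A_lifting[OF q] .
  then show "(\<lambda>s. tau I L lam K \<epsilon> (t - s) (of_funs L (forcing L lam \<epsilon> q))) integrable_on {0..t}"
    "sol u0 (of_funs L q) t = tau I L lam K \<epsilon> t (u0 - of_funs L q)
      + integral {0..t} (\<lambda>s. tau I L lam K \<epsilon> (t - s) (of_funs L (forcing L lam \<epsilon> q))) + of_funs L q"
    by (auto simp: sol_def integral_unique)
qed

end

theorem theorem2p1:
  fixes I :: "'m::finite set"
    and L lam :: "'m \<Rightarrow> real"
    and K :: "'m \<Rightarrow> 'm \<Rightarrow> real"
    and \<epsilon> :: real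
    and u0 :: "'m l1"
  assumes "I \<noteq> {}" and "- I \<noteq> {}"
    and "\<And>i. L i > 0" and "\<And>i. lam i > 0"
    and "\<And>i j. K i j \<ge> 0" and "\<And>i j. K i j = K j i"
    and "\<epsilon> > 0"
    and "u0 \<in> WA L 2"
    and "transmission I L lam K \<epsilon> u0"
  shows "\<exists>u. is_solution I L lam K \<epsilon> u0 u \<and>
    (\<forall>v. is_solution I L lam K \<epsilon> u0 v \<longrightarrow> (\<forall>t\<ge>0. v t = u t)) \<and>
    (\<forall>q. is_lifting I L u0 q \<longrightarrow>
      (\<forall>t\<ge>0. (\<lambda>s. tau I L lam K \<epsilon> (t - s) (of_funs L (forcing L lam \<epsilon> q))) integrable_on {0..t} \<and>
        u t = tau I L lam K \<epsilon> t (u0 - of_funs L q)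
            + integral {0..t} (\<lambda>s. tau I L lam K \<epsilon> (t - s) (of_funs L (forcing L lam \<epsilon> q)))
            + of_funs L q))"
proof -
  interpret network I L lam K \<epsilon> by standard fact+
  obtain q where q: "is_lifting I L u0 q" using lifting_exists by blast
  let ?u = "sol u0 (of_funs L q)"
  have u: "is_solution I L lam K \<epsilon> u0 (sol u0 (of_funs L p))" if "is_lifting I L u0 p" for p
    by (rule sol_is_solution[OF assms(8,9) that])
  show ?thesis
  proof (intro exI[of _ ?u] conjI allI impI)
    show "is_solution I L lam K \<epsilon> u0 ?u" by (rule u[OF q])
    show "v t = ?u t" if "is_solution I L lam K \<epsilon> u0 v" "0 \<le> t" for v t
      by (rule solution_unique[OF that(1) u[OF q] that(2)])
  next
    fix p t assume p: "is_lifting I L u0 p" and t: "(0::real) \<le> t"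
    show "(\<lambda>s. tau I L lam K \<epsilon> (t - s) (of_funs L (forcing L lam \<epsilon> p))) integrable_on {0..t}"
      by (rule sol_formula(1)[OF p t])
    \<comment> \<open>The formula for any other lifting \<open>p\<close> also defines a solution,
      which by uniqueness is the same one.\<close>
    show "?u t = tau I L lam K \<epsilon> t (u0 - of_funs L p)
        + integral {0..t} (\<lambda>s. tau I L lam K \<epsilon> (t - s) (of_funs L (forcing L lam \<epsilon> p))) + of_funs L p"
      unfolding sol_formula(2)[OF p t, symmetric] by (rule solution_unique[OF u[OF q] u[OF p] t])
  qed
qed

end
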